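(* Let $m\ge 2$ be an integer, and let $B=\sum_{i=1}^{m-1}B_i$ and $\mathcal{C}$ be two plane curves in $\mathbb{P}^2$ with no common components. Assume that the degree of $\mathcal{B}:=\sum_{i=1}^{m-1} i\cdot B_i$ is divisible by $m$, that all irreducible components of $\mathcal{C}$ are smooth, and that $\mathcal{C}$ is smooth at all intersection points of $\mathcal{C}$ and $B$. Let $\phi_{\mathcal{B}}:X_{\mathcal{B}}\to\mathbb{P}^2$ be the cyclic cover of degree $m$ branched at $\mathcal{B}$, put $n:=\deg\mathcal{B}/m$, and let $F_{\mathcal{B}}\in \mathrm{H}^0(\mathbb{P}^2,\mathcal{O}(mn))$ be a global section defining $\mathcal{B}$. Then, for a positive divisor $\lambda$ of $m$, say $m=\mu\lambda$, the following conditions are equivalent: (i) $c_{\mathcal{B}}(\mathcal{C})=\lambda$, where $c_{\mathcal{B}}(\mathcal{C}):=c_{\phi_{\mathcal{B}}}(\mathcal{C})$ is the connected number of $\mathcal{C}$ for $\phi_{\mathcal{B}}$; (ii) $\lambda$ is the maximal divisor of $m$ such that (with $\mu=m/\lambda$) there exists a continuous map $h:\mathcal{C}\to\mathcal{T}_{\mu n}$ satisfying the following conditions: (a) $p_{\mu n}\circ h=\mathrm{id}_{\mathcal{C}}$; (b) $h^{\lambda}=h^{\otimes\lambda}:\mathcal{C}\to\mathcal{T}_{\mu n}^{\otimes\lambda}=\mathcal{T}_{mn}$ coincides with the restriction $F_{\mathcal{B}}|_{\mathcal{C}}$ of $F_{\mathcal{B}}$ to $\mathcal{C}$; (c) for each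 irreducible component $C$ of $\mathcal{C}$, there exists a global section $g_C\in\mathrm{H}^0(\mathbb{P}^2,\mathcal{O}(\mu n))$ such that $h|_C=g_C|_C$.
   Context: $\mathbb{P}^2=\mathbb{P}^2_{\mathbb{C}}$; a plane curve is a reduced (effective) divisor on $\mathbb{P}^2$; some of the $B_i$ may be zero, and $B=\sum B_i$ is reduced. For an integer $d$, $p_d:\mathcal{T}_d\to\mathbb{P}^2$ denotes the line bundle associated to the invertible sheaf $\mathcal{O}(d)$; a global section $F\in\mathrm{H}^0(\mathbb{P}^2,\mathcal{O}(d))$ is identified with the corresponding section $F:\mathbb{P}^2\to\mathcal{T}_d$ of $p_d$. Continuity is with respect to the classical topology. Cyclic cover of degree $m$ branched at $\mathcal{B}$: with $\deg\mathcal{B}=mn$, let $t_n\in\mathrm{H}^0(\mathcal{T}_n,p_n^{\ast}\mathcal{O}(n))$ be a tautological section and let $X'_{\mathcal{B}}\subset\mathcal{T}_n$ be defined by $t_n^m=p_n^{\ast}F_{\mathcal{B}}$. Then $X_{\mathcal{B}}$ is the normalization of $X'_{\mathcal{B}}$, and $\phi_{\mathcal{B}}:X_{\mathcal{B}}\to\mathbb{P}^2$ is the composition of the normalization $X_{\mathcal{B}}\to X'_{\mathcal{B}}$ with $p_n$. Connected number: for a Galois cover $\phi:X\to Y$ of a smooth variety $Y$ branched along $B$, and an algebraic subset $C\subset Y$ none of whose irreducible components is contained in $B$ and such that $C\setminus B$ is connected, $c_\phi(C)$ is the number of connected components of $\phi^{-1}(C\setminus B)$. *)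

theory Defs
  imports
    "HOL-Analysis.Analysis"
    "HOL-Computational_Algebra.Computational_Algebra"
    "HOL-Computational_Algebra.Field_as_Ring"
begin

section \<open>Forms on the projective plane\<close>

text \<open>
  The ring of polynomials in three variables over the complex numbers is realised as an iterated
  polynomial ring: \<open>coeff (coeff (coeff F k) j) i\<close> is the coefficient of
  \<open>x\<^sub>1^i x\<^sub>2^j x\<^sub>3^k\<close>.
\<close>

type_synonym poly3 = "complex poly poly poly"

definition eval3 :: "poly3 \<Rightarrow> complex ^ 3 \<Rightarrow> complex" where
  "eval3 F z = poly (poly (poly F [:[:z $ 3:]:]) [:z $ 2:]) (z $ 1)"

text \<open>
  The forms of degree \<open>d\<close> (including 0) are the global sections of \<open>O(d)\<close>. Effective divisors
  are given by nonzero forms up to a constant factor, plane curves (reduced divisors) by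
  squarefree ones; the zero divisor is given by a nonzero constant.
\<close>

definition homogeneous :: "nat \<Rightarrow> poly3 \<Rightarrow> bool" where
  "homogeneous d F \<longleftrightarrow> (\<forall>i j k. coeff (coeff (coeff F k) j) i \<noteq> 0 \<longrightarrow> i + j + k = d)"

definition same_divisor :: "poly3 \<Rightarrow> poly3 \<Rightarrow> bool" where
  "same_divisor F G \<longleftrightarrow> F dvd G \<and> G dvd F"

definition component :: "poly3 \<Rightarrow> poly3 \<Rightarrow> bool" where
  "component P H \<longleftrightarrow> irreducible P \<and> P dvd H"

definition smooth_at :: "poly3 \<Rightarrow> complex ^ 3 \<Rightarrow> bool" where
  "smooth_at H z \<longleftrightarrow>
     eval3 (map_poly (map_poly pderiv) H) z \<noteq> 0 \<or>
     eval3 (map_poly pderiv H) z \<noteq> 0 \<or>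
     eval3 (pderiv H) z \<noteq> 0"

section \<open>The projective plane and its line bundles, with the classical topology\<close>

definition quotient_topology :: "'a topology \<Rightarrow> ('a \<Rightarrow> 'b) \<Rightarrow> 'b topology" where
  "quotient_topology X q =
     topology (\<lambda>U. U \<subseteq> q ` topspace X \<and> openin X {x \<in> topspace X. q x \<in> U})"

lemma openin_quotient_topology:
  "openin (quotient_topology X q) U \<longleftrightarrow>
     U \<subseteq> q ` topspace X \<and> openin X {x \<in> topspace X. q x \<in> U}"
proof -
  have "istopology (\<lambda>U. U \<subseteq> q ` topspace X \<and> openin X {x \<in> topspace X. q x \<in> U})"
    unfolding istopology_def
  proof (intro conjI allI impI)
    fix S T
    assume "S \<subseteq> q ` topspace X \<and> openin X {x \<in> topspace X. q x \<in> S}"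
      and "T \<subseteq> q ` topspace X \<and> openin X {x \<in> topspace X. q x \<in> T}"
    moreover have "{x \<in> topspace X. q x \<in> S \<inter> T} =
        {x \<in> topspace X. q x \<in> S} \<inter> {x \<in> topspace X. q x \<in> T}" by auto
    ultimately show "S \<inter> T \<subseteq> q ` topspace X" "openin X {x \<in> topspace X. q x \<in> S \<inter> T}"
      by auto
  next
    fix \<K>
    assume K: "\<forall>K\<in>\<K>. K \<subseteq> q ` topspace X \<and> openin X {x \<in> topspace X. q x \<in> K}"
    then show "\<Union>\<K> \<subseteq> q ` topspace X" by auto
    have "{x \<in> topspace X. q x \<in> \<Union>\<K>} = (\<Union>K\<in>\<K>. {x \<in> topspace X. q x \<in> K})" by auto
    with K show "openin X {x \<in> topspace X. q x \<in> \<Union>\<K>}" by auto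
  qed
  then show ?thesis
    unfolding quotient_topology_def by (simp add: topology_inverse')
qed

lemma quotient_map_quotient_topology: "quotient_map X (quotient_topology X q) q"
proof -
  have "topspace (quotient_topology X q) = q ` topspace X"
  proof
    show "topspace (quotient_topology X q) \<subseteq> q ` topspace X"
      using openin_quotient_topology[of X q] openin_topspace by blast
    have "{x \<in> topspace X. q x \<in> q ` topspace X} = topspace X" by auto
    then have "openin (quotient_topology X q) (q ` topspace X)"
      by (simp add: openin_quotient_topology)
    then show "q ` topspace X \<subseteq> topspace (quotient_topology X q)"
      by (rule openin_subset)
  qed
  then show ?thesis
    by (simp add: quotient_map_def openin_quotient_topology)
qed

type_synonym pt = "(complex ^ 3) set"
type_synonym bundle_pt = "((complex ^ 3) \<times> complex) set"

definition proj_pt :: "complex ^ 3 \<Rightarrow> pt" where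
  "proj_pt z = {c *s z | c. c \<noteq> 0}"

definition P2 :: "pt topology" where
  "P2 = quotient_topology (top_of_set (- {0})) proj_pt"

definition locus :: "poly3 \<Rightarrow> pt set" where
  "locus H = {proj_pt z | z. z \<noteq> 0 \<and> eval3 H z = 0}"

text \<open>
  The total space of \<open>O(d)\<close> is the quotient of the product of the punctured 3-space and the line
  by the action \<open>c \<cdot> (z, s) = (c z, c^d s)\<close>. A point over \<open>proj_pt z\<close> is thus the graph of
  a function on the punctured line through \<open>z\<close> that is homogeneous of degree \<open>d\<close>; this is why the
  projection, the sections and the tensor powers below are images of sets of representatives.
\<close>

definition bundle_point :: "nat \<Rightarrow> (complex ^ 3) \<times> complex \<Rightarrow> bundle_pt" where
  "bundle_point d = (\<lambda>(z, s). {(c *s z, c ^ d * s) | c. c \<noteq> 0})"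

definition total_space :: "nat \<Rightarrow> bundle_pt topology" where
  "total_space d = quotient_topology (top_of_set ((- {0}) \<times> UNIV)) (bundle_point d)"

definition bundle_proj :: "bundle_pt \<Rightarrow> pt" where
  "bundle_proj \<tau> = fst ` \<tau>"

definition bundle_section :: "poly3 \<Rightarrow> pt \<Rightarrow> bundle_pt" where
  "bundle_section F x = (\<lambda>z. (z, eval3 F z)) ` x"

definition bundle_power :: "nat \<Rightarrow> bundle_pt \<Rightarrow> bundle_pt" where
  "bundle_power l \<tau> = (\<lambda>(z, s). (z, s ^ l)) ` \<tau>"

lemma bundle_proj_point: "bundle_proj (bundle_point d (z, s)) = proj_pt z"
  by (force simp: bundle_proj_def bundle_point_def proj_pt_def)

lemma bundle_power_point:
  "bundle_power l (bundle_point d (z, s)) = bundle_point (d * l) (z, s ^ l)"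
  by (force simp: bundle_power_def bundle_point_def power_mult_distrib power_mult)

section \<open>Normalization of a hypersurface in the total space of a line bundle\<close>

text \<open>
  Polynomials in the homogeneous coordinates \<open>x\<^sub>1, x\<^sub>2, x\<^sub>3\<close> and the tautological section \<open>t\<close>
  of the pullback of \<open>O(n)\<close>, which has weight \<open>n\<close> and is the outermost variable. Quotients of two
  such polynomials of the same weight are the rational functions on the total space of \<open>O(n)\<close>.
\<close>

type_synonym poly4 = "poly3 poly"

definition eval4 :: "poly4 \<Rightarrow> complex ^ 3 \<Rightarrow> complex \<Rightarrow> complex" where
  "eval4 G z s = eval3 (poly G [:[:[:s:]:]:]) z"

definition weighted_homogeneous :: "nat \<Rightarrow> nat \<Rightarrow> poly4 \<Rightarrow> bool" where
  "weighted_homogeneous n d G \<longleftrightarrow>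
     (\<forall>k. coeff G k \<noteq> 0 \<longrightarrow> k * n \<le> d \<and> homogeneous (d - k * n) (coeff G k))"

definition hypersurface :: "nat \<Rightarrow> poly4 \<Rightarrow> bundle_pt set" where
  "hypersurface n W = {\<tau> \<in> topspace (total_space n). \<forall>(z, s) \<in> \<tau>. eval4 W z s = 0}"

definition nonzerodivisor_mod :: "poly4 \<Rightarrow> poly4 \<Rightarrow> bool" where
  "nonzerodivisor_mod W H \<longleftrightarrow> (\<forall>K. W dvd H * K \<longrightarrow> W dvd K)"

text \<open>
  For a weighted homogeneous squarefree \<open>W\<close>, the total ring of fractions of the hypersurface
  \<open>W = 0\<close> (the product of the function fields of its components) is the quotient of
  \<open>rational_functions n W\<close> by its ideal \<open>vanishing n W\<close>. The image of \<open>local_functions n W \<tau>\<close> in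
  that quotient consists of the rational functions regular at the point \<open>\<tau>\<close>.
\<close>

definition rational_functions :: "nat \<Rightarrow> poly4 \<Rightarrow> poly4 fract set" where
  "rational_functions n W =
     {Fract G H | G H d. weighted_homogeneous n d G \<and> weighted_homogeneous n d H \<and>
        nonzerodivisor_mod W H}"

definition vanishing :: "nat \<Rightarrow> poly4 \<Rightarrow> poly4 fract set" where
  "vanishing n W =
     {Fract G H | G H d. weighted_homogeneous n d G \<and> weighted_homogeneous n d H \<and>
        nonzerodivisor_mod W H \<and> W dvd G}"

definition local_fraction :: "nat \<Rightarrow> poly4 \<Rightarrow> bundle_pt \<Rightarrow> poly4 \<Rightarrow> poly4 \<Rightarrow> bool" where
  "local_fraction n W \<tau> G H \<longleftrightarrow>
     (\<exists>d. weighted_homogeneous n d G \<and> weighted_homogeneous n d H) \<and>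
     nonzerodivisor_mod W H \<and> (\<forall>(z, s) \<in> \<tau>. eval4 H z s \<noteq> 0)"

definition local_functions :: "nat \<Rightarrow> poly4 \<Rightarrow> bundle_pt \<Rightarrow> poly4 fract set" where
  "local_functions n W \<tau> = {Fract G H | G H. local_fraction n W \<tau> G H}"

text \<open>
  The rational functions on \<open>W = 0\<close> (as elements of \<open>rational_functions n W\<close>) that are integral
  over the local ring at \<open>\<tau>\<close>.
\<close>

definition integral_functions :: "nat \<Rightarrow> poly4 \<Rightarrow> bundle_pt \<Rightarrow> poly4 fract set" where
  "integral_functions n W \<tau> =
     {a \<in> rational_functions n W.
        \<exists>k c. (\<forall>i<k. c i \<in> local_functions n W \<tau>) \<and>
          a ^ k + (\<Sum>i<k. c i * a ^ i) \<in> vanishing n W}"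

text \<open>
  The normalization is glued from the spectra of the integral closures of the coordinate rings in
  their total rings of fractions. Hence its points over a point \<open>\<tau>\<close> of the hypersurface are the
  complex-valued points of the integral closure of the local ring at \<open>\<tau>\<close>, that is, the ring
  homomorphisms \<open>\<psi>\<close> from it to the complex numbers that extend evaluation at \<open>\<tau>\<close>. A point of the
  normalization is represented as \<open>(\<tau>, \<psi>)\<close>, so that the normalization morphism is \<open>fst\<close>.
\<close>

definition integral_character ::
    "nat \<Rightarrow> poly4 \<Rightarrow> bundle_pt \<Rightarrow> (poly4 fract \<Rightarrow> complex) \<Rightarrow> bool" where
  "integral_character n W \<tau> \<psi> \<longleftrightarrow>
     \<psi> \<in> extensional (integral_functions n W \<tau>) \<and>
     (\<forall>a \<in> integral_functions n W \<tau>. \<forall>b \<in> integral_functions n W \<tau>.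
        \<psi> (a + b) = \<psi> a + \<psi> b \<and> \<psi> (a * b) = \<psi> a * \<psi> b) \<and>
     (\<forall>a \<in> vanishing n W. \<psi> a = 0) \<and>
     (\<forall>G H. local_fraction n W \<tau> G H \<longrightarrow>
        (\<forall>(z, s) \<in> \<tau>. \<psi> (Fract G H) = eval4 G z s / eval4 H z s))"

definition normalization_points ::
    "nat \<Rightarrow> poly4 \<Rightarrow> (bundle_pt \<times> (poly4 fract \<Rightarrow> complex)) set" where
  "normalization_points n W =
     {(\<tau>, \<psi>). \<tau> \<in> hypersurface n W \<and> integral_character n W \<tau> \<psi>}"

text \<open>
  The classical topology: the coarsest one in which every rational function has open domain of
  regularity and is continuous there. (The domains of regularity include the preimages of the
  standard affine charts, on which this is the coarsest topology making all regular functions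
  continuous.)
\<close>

definition normalization ::
    "nat \<Rightarrow> poly4 \<Rightarrow> (bundle_pt \<times> (poly4 fract \<Rightarrow> complex)) topology" where
  "normalization n W =
     topology_generated_by
       {{(\<tau>, \<psi>) \<in> normalization_points n W. a \<in> integral_functions n W \<tau> \<and> \<psi> a \<in> V} | a V.
          a \<in> rational_functions n W \<and> open V}"

section \<open>Cyclic covers and connected numbers\<close>

definition cyclic_equation :: "nat \<Rightarrow> poly3 \<Rightarrow> poly4" where
  "cyclic_equation m F = monom 1 m - [:F:]"

lemma eval4_cyclic_equation: "eval4 (cyclic_equation m F) z s = s ^ m - eval3 F z"
  by (simp add: eval4_def eval3_def cyclic_equation_def poly_monom poly_power)

lemma hypersurface_cyclic_equation:
  "hypersurface n (cyclic_equation m F) =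
     {\<tau> \<in> topspace (total_space n). bundle_power m \<tau> = bundle_section F (bundle_proj \<tau>)}"
proof -
  have "(\<forall>(z, s) \<in> \<tau>. s ^ m = eval3 F z) \<longleftrightarrow>
      bundle_power m \<tau> = bundle_section F (bundle_proj \<tau>)" for \<tau>
    unfolding bundle_power_def bundle_section_def bundle_proj_def
    by (auto simp: image_iff set_eq_iff split_beta) (metis fst_conv snd_conv)+
  then show ?thesis
    by (auto simp: hypersurface_def eval4_cyclic_equation)
qed

definition cyclic_cover ::
    "nat \<Rightarrow> nat \<Rightarrow> poly3 \<Rightarrow> (bundle_pt \<times> (poly4 fract \<Rightarrow> complex)) topology" where
  "cyclic_cover m n F = normalization n (cyclic_equation m F)"

definition cyclic_cover_map :: "bundle_pt \<times> (poly4 fract \<Rightarrow> complex) \<Rightarrow> pt" where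
  "cyclic_cover_map = bundle_proj \<circ> fst"

text \<open>
  The number of connected components of the preimage of \<open>C - B\<close>, with value 0 if that number is
  infinite.
\<close>

definition connected_number :: "'a topology \<Rightarrow> ('a \<Rightarrow> 'b) \<Rightarrow> 'b set \<Rightarrow> 'b set \<Rightarrow> nat" where
  "connected_number X \<phi> B C =
     card (connected_components_of (subtopology X {x \<in> topspace X. \<phi> x \<in> C - B}))"

text \<open>
  The map \<open>h\<close> is an \<open>l\<close>-th root, valued in \<open>O(k)\<close>, of \<open>F\<close> on the curve \<open>H = 0\<close>, satisfying the
  three conditions of the theorem.
\<close>

definition root_section :: "nat \<Rightarrow> nat \<Rightarrow> poly3 \<Rightarrow> poly3 \<Rightarrow> (pt \<Rightarrow> bundle_pt) \<Rightarrow> bool" where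
  "root_section l k F H h \<longleftrightarrow>
     continuous_map (subtopology P2 (locus H)) (total_space k) h \<and>
     (\<forall>x \<in> locus H. bundle_proj (h x) = x) \<and>
     (\<forall>x \<in> locus H. bundle_power l (h x) = bundle_section F x) \<and>
     (\<forall>P. component P H \<longrightarrow>
        (\<exists>g. homogeneous k g \<and> (\<forall>x \<in> locus P. h x = bundle_section g x)))"

end

theory Submission
  imports Defs "HOL-Complex_Analysis.Cauchy_Integral_Formula"
begin

text \<open>
  Over the complement of the branch curve the cover is the set of pairs \<open>(z, s)\<close> with \<open>s^m = F z\<close>,
  on which the \<open>m\<close>-th roots of unity act transitively on the connected components. If there are
  \<open>\<lambda>\<close> of them and \<open>m = \<mu> \<lambda>\<close>, a component is stable under the \<open>\<mu>\<close>-th roots of unity, so \<open>s^\<mu>\<close> is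
  a function \<open>h\<close> on \<open>C - B\<close> with \<open>h^\<lambda> = F\<close>. Conversely, such an \<open>h\<close> separates the cover into
  \<open>\<lambda>\<close> open pieces by the value of \<open>s^\<mu> / h\<close>.

  The analytic core is that a continuous homogeneous function on a smooth plane curve which is a root
  of a quotient of forms is itself a form. By Lagrange interpolation along a linear projection, it is
  a polynomial in the last coordinate whose coefficients are traces of functions with denominator the
  derivative of the equation. On a smooth curve these traces are \<open>o(1 / (x - x\<^sub>0))\<close> at a branch
  point of the projection, also at infinity, hence polynomials of bounded degree. The same
  statement, for the values \<open>\<plusminus>1\<close> and for the inverse of a second form, shows that an
  irreducible smooth curve minus finitely many points is connected and that two curves meet.
\<close>

text \<open>The overview treats the cover as a set of pairs \<open>(z, s)\<close>, but the
  normalization is defined through characters of integral closures. Where \<open>F\<close> is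
  nonzero, an integral function must therefore be shown to be congruent modulo
  \<open>vanishing\<close> to a fraction regular at the point. A norm turns its denominator into a
  form \<open>r\<close> on the plane, and each prime of \<open>r\<close> not dividing
  \<open>F\<close> cancels, because the cover is reduced modulo such a prime. So each such point
  carries one character, and the cover there is \<open>E\<close> up to scaling. Sections are treated
  as homogeneous functions on cones in affine 3-space. A shear puts a point off the curve at
  \<open>(0, 0, 1)\<close>; the equation is then monic in the last coordinate up to a constant, and
  no root of a fibre escapes to infinity. Smoothness of the curve on the branch curve has a global
  role. The function \<open>h\<close> lives only off the branch curve and extends over each
  component as a form. Components cross at singular points of their union, hence off the branch
  curve, where both forms equal \<open>h\<close>. So the forms glue, and the components stay
  connected to each other after the branch curve is removed.\<close>

definition ev :: "poly3 \<Rightarrow> complex \<Rightarrow> complex \<Rightarrow> complex \<Rightarrow> complex" where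
  "ev F x w y = poly (poly (poly F [:[:y:]:]) [:w:]) x"

lemma eval3_ev: "eval3 F z = ev F (z $ 1) (z $ 2) (z $ 3)"
  by (simp add: eval3_def ev_def)

lemma ev_0 [simp]: "ev 0 x w y = 0" and ev_1 [simp]: "ev 1 x w y = 1"
  and ev_const [simp]: "ev [:[:[:c:]:]:] x w y = c"
  and ev_add [simp]: "ev (F + G) x w y = ev F x w y + ev G x w y"
  and ev_diff [simp]: "ev (F - G) x w y = ev F x w y - ev G x w y"
  and ev_minus [simp]: "ev (- F) x w y = - ev F x w y"
  and ev_mult [simp]: "ev (F * G) x w y = ev F x w y * ev G x w y"
  and ev_power [simp]: "ev (F ^ k) x w y = ev F x w y ^ k"
  by (simp_all add: ev_def poly_power)

lemma ev_sum [simp]: "ev (sum f I) x w y = (\<Sum>i\<in>I. ev (f i) x w y)"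
  by (induction I rule: infinite_finite_induct) auto

lemma ev_prod [simp]: "ev (prod f I) x w y = (\<Prod>i\<in>I. ev (f i) x w y)"
  by (induction I rule: infinite_finite_induct) auto

lemma ev_pCons: "ev (pCons c F) x w y = poly (poly c [:w:]) x + y * ev F x w y"
  by (simp add: ev_def)

text \<open>The map \<open>c\<close> embeds infinitely many scalars as constants of the coefficient
  ring, so finiteness of root sets eliminates the variables of a nested polynomial one at a
  time.\<close>

lemma poly_zero_on_range:
  fixes q :: "'a::idom poly"
  assumes "inj_on c A" "infinite A" "\<And>w. w \<in> A \<Longrightarrow> poly q (c w) = 0"
  shows "q = 0"
proof (rule ccontr)
  assume "q \<noteq> 0"
  then have "finite {x. poly q x = 0}" by (rule poly_roots_finite)
  moreover have "c ` A \<subseteq> {x. poly q x = 0}" using assms by auto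
  ultimately show False using assms finite_imageD finite_subset by metis
qed

lemma ev_zero:
  assumes "\<And>x w y. ev F x w y = 0"
  shows "F = 0"
proof -
  have inf: "infinite (UNIV :: complex set)" by (rule infinite_UNIV_char_0)
  have 1: "poly (poly F [:[:y:]:]) [:w:] = 0" for y w
    using assms unfolding ev_def by (intro poly_zero_on_range[of id, OF _ inf]) auto
  have 2: "poly F [:[:y:]:] = 0" for y
    using 1 by (intro poly_zero_on_range[of "\<lambda>w. [:w:]", OF _ inf]) (auto intro: injI)
  show ?thesis
    using 2 by (intro poly_zero_on_range[of "\<lambda>w. [:[:w:]:]", OF _ inf]) (auto intro: injI)
qed

lemma ev_eqI: "(\<And>x w y. ev F x w y = ev G x w y) \<Longrightarrow> F = G"
  using ev_zero[of "F - G"] by simp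

section \<open>Derivatives\<close>

abbreviation "D1 \<equiv> map_poly (map_poly pderiv) :: poly3 \<Rightarrow> poly3"
abbreviation "D2 \<equiv> map_poly pderiv :: poly3 \<Rightarrow> poly3"
abbreviation "D3 \<equiv> pderiv :: poly3 \<Rightarrow> poly3"

lemma poly2_chain:
  fixes q :: "complex poly poly"
  assumes "(f has_field_derivative f') (at t within S)" "(g has_field_derivative g') (at t within S)"
  shows "((\<lambda>t. poly (poly q [:g t:]) (f t)) has_field_derivative
      poly (poly (map_poly pderiv q) [:g t:]) (f t) * f' + poly (poly (pderiv q) [:g t:]) (f t) * g')
      (at t within S)"
proof (induction q)
  case (pCons c q)
  have c: "((\<lambda>t. poly c (f t)) has_field_derivative poly (pderiv c) (f t) * f') (at t within S)"
    using DERIV_chain2[OF poly_DERIV assms(1)] by simp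
  show ?case
    by (simp add: map_poly_pCons pderiv_pCons)
      (rule derivative_eq_intros c assms(2) pCons.IH refl | simp add: algebra_simps)+
qed simp

text \<open>The bridge between formal partials and analysis: identities among \<open>D1\<close>,
  \<open>D2\<close>, \<open>D3\<close> are later read off from uniqueness of a derivative along a
  line, without computing with nested coefficients.\<close>

lemma ev_chain:
  assumes "(f has_field_derivative f') (at t within S)" "(g has_field_derivative g') (at t within S)"
    "(h has_field_derivative h') (at t within S)"
  shows "((\<lambda>t. ev F (f t) (g t) (h t)) has_field_derivative
      ev (D1 F) (f t) (g t) (h t) * f' + ev (D2 F) (f t) (g t) (h t) * g'
        + ev (D3 F) (f t) (g t) (h t) * h') (at t within S)"
proof (induction F)
  case (pCons c F)
  show ?case
    by (simp add: map_poly_pCons pderiv_pCons ev_pCons)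
      (rule derivative_eq_intros poly2_chain[OF assms(1,2)] assms(3) pCons.IH refl
        | simp add: algebra_simps)+
qed simp

lemma continuous_on_poly2:
  fixes q :: "complex poly poly"
  assumes "continuous_on S f" "continuous_on S g"
  shows "continuous_on S (\<lambda>t. poly (poly q [:g t:]) (f t))"
  by (induction q) (auto intro!: continuous_intros assms)

lemma continuous_on_ev [continuous_intros]:
  assumes "continuous_on S f" "continuous_on S g" "continuous_on S h"
  shows "continuous_on S (\<lambda>t. ev F (f t) (g t) (h t))"
  by (induction F) (auto simp: ev_pCons intro!: continuous_intros continuous_on_poly2 assms)

lemma tendsto_poly2:
  fixes q :: "complex poly poly"
  assumes "(f \<longlongrightarrow> a) G" "(g \<longlongrightarrow> b) G"
  shows "((\<lambda>t. poly (poly q [:g t:]) (f t)) \<longlongrightarrow> poly (poly q [:b:]) a) G"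
  by (induction q) (auto intro!: tendsto_intros assms)

lemma tendsto_ev [tendsto_intros]:
  assumes "(f \<longlongrightarrow> a) G" "(g \<longlongrightarrow> b) G" "(h \<longlongrightarrow> c) G"
  shows "((\<lambda>t. ev F (f t) (g t) (h t)) \<longlongrightarrow> ev F a b c) G"
  by (induction F) (auto simp: ev_pCons intro!: tendsto_intros tendsto_poly2 assms)

text \<open>A product of two functions vanishing at a point has zero derivative along every line
  through it. This makes a union of two curves singular where they cross.\<close>

lemma partials_mult_at_zero:
  assumes "ev F x w y = 0" "ev G x w y = 0"
  shows "ev (D1 (F * G)) x w y = 0" "ev (D2 (F * G)) x w y = 0" "ev (D3 (F * G)) x w y = 0"
proof -
  have *: "ev (D1 (F * G)) x w y * a + ev (D2 (F * G)) x w y * b + ev (D3 (F * G)) x w y * c = 0"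
    for a b c
  proof -
    have d: "((\<lambda>t. x + t * a) has_field_derivative a) (at 0)"
      "((\<lambda>t. w + t * b) has_field_derivative b) (at 0)"
      "((\<lambda>t. y + t * c) has_field_derivative c) (at 0)"
      by (auto intro!: derivative_eq_intros)
    have "((\<lambda>t. ev F (x + t * a) (w + t * b) (y + t * c) * ev G (x + t * a) (w + t * b) (y + t * c))
        has_field_derivative 0) (at 0)"
      by (rule derivative_eq_intros ev_chain[OF d] refl | simp add: assms)+
    from DERIV_unique[OF ev_chain[OF d, of "F * G"]] this show ?thesis by simp
  qed
  from *[of 1 0 0] *[of 0 1 0] *[of 0 0 1]
  show "ev (D1 (F * G)) x w y = 0" "ev (D2 (F * G)) x w y = 0" "ev (D3 (F * G)) x w y = 0" by auto
qed

section \<open>Homogeneous forms\<close>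

definition dil1 :: "complex \<Rightarrow> complex poly \<Rightarrow> complex poly" where
  "dil1 c q = pcompose q [:0, c:]"
definition dil2 :: "complex \<Rightarrow> complex poly poly \<Rightarrow> complex poly poly" where
  "dil2 c q = pcompose (map_poly (dil1 c) q) [:0, [:c:]:]"
definition dil :: "complex \<Rightarrow> poly3 \<Rightarrow> poly3" where
  "dil c F = pcompose (map_poly (dil2 c) F) [:0, [:[:c:]:]:]"

lemma dil1_0 [simp]: "dil1 c 0 = 0" and dil2_0 [simp]: "dil2 c 0 = 0"
  by (simp_all add: dil1_def dil2_def)

lemma coeff_dil:
  "coeff (coeff (coeff (dil c F) k) j) i = c ^ (i + j + k) * coeff (coeff (coeff F k) j) i"
  by (simp add: dil_def dil2_def dil1_def coeff_pcompose_linear coeff_map_poly poly_const_pow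
      power_add pCons_one[symmetric] del: pCons_one)

lemma poly_dil1: "poly (dil1 c q) x = poly q (c * x)"
  by (simp add: dil1_def poly_pcompose mult.commute)

lemma poly_dil2: "poly (poly (dil2 c q) [:w:]) x = poly (poly q [:c * w:]) (c * x)"
proof -
  have "poly (poly (map_poly (dil1 c) q) [:u:]) x = poly (poly q [:u:]) (c * x)" for u
    by (induction q) (simp_all add: map_poly_pCons poly_dil1)
  from this[of "c * w"] show ?thesis
    by (simp add: dil2_def poly_pcompose mult.commute)
qed

lemma ev_dil: "ev (dil c F) x w y = ev F (c * x) (c * w) (c * y)"
proof -
  have "ev (map_poly (dil2 c) F) x w u = ev F (c * x) (c * w) u" for u
    by (induction F) (simp_all add: map_poly_pCons poly_dil2 ev_pCons)
  from this[of "c * y"] show ?thesis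
    by (simp add: dil_def ev_def poly_pcompose mult.commute)
qed

lemma homogeneous_ev:
  assumes "homogeneous d F"
  shows "ev F (c * x) (c * w) (c * y) = c ^ d * ev F x w y"
proof -
  have "dil c F = [:[:[:c ^ d:]:]:] * F"
    using assms by (intro poly_eqI) (auto simp: coeff_dil homogeneous_def)
  then show ?thesis
    by (metis ev_dil ev_mult ev_const)
qed

text \<open>One scalar is enough because the powers of 2 are distinct: comparing the coefficients of
  \<open>dil 2 F\<close> and \<open>F\<close> fixes the total degree of each monomial.\<close>

lemma homogeneousI_ev:
  assumes "\<And>x w y. ev F (2 * x) (2 * w) (2 * y) = 2 ^ d * ev F x w y"
  shows "homogeneous d F"
proof -
  have "dil 2 F = [:[:[:2 ^ d:]:]:] * F"
    by (rule ev_eqI) (simp only: ev_dil ev_mult ev_const assms)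
  then have "2 ^ (i + j + k) * coeff (coeff (coeff F k) j) i = 2 ^ d * coeff (coeff (coeff F k) j) i"
    for i j k
    using arg_cong[of _ _ "\<lambda>G. coeff (coeff (coeff G k) j) i"] coeff_dil[of 2 F k j i] by fastforce
  then have "coeff (coeff (coeff F k) j) i \<noteq> 0 \<Longrightarrow> (2::complex) ^ (i + j + k) = 2 ^ d" for i j k
    by (metis mult_cancel_right)
  moreover have "(2::complex) ^ a = 2 ^ b \<Longrightarrow> a = b" for a b :: nat
  proof -
    assume "(2::complex) ^ a = 2 ^ b"
    then have "(2::nat) ^ a = 2 ^ b"
      by (metis of_nat_eq_iff of_nat_numeral of_nat_power)
    then show "a = b" by simp
  qed
  ultimately show ?thesis unfolding homogeneous_def by blast
qed

lemma homogeneous_0 [simp]: "homogeneous d 0"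
  by (simp add: homogeneous_def)

lemma homogeneous_const [simp]: "homogeneous 0 [:[:[:c:]:]:]"
  by (auto simp: homogeneous_def coeff_pCons split: nat.splits)

lemma homogeneous_1 [simp]: "homogeneous 0 1"
  using homogeneous_const[of 1] by (simp add: pCons_one)

lemma homogeneous_add: "homogeneous d F \<Longrightarrow> homogeneous d G \<Longrightarrow> homogeneous d (F + G)"
  by (rule homogeneousI_ev) (simp add: homogeneous_ev distrib_left)

lemma homogeneous_sum: "(\<And>i. i \<in> I \<Longrightarrow> homogeneous d (f i)) \<Longrightarrow> homogeneous d (sum f I)"
  by (induction I rule: infinite_finite_induct) (auto intro: homogeneous_add)

lemma homogeneous_minus: "homogeneous d F \<Longrightarrow> homogeneous d (- F)"
  by (simp add: homogeneous_def)

lemma homogeneous_mult: "homogeneous d F \<Longrightarrow> homogeneous k G \<Longrightarrow> homogeneous (d + k) (F * G)"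
  by (rule homogeneousI_ev) (simp add: homogeneous_ev power_add)

lemma homogeneous_prod: "(\<And>i. i \<in> I \<Longrightarrow> homogeneous (d i) (f i)) \<Longrightarrow> homogeneous (sum d I) (prod f I)"
  by (induction I rule: infinite_finite_induct) (auto intro: homogeneous_mult)

lemma homogeneous_power: "homogeneous d F \<Longrightarrow> homogeneous (d * k) (F ^ k)"
  by (rule homogeneousI_ev) (simp add: homogeneous_ev power_mult power_mult_distrib)

lemma homogeneous_D3: "homogeneous d F \<Longrightarrow> homogeneous (d - 1) (D3 F)"
  unfolding homogeneous_def by (force simp: coeff_pderiv of_nat_poly)

lemma homogeneous_unique: "homogeneous d F \<Longrightarrow> homogeneous k F \<Longrightarrow> F \<noteq> 0 \<Longrightarrow> d = k"
  unfolding homogeneous_def by (metis coeff_0 poly_eqI)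

lemma ev_curve_poly:
  "\<exists>p :: complex poly. \<forall>t. poly p t = ev F (poly p1 t) (poly p2 t) (poly p3 t)"
proof -
  have 1: "\<exists>p :: complex poly. \<forall>t. poly p t = poly (poly q [:poly p2 t:]) (poly p1 t)" for q :: "complex poly poly"
  proof (induction q)
    case 0
    then show ?case by (auto intro: exI[of _ 0])
  next
    case (pCons c q)
    then obtain p where p: "\<forall>t. poly p t = poly (poly q [:poly p2 t:]) (poly p1 t)" by blast
    show ?case by (rule exI[of _ "pcompose c p1 + p2 * p"]) (simp add: p poly_pcompose)
  qed
  show ?thesis
  proof (induction F)
    case 0
    then show ?case by (auto intro: exI[of _ 0])
  next
    case (pCons c F)
    then obtain p where p: "\<forall>t. poly p t = ev F (poly p1 t) (poly p2 t) (poly p3 t)" by blast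
    obtain q where "\<forall>t. poly q t = poly (poly c [:poly p2 t:]) (poly p1 t)" using 1 by blast
    then show ?case by (intro exI[of _ "q + p3 * p"]) (simp add: p ev_pCons)
  qed
qed

text \<open>Order at 0 and degree are both additive and agree on the product, while on each factor
  the order is at most the degree. So they agree on \<open>p\<close>, which leaves no root other
  than 0.\<close>

lemma monom_factor:
  fixes p q :: "complex poly"
  assumes "p * q = monom a d" "a \<noteq> 0"
  obtains k b where "k \<le> d" "p = monom b k"
proof -
  have nz: "p \<noteq> 0" "q \<noteq> 0" "p * q \<noteq> 0" using assms by (auto simp: monom_eq_0_iff)
  have deg: "degree p + degree q = d"
    using assms nz by (metis degree_mult_eq degree_monom_eq)
  have "monom a d = smult a ([:0, 1:] ^ d)"
    by (metis monom_altdef)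
  moreover have "order 0 ([:0, 1:] ^ d :: complex poly) = d"
    using order_power_n_n[of "0 :: complex" d] by simp
  ultimately have "order 0 (p * q) = d"
    using assms by (simp add: order_smult)
  then have ord: "order 0 p + order 0 q = d"
    using nz by (simp add: order_mult)
  have "order 0 p \<le> degree p" "order 0 q \<le> degree q"
    using nz by (auto intro: order_degree)
  with deg ord have op: "order 0 p = degree p" by linarith
  have "[:0, 1:] ^ degree p dvd p"
    using order_1[of 0 p] op by simp
  then obtain r where r: "p = [:0, 1:] ^ degree p * r" by (rule dvdE)
  with nz have "r \<noteq> 0" by auto
  then have "degree ([:0, 1:] ^ degree p * r) = degree p + degree r"
    by (subst degree_mult_eq) (auto simp: degree_power_eq)
  then have "degree r = 0" using r by simp
  then obtain b where "r = [:b:]" by (elim degree_eq_zeroE)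
  then have "p = monom b (degree p)"
    using r by (simp add: monom_altdef mult.commute)
  with deg show ?thesis by (intro that[of "degree p" b]) auto
qed

text \<open>On a line through the origin where the product is nonzero, \<open>F\<close> restricts to
  a factor of a monomial, hence to a monomial. Its exponent could depend on the line; absence of
  zero divisors makes one exponent serve for all.\<close>

lemma homogeneous_factor:
  assumes "homogeneous d (F * G)" "F * G \<noteq> 0"
  obtains k where "homogeneous k F"
proof -
  define M where "M = F * G"
  have *: "\<exists>k\<le>d. ev F (2 * x) (2 * w) (2 * y) = 2 ^ k * ev F x w y" if M: "ev M x w y \<noteq> 0" for x w y
  proof -
    obtain p where p: "\<And>t. poly p t = ev F (poly [:0, x:] t) (poly [:0, w:] t) (poly [:0, y:] t)"
      using ev_curve_poly by blast
    obtain q where q: "\<And>t. poly q t = ev G (poly [:0, x:] t) (poly [:0, w:] t) (poly [:0, y:] t)"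
      using ev_curve_poly by blast
    have "poly (p * q) t = poly (monom (ev M x w y) d) t" for t
      using homogeneous_ev[OF assms(1), of t x w y]
      by (simp add: p q poly_monom M_def mult.commute)
    then have "p * q = monom (ev M x w y) d"
      by (simp add: poly_eq_poly_eq_iff[symmetric] fun_eq_iff)
    from this M obtain k b where "k \<le> d" and k: "p = monom b k" by (rule monom_factor)
    have "ev F (2 * x) (2 * w) (2 * y) = 2 ^ k * ev F x w y"
      using p[of 1] p[of 2] by (simp add: k poly_monom mult.commute)
    with \<open>k \<le> d\<close> show ?thesis by blast
  qed
  \<comment> \<open>\<open>T k\<close> vanishes wherever the exponent is \<open>k\<close>, so the
    product of all \<open>T k\<close> with \<open>M\<close> is identically zero and some
    \<open>T k\<close> is the zero polynomial.\<close>
  define T where "T k = dil 2 F - [:[:[:2 ^ k:]:]:] * F" for k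
  have "(\<Prod>k\<le>d. T k) * M = 0"
  proof (rule ev_zero)
    fix x w y
    show "ev ((\<Prod>k\<le>d. T k) * M) x w y = 0"
    proof (cases "ev M x w y = 0")
      case False
      then obtain k where k: "k \<le> d" "ev (T k) x w y = 0"
        using *[of x w y] unfolding T_def ev_diff ev_mult ev_const ev_dil by auto
      then have "(\<Prod>k\<le>d. ev (T k) x w y) = 0" by auto
      then show ?thesis by simp
    qed simp
  qed
  then obtain k where "T k = 0"
    using assms(2) by (auto simp: M_def)
  then have "ev (T k) x w y = 0" for x w y by simp
  then have "homogeneous k F"
    by (intro homogeneousI_ev) (simp only: T_def ev_diff ev_mult ev_const ev_dil right_minus_eq)
  then show ?thesis by (rule that)
qed

lemma homogeneous_dvd:
  assumes "homogeneous d G" "F dvd G" "G \<noteq> 0"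
  obtains k where "homogeneous k F"
  using assms homogeneous_factor by (metis dvdE)

section \<open>Elimination\<close>

text \<open>Elimination without resultants: a nonzero element of least degree in the ideal of
  \<open>P\<close> and \<open>F\<close> divides both generators up to constants of the coefficient
  ring, and primality of \<open>P\<close> forces its degree to be 0.\<close>

lemma prime_elem_combination:
  fixes P F :: "'a::idom poly"
  assumes P: "prime_elem P" "degree P > 0" and F: "\<not> P dvd F"
  obtains u v r where "r \<noteq> 0" "u * P + v * F = [:r:]"
proof -
  define I where "I = {u * P + v * F | u v. True}"
  have diff: "a * f - b * g \<in> I" if "f \<in> I" "g \<in> I" for f g a b
  proof -
    from that obtain u v u' v' where "f = u * P + v * F" "g = u' * P + v' * F"
      unfolding I_def by blast
    then have "a * f - b * g = (a * u - b * u') * P + (a * v - b * v') * F"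
      by (simp add: algebra_simps)
    then show ?thesis unfolding I_def by blast
  qed
  have "P = 1 * P + 0 * F" "F = 0 * P + 1 * F" by simp_all
  then have PI: "P \<in> I" and FI: "F \<in> I" unfolding I_def by blast+
  have "P \<in> I \<and> P \<noteq> 0" using PI P by auto
  from ex_has_least_nat[of "\<lambda>f. f \<in> I \<and> f \<noteq> 0", OF this, of degree]
  obtain g where g: "g \<in> I" "g \<noteq> 0" and min: "\<And>f. f \<in> I \<Longrightarrow> f \<noteq> 0 \<Longrightarrow> degree g \<le> degree f"
    by blast
  \<comment> \<open>The pseudo-remainder stays in the ideal and has smaller degree than the minimal
    \<open>g\<close>, so it is zero. Pseudo-division replaces division over the fraction
    field.\<close>
  have div: "\<exists>c q. c \<noteq> 0 \<and> smult c f = g * q" if "f \<in> I" for f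
  proof -
    obtain q r where qr: "pseudo_divmod f g = (q, r)" by (cases "pseudo_divmod f g")
    define c where "c = coeff g (degree g) ^ (Suc (degree f) - degree g)"
    from pseudo_divmod[OF g(2) qr] have e: "smult c f = g * q + r" and r: "r = 0 \<or> degree r < degree g"
      by (auto simp: c_def)
    from e have "r = [:c:] * f - q * g" by (simp add: algebra_simps)
    then have "r \<in> I" using diff that g(1) by blast
    with r min have "r = 0" by (metis not_le)
    with e g show ?thesis by (intro exI[of _ c] exI[of _ q]) (auto simp: c_def)
  qed
  obtain c q where cq: "c \<noteq> 0" "smult c P = g * q" using div[OF PI] by blast
  obtain c' q' where cq': "c' \<noteq> 0" "smult c' F = g * q'" using div[OF FI] by blast
  have "P dvd smult c P" by (rule dvd_smult) simp
  then have "P dvd g * q" using cq(2) by simp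
  \<comment> \<open>Either \<open>P\<close> divides \<open>g\<close>, hence a constant multiple of
    \<open>F\<close>, which is impossible, or \<open>P\<close> cancels and \<open>g\<close> divides
    the constant \<open>c\<close>.\<close>
  then consider "P dvd g" | "P dvd q" using P(1) by (auto simp: prime_elem_dvd_mult_iff)
  then have "degree g = 0"
  proof cases
    case 1
    then have "P dvd g * q'" by (rule dvd_mult2)
    then have "P dvd [:c':] * F" using cq'(2) by simp
    with F have "P dvd [:c':]" using prime_elem_dvd_multD[OF P(1)] by blast
    then have False using P(2) cq'(1)
      by (metis degree_pCons_0 dvd_imp_degree_le not_le pCons_eq_0_iff)
    then show ?thesis ..
  next
    case 2
    then obtain q2 where "q = P * q2" by (rule dvdE)
    then have "P * [:c:] = P * (g * q2)" using cq(2) by (simp add: algebra_simps)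
    then have "[:c:] = g * q2" using P(1) by (metis mult_cancel_left prime_elem_not_zeroI)
    moreover from this have "q2 \<noteq> 0" using cq(1) by auto
    ultimately have "degree [:c:] = degree g + degree q2" using degree_mult_eq[OF g(2)] by metis
    then show ?thesis by simp
  qed
  then obtain r where "g = [:r:]" by (elim degree_eq_zeroE)
  with g that show ?thesis unfolding I_def by auto
qed

lemma irreducible_prime_elem3: "irreducible P \<Longrightarrow> prime_elem P" for P :: poly3
  by (rule irreducible_imp_prime_elem_gcd)

text \<open>Eliminating \<open>y\<close> leaves a nonzero \<open>r\<close> in the other two
  variables. It need not be homogeneous, but common zeros of the forms can be scaled, so
  \<open>r\<close> vanishes on a punctured line through the origin for each of them; infinitely many
  such lines force \<open>r = 0\<close>.\<close>

lemma finite_common_zeros: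
  assumes P: "irreducible P" "degree P > 0" "homogeneous e P"
    and F: "\<not> P dvd F" "homogeneous k F"
  shows "finite {x. \<exists>y. ev P x 1 y = 0 \<and> ev F x 1 y = 0}" (is "finite ?X")
proof (rule ccontr)
  assume inf: "infinite ?X"
  obtain u v r where r: "r \<noteq> 0" "u * P + v * F = [:r:]"
    by (rule prime_elem_combination[OF irreducible_prime_elem3[OF P(1)] P(2) F(1)])
  have "poly (poly r [:t:]) (t * x) = 0" if x: "x \<in> ?X" for x t
  proof -
    from x obtain y where y: "ev P x 1 y = 0" "ev F x 1 y = 0" by blast
    have "ev [:r:] (t * x) (t * 1) (t * y) = 0"
      unfolding r(2)[symmetric] ev_add ev_mult homogeneous_ev[OF P(3)] homogeneous_ev[OF F(2)] y
      by simp
    then show ?thesis by (simp add: ev_pCons)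
  qed
  then have "poly r [:t:] = 0" if "t \<noteq> 0" for t
    using that inf by (intro poly_zero_on_range[of "\<lambda>x. t * x" ?X]) (auto intro: inj_onI)
  moreover have "infinite (UNIV - {0 :: complex})"
    using infinite_UNIV_char_0 by (metis finite.emptyI finite_insert finite_Diff2)
  ultimately have "r = 0"
    by (intro poly_zero_on_range[of "\<lambda>t. [:t:]" "UNIV - {0}"]) (auto intro: inj_onI)
  with r show False by simp
qed

section \<open>Shears\<close>

lemma ev_subst_ex: "\<exists>G. \<forall>x w y. ev G x w y = ev F (ev f x w y) (ev g x w y) (ev h x w y)"
proof -
  have 0: "\<exists>G. \<forall>x w y. ev G x w y = poly p (ev f x w y)" for p
  proof (induction p)
    case (pCons c p)
    then obtain G where "\<forall>x w y. ev G x w y = poly p (ev f x w y)" by blast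
    then show ?case by (intro exI[of _ "[:[:[:c:]:]:] + f * G"]) (simp del: mult_pCons_left)
  qed (auto intro: exI[of _ 0])
  have 1: "\<exists>G. \<forall>x w y. ev G x w y = poly (poly q [:ev g x w y:]) (ev f x w y)" for q
  proof (induction q)
    case (pCons p q)
    then obtain G where "\<forall>x w y. ev G x w y = poly (poly q [:ev g x w y:]) (ev f x w y)" by blast
    moreover obtain G' where "\<forall>x w y. ev G' x w y = poly p (ev f x w y)" using 0 by blast
    ultimately show ?case by (intro exI[of _ "G' + g * G"]) simp
  qed (auto intro: exI[of _ 0])
  show ?thesis
  proof (induction F)
    case (pCons q F)
    then obtain G where "\<forall>x w y. ev G x w y = ev F (ev f x w y) (ev g x w y) (ev h x w y)" by blast
    moreover obtain G' where "\<forall>x w y. ev G' x w y = poly (poly q [:ev g x w y:]) (ev f x w y)"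
      using 1 by blast
    ultimately show ?case by (intro exI[of _ "G' + h * G"]) (simp add: ev_pCons)
  qed (auto intro: exI[of _ 0])
qed

text \<open>The linear coordinate change carrying \<open>(0, 0, 1)\<close> to
  \<open>(a, b, 1)\<close>; it serves to make a form monic in the last variable up to a constant.
  The chosen polynomial exists by \<open>ev_subst_ex\<close> and is unique by
  \<open>ev_eqI\<close>.\<close>

definition shear :: "complex \<Rightarrow> complex \<Rightarrow> poly3 \<Rightarrow> poly3" where
  "shear a b F = (SOME G. \<forall>x w y. ev G x w y = ev F (x + a * y) (w + b * y) y)"

lemma ev_shear [simp]: "ev (shear a b F) x w y = ev F (x + a * y) (w + b * y) y"
proof -
  have 1: "ev [:[:[:0, 1:]:]:] x w y = x" "ev [:[:0, 1:]:] x w y = w" "ev [:0, 1:] x w y = y" for x w y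
    by (simp_all add: ev_def)
  obtain G where "\<forall>x w y. ev G x w y = ev F (ev ([:[:[:0, 1:]:]:] + [:[:[:a:]:]:] * [:0, 1:]) x w y)
      (ev ([:[:0, 1:]:] + [:[:[:b:]:]:] * [:0, 1:]) x w y) (ev [:0, 1:] x w y)"
    using ev_subst_ex by blast
  then have "\<forall>x w y. ev G x w y = ev F (x + a * y) (w + b * y) y"
    unfolding ev_add ev_mult ev_const 1 .
  then have "\<forall>x w y. ev (shear a b F) x w y = ev F (x + a * y) (w + b * y) y"
    unfolding shear_def by (rule someI)
  then show ?thesis by blast
qed

lemma shear_mult: "shear a b (F * G) = shear a b F * shear a b G"
  and shear_1: "shear a b 1 = 1"
  and shear_inverse: "shear (- a) (- b) (shear a b F) = F"
  by (rule ev_eqI; simp)+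

lemma homogeneous_shear: "homogeneous d F \<Longrightarrow> homogeneous d (shear a b F)"
proof (rule homogeneousI_ev)
  fix x w y
  assume "homogeneous d F"
  from homogeneous_ev[OF this, of 2 "x + a * y" "w + b * y" y]
  show "ev (shear a b F) (2 * x) (2 * w) (2 * y) = 2 ^ d * ev (shear a b F) x w y"
    by (simp add: algebra_simps)
qed

lemma shear_dvd_iff: "shear a b F dvd shear a b G \<longleftrightarrow> F dvd G"
  by (metis dvdE dvdI shear_inverse shear_mult minus_minus)

lemma irreducible_shear:
  assumes "irreducible P" shows "irreducible (shear a b P)"
proof -
  have "P \<noteq> 0" "\<not> P dvd 1" and irr: "\<And>U V. P = U * V \<Longrightarrow> U dvd 1 \<or> V dvd 1"
    using assms by (auto simp: irreducible_def)
  show ?thesis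
  proof (rule irreducibleI)
    show "shear a b P \<noteq> 0"
      using \<open>P \<noteq> 0\<close> by (metis ev_0 ev_shear ev_zero shear_inverse)
    show "\<not> shear a b P dvd 1"
      using \<open>\<not> P dvd 1\<close> by (metis shear_1 shear_dvd_iff)
    fix U V assume "shear a b P = U * V"
    then have "P = shear (- a) (- b) U * shear (- a) (- b) V"
      by (metis shear_inverse shear_mult)
    then have "shear (- a) (- b) U dvd 1 \<or> shear (- a) (- b) V dvd 1" by (rule irr)
    then show "U dvd 1 \<or> V dvd 1"
      by (metis shear_1 shear_dvd_iff)
  qed
qed

lemma ev_partials_shear:
  "ev (D1 (shear a b F)) x w y = ev (D1 F) (x + a * y) (w + b * y) y"
  "ev (D2 (shear a b F)) x w y = ev (D2 F) (x + a * y) (w + b * y) y"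
  "ev (D3 (shear a b F)) x w y = a * ev (D1 F) (x + a * y) (w + b * y) y
     + b * ev (D2 F) (x + a * y) (w + b * y) y + ev (D3 F) (x + a * y) (w + b * y) y"
proof -
  have *: "ev (D1 (shear a b F)) x w y * u + ev (D2 (shear a b F)) x w y * v + ev (D3 (shear a b F)) x w y * c
    = ev (D1 F) (x + a * y) (w + b * y) y * (u + a * c) + ev (D2 F) (x + a * y) (w + b * y) y * (v + b * c)
      + ev (D3 F) (x + a * y) (w + b * y) y * c" for u v c
  proof -
    have d: "((\<lambda>t. x + t * u) has_field_derivative u) (at 0)"
      "((\<lambda>t. w + t * v) has_field_derivative v) (at 0)"
      "((\<lambda>t. y + t * c) has_field_derivative c) (at 0)"
      by (auto intro!: derivative_eq_intros)
    have d': "((\<lambda>t. (x + t * u) + a * (y + t * c)) has_field_derivative u + a * c) (at 0)"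
      "((\<lambda>t. (w + t * v) + b * (y + t * c)) has_field_derivative v + b * c) (at 0)"
      by (auto intro!: derivative_eq_intros simp: algebra_simps)
    from DERIV_unique[OF ev_chain[OF d, of "shear a b F", unfolded ev_shear] ev_chain[OF d' d(3), of F]]
    show ?thesis by simp
  qed
  from *[of 1 0 0] *[of 0 1 0] *[of 0 0 1]
  show "ev (D1 (shear a b F)) x w y = ev (D1 F) (x + a * y) (w + b * y) y"
    "ev (D2 (shear a b F)) x w y = ev (D2 F) (x + a * y) (w + b * y) y"
    "ev (D3 (shear a b F)) x w y = a * ev (D1 F) (x + a * y) (w + b * y) y
     + b * ev (D2 F) (x + a * y) (w + b * y) y + ev (D3 F) (x + a * y) (w + b * y) y"
    by (auto simp: algebra_simps)
qed

lemma homogeneous_nonzero_point: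
  assumes "homogeneous d F" "F \<noteq> 0"
  obtains a b where "ev F a b 1 \<noteq> 0"
proof -
  \<comment> \<open>The extra factor \<open>y\<close> forces the point found to lie off
    \<open>y = 0\<close>, so that it can be rescaled to last coordinate 1.\<close>
  have "F * [:0, 1:] \<noteq> 0" using assms by simp
  then obtain x w y where *: "ev (F * [:0, 1:]) x w y \<noteq> 0" using ev_zero by blast
  have "ev [:0, 1:] x w y = y" by (simp add: ev_def)
  with * have nz: "ev F x w y \<noteq> 0" "y \<noteq> 0" unfolding ev_mult by auto
  have "ev F (y * (x / y)) (y * (w / y)) (y * 1) \<noteq> 0" using nz by simp
  then have "ev F (x / y) (w / y) 1 \<noteq> 0" unfolding homogeneous_ev[OF assms(1)] by simp
  then show ?thesis by (rule that)
qed

section \<open>Slices\<close>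

text \<open>Restriction to a line through \<open>(0, 0, 1)\<close>: the roots form the fibre over
  \<open>(x, w)\<close> of the projection from that point.\<close>

definition slice :: "complex \<Rightarrow> complex \<Rightarrow> poly3 \<Rightarrow> complex poly" where
  "slice x w F = map_poly (\<lambda>c. poly (poly c [:w:]) x) F"

lemma poly_slice [simp]: "poly (slice x w F) y = ev F x w y"
  unfolding slice_def by (induction F) (simp_all add: map_poly_pCons ev_pCons)

lemma coeff_slice: "coeff (slice x w F) k = poly (poly (coeff F k) [:w:]) x"
  by (simp add: slice_def coeff_map_poly)

lemma poly_pderiv_slice [simp]: "poly (pderiv (slice x w F)) y = ev (D3 F) x w y"
proof -
  have "((\<lambda>t. poly (slice x w F) t) has_field_derivative poly (pderiv (slice x w F)) y) (at y)"
    by (rule poly_DERIV)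
  moreover have "((\<lambda>t. ev F x w t) has_field_derivative ev (D3 F) x w y) (at y)"
    using ev_chain[of "\<lambda>_. x" 0 y UNIV "\<lambda>_. w" 0 "\<lambda>t. t" 1] by simp
  ultimately show ?thesis using DERIV_unique by simp
qed

lemma coeff_homogeneous_top:
  assumes "homogeneous e F"
  shows "coeff F e = [:[:ev F 0 0 1:]:]" "k > e \<Longrightarrow> coeff F k = 0"
proof -
  have k: "coeff F k = 0" if "k > e" for k
    using assms that by (intro poly_eqI) (force simp: homogeneous_def)
  have c: "k = e \<or> coeff (coeff (coeff F k) 0) 0 = 0" for k
    using assms unfolding homogeneous_def by (metis add.left_neutral)
  have top: "coeff F e = [:[:coeff (coeff (coeff F e) 0) 0:]:]"
  proof (intro poly_eqI)
    fix j i
    show "coeff (coeff (coeff F e) j) i = coeff (coeff [:[:coeff (coeff (coeff F e) 0) 0:]:] j) i"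
      using assms unfolding homogeneous_def coeff_pCons
      by (cases j; cases i) force+
  qed
  have "ev F 0 0 1 = poly (slice 0 0 F) 1" by simp
  also have "\<dots> = (\<Sum>k\<le>degree (slice 0 0 F). coeff (slice 0 0 F) k)"
    by (simp add: poly_altdef)
  also have "\<dots> = (\<Sum>k\<le>degree (slice 0 0 F). if k = e then coeff (coeff (coeff F e) 0) 0 else 0)"
  proof (intro sum.cong refl)
    fix k show "coeff (slice 0 0 F) k = (if k = e then coeff (coeff (coeff F e) 0) 0 else 0)"
      using c[of k] by (auto simp: coeff_slice poly_0_coeff_0)
  qed
  also have "\<dots> = coeff (coeff (coeff F e) 0) 0"
  proof (cases "e \<le> degree (slice 0 0 F)")
    case False
    then have "coeff (slice 0 0 F) e = 0" by (simp add: coeff_eq_0)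
    then show ?thesis using False by (simp add: coeff_slice poly_0_coeff_0)
  qed simp
  finally show "coeff F e = [:[:ev F 0 0 1:]:]" using top by simp
  show "coeff F k = 0" if "k > e" using k[OF that] .
qed

text \<open>With \<open>(0, 0, 1)\<close> off the curve the coefficient of \<open>y ^ e\<close> is a
  nonzero constant, so no root is lost over any base point, including those with
  \<open>w = 0\<close>.\<close>

lemma slice_degree:
  assumes "homogeneous e P" "ev P 0 0 1 \<noteq> 0"
  shows "degree (slice x w P) = e" "lead_coeff (slice x w P) = ev P 0 0 1" "slice x w P \<noteq> 0"
    "degree P = e"
proof -
  have c: "coeff (slice x w P) e = ev P 0 0 1"
    using coeff_homogeneous_top[OF assms(1)] by (simp add: coeff_slice)
  have z: "coeff (slice x w P) k = 0" if "k > e" for k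
    using coeff_homogeneous_top[OF assms(1)] that by (simp add: coeff_slice)
  show d: "degree (slice x w P) = e"
    using c z assms(2) by (intro antisym degree_le le_degree) auto
  show "lead_coeff (slice x w P) = ev P 0 0 1" using c d by simp
  show "slice x w P \<noteq> 0" using c assms(2) by auto
  show "degree P = e"
    using coeff_homogeneous_top[OF assms(1)] assms(2) by (intro antisym degree_le le_degree) auto
qed

section \<open>Roots of a monic form\<close>

lemma prod_mset_lower:
  assumes "r \<ge> (0::real)" "\<And>a. a \<in># A \<Longrightarrow> r \<le> f a"
  shows "r ^ size A \<le> (\<Prod>a\<in>#A. f a)"
  using assms(2)
proof (induction A)
  case (add x A)
  then have "0 \<le> f x" using assms(1) order_trans by (metis union_single_eq_member)
  with add show ?case using assms(1) by (auto intro!: mult_mono)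
qed simp

text \<open>Up to the leading coefficient, the value at \<open>y\<close> is the product of the
  distances from \<open>y\<close> to the \<open>e\<close> roots, so the nearest root is no farther
  than their geometric mean. This is continuity of roots in quantitative form.\<close>

lemma near_root:
  assumes "homogeneous e P" "ev P 0 0 1 \<noteq> 0" "e > 0"
  shows "\<exists>a. ev P x w a = 0 \<and> cmod (a - y) ^ e \<le> cmod (ev P x w y) / cmod (ev P 0 0 1)"
proof -
  note s = slice_degree(1-3)[where x=x and w=w, OF assms(1,2)]
  obtain A where A: "size A = e" "slice x w P = smult (ev P 0 0 1) (\<Prod>a\<in>#A. [:-a, 1:])"
    using alg_closed_imp_factorization[OF s(3)] s by auto
  have "ev P x w y = poly (slice x w P) y" by simp
  also have "\<dots> = ev P 0 0 1 * (\<Prod>a\<in>#A. y - a)"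
    unfolding A(2) by (simp add: poly_prod_mset image_mset.compositionality o_def)
  finally have e1: "cmod (ev P x w y) / cmod (ev P 0 0 1) = cmod (\<Prod>a\<in>#A. y - a)"
    using assms(2) by (simp add: norm_mult)
  have e2: "cmod (\<Prod>a\<in>#A. y - a) = (\<Prod>a\<in>#A. cmod (a - y))"
    by (induction A) (auto simp: norm_mult norm_minus_commute)
  have "A \<noteq> {#}" using A(1) assms(3) by auto
  then have ne: "set_mset A \<noteq> {}" by simp
  define r where "r = Min ((\<lambda>a. cmod (a - y)) ` set_mset A)"
  have "r \<in> (\<lambda>a. cmod (a - y)) ` set_mset A" unfolding r_def using ne by (intro Min_in) auto
  then obtain a where a: "a \<in># A" "r = cmod (a - y)" by blast
  have "r \<le> cmod (a' - y)" if "a' \<in># A" for a'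
    unfolding r_def using that by (intro Min_le) auto
  moreover have "r \<ge> 0" using a by simp
  ultimately have "r ^ size A \<le> (\<Prod>a\<in>#A. cmod (a - y))"
    by (intro prod_mset_lower) auto
  then have "cmod (a - y) ^ e \<le> cmod (ev P x w y) / cmod (ev P 0 0 1)"
    using a A(1) e1 e2 by simp
  moreover have "poly (slice x w P) a = 0"
    unfolding A(2) using a(1) by (auto simp: poly_prod_mset image_mset.compositionality o_def prod_mset_zero_iff)
  then have "ev P x w a = 0" by simp
  ultimately show ?thesis by blast
qed

text \<open>\<open>P\<close> stays nonzero near \<open>(0, 0, 1)\<close>; rescaling a zero to
  \<open>y = 1\<close> turns this into a bound on \<open>y\<close>. It gives the compactness of
  fibres over a bounded base.\<close>

lemma root_bound:
  assumes "homogeneous e P" "ev P 0 0 1 \<noteq> 0"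
  obtains M where "M > 0" "\<And>x w y. ev P x w y = 0 \<Longrightarrow> cmod y \<le> M * max (cmod x) (cmod w)"
proof -
  have "((\<lambda>(u, v). ev P u v 1) \<longlongrightarrow> ev P 0 0 1) (at (0, 0))"
    unfolding case_prod_beta by (intro tendsto_eq_intros | simp)+
  then have "eventually (\<lambda>z. (\<lambda>(u, v). ev P u v 1) z \<noteq> 0) (at (0, 0))"
    using assms(2) by (rule tendsto_imp_eventually_ne)
  then obtain d where d: "d > 0" "\<And>z. z \<noteq> (0, 0) \<Longrightarrow> dist z (0, 0) < d \<Longrightarrow> (\<lambda>(u, v). ev P u v 1) z \<noteq> 0"
    unfolding eventually_at by blast
  have d': "ev P u v 1 \<noteq> 0" if "cmod u + cmod v < d" for u v
  proof (cases "(u, v) = (0, 0)")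
    case False
    have "dist (u, v) (0, 0) \<le> cmod u + cmod v"
      by (simp add: dist_Pair_Pair sqrt_sum_squares_le_sum)
    then show ?thesis using d(2)[OF False] that by auto
  qed (use assms(2) in auto)
  show ?thesis
  proof (rule that[of "2 / d"])
    show "2 / d > 0" using d by simp
    fix x w y assume z: "ev P x w y = 0"
    show "cmod y \<le> 2 / d * max (cmod x) (cmod w)"
    proof (cases "y = 0")
      case False
      have "ev P (y * (x / y)) (y * (w / y)) (y * 1) = 0" using z False by simp
      then have "ev P (x / y) (w / y) 1 = 0"
        unfolding homogeneous_ev[OF assms(1)] using False by simp
      then have "d \<le> cmod (x / y) + cmod (w / y)" using d' not_le by blast
      also have "\<dots> \<le> 2 * max (cmod x) (cmod w) / cmod y"
        by (simp add: norm_divide field_simps)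
          (use False in \<open>simp add: add_divide_distrib[symmetric] divide_right_mono\<close>)
      finally show ?thesis using d(1) False by (simp add: field_simps)
    qed (use d(1) in \<open>simp add: le_max_iff_disj\<close>)
  qed
qed

lemma eventually_notin_finite:
  fixes a :: "'a::t1_space"
  shows "finite S \<Longrightarrow> eventually (\<lambda>x. x \<notin> S) (at a)"
  using islimpt_finite islimpt_iff_eventually by blast

text \<open>The base point is moved slightly, off \<open>w = 0\<close> and off finitely many ratios,
  and \<open>near_root\<close> lifts the motion to the curve.\<close>

lemma dense_points:
  assumes "homogeneous e P" "ev P 0 0 1 \<noteq> 0" "e > 0" and "finite D"
    and z: "(x0, w0) \<noteq> (0, 0)" "ev P x0 w0 y0 = 0" and "\<epsilon> > 0"
  obtains x w y where "ev P x w y = 0" "w \<noteq> 0" "x / w \<notin> D"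
    "cmod (x - x0) < \<epsilon>" "cmod (w - w0) < \<epsilon>" "cmod (y - y0) < \<epsilon>"
proof -
  \<comment> \<open>Direction of the motion: \<open>w\<close> is moved if \<open>w0 = 0\<close>, to
    make it nonzero, and \<open>x\<close> otherwise. The set \<open>S\<close> collects the finitely
    many parameters to be avoided.\<close>
  define a b :: complex where "a = (if w0 = 0 then 0 else 1)" and "b = (if w0 = 0 then 1 else 0)"
  define S where "S = (if w0 = 0 then insert 0 ((\<lambda>d. x0 / d) ` D) else (\<lambda>d. d * w0 - x0) ` D)"
  have "finite S" using assms(4) by (simp add: S_def)
  then have 1: "eventually (\<lambda>t. t \<notin> S) (at 0)" by (rule eventually_notin_finite)
  have g: "w0 + t * b \<noteq> 0 \<and> (x0 + t * a) / (w0 + t * b) \<notin> D" if "t \<notin> S" for t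
  proof (cases "w0 = 0")
    case True
    then have t: "t \<noteq> 0" "\<And>d. d \<in> D \<Longrightarrow> t \<noteq> x0 / d" "x0 \<noteq> 0" using that z(1) by (auto simp: S_def)
    then have "x0 / t \<noteq> d" if "d \<in> D" for d using that by (metis divide_divide_eq_right divide_self_if mult_1 times_divide_eq_left nonzero_mult_div_cancel_left)
    then show ?thesis using t True by (auto simp: a_def b_def)
  next
    case False
    have "x0 + t \<noteq> d * w0" if "d \<in> D" for d
    proof
      assume "x0 + t = d * w0"
      then have "t = d * w0 - x0" by (simp add: algebra_simps)
      then show False using that \<open>t \<notin> S\<close> False by (auto simp: S_def)
    qed
    then have "(x0 + t) / w0 \<noteq> d" if "d \<in> D" for d using that False by (auto simp: field_simps)
    then show ?thesis using False by (auto simp: a_def b_def)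
  qed
  have tx: "((\<lambda>t. x0 + t * a) \<longlongrightarrow> x0) (at 0)" "((\<lambda>t. w0 + t * b) \<longlongrightarrow> w0) (at 0)"
    by (auto intro!: tendsto_eq_intros)
  have "((\<lambda>t. cmod (ev P (x0 + t * a) (w0 + t * b) y0) / cmod (ev P 0 0 1)) \<longlongrightarrow> 0) (at 0)"
    using z(2) assms(2) by (auto intro!: tendsto_eq_intros tx)
  then have 2: "eventually (\<lambda>t. cmod (ev P (x0 + t * a) (w0 + t * b) y0) / cmod (ev P 0 0 1) < \<epsilon> ^ e) (at 0)"
    using assms(7) by (intro order_tendstoD(2)) auto
  have 3: "eventually (\<lambda>t. dist (x0 + t * a) x0 < \<epsilon>) (at 0)" "eventually (\<lambda>t. dist (w0 + t * b) w0 < \<epsilon>) (at 0)"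
    using tx assms(7) by (auto intro: tendstoD)
  have "eventually (\<lambda>t. t \<notin> S \<and> cmod (ev P (x0 + t * a) (w0 + t * b) y0) / cmod (ev P 0 0 1) < \<epsilon> ^ e
     \<and> dist (x0 + t * a) x0 < \<epsilon> \<and> dist (w0 + t * b) w0 < \<epsilon>) (at 0)"
    using 1 2 3 by eventually_elim auto
  then obtain t where t: "t \<notin> S" "cmod (ev P (x0 + t * a) (w0 + t * b) y0) / cmod (ev P 0 0 1) < \<epsilon> ^ e"
     "dist (x0 + t * a) x0 < \<epsilon>" "dist (w0 + t * b) w0 < \<epsilon>"
    using eventually_happens[of _ "at (0::complex)"] by force
  obtain y where y: "ev P (x0 + t * a) (w0 + t * b) y = 0"
    "cmod (y - y0) ^ e \<le> cmod (ev P (x0 + t * a) (w0 + t * b) y0) / cmod (ev P 0 0 1)"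
    using near_root[OF assms(1-3)] by blast
  have "cmod (y - y0) ^ e < \<epsilon> ^ e" using y(2) t(2) by linarith
  then have "cmod (y - y0) < \<epsilon>" using assms(7) power_less_imp_less_base by fastforce
  with y(1) t g[OF t(1)] show ?thesis
    by (intro that[of "x0 + t * a" "w0 + t * b" y]) (auto simp: dist_norm)
qed

section \<open>Local behaviour along a smooth curve\<close>

text \<open>Moving the base line changes the polynomial by a multiple of \<open>t\<close>, and the
  quotient is again polynomial in \<open>t\<close> and \<open>y\<close>, so it has limits and
  derivatives of its own.\<close>

lemma line_expansion:
  "\<exists>S :: complex poly poly. \<forall>t y. ev P (\<alpha> + t * \<alpha>') (\<beta> + t * \<beta>') y = ev P \<alpha> \<beta> y + t * poly (poly S [:y:]) t"
proof (induction P)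
  case (pCons c P)
  then obtain S where S: "\<forall>t y. ev P (\<alpha> + t * \<alpha>') (\<beta> + t * \<beta>') y = ev P \<alpha> \<beta> y + t * poly (poly S [:y:]) t"
    by blast
  obtain p where p: "\<forall>t. poly p t = ev [:c:] (poly [:\<alpha>, \<alpha>':] t) (poly [:\<beta>, \<beta>':] t) (poly 0 t)"
    using ev_curve_poly by blast
  obtain p0 s where ps: "p = pCons p0 s" by (cases p)
  have "p0 = poly (poly c [:\<beta>:]) \<alpha>" using p[rule_format, of 0] by (simp add: ps ev_pCons)
  then have "poly (poly c [:\<beta> + t * \<beta>':]) (\<alpha> + t * \<alpha>') = poly (poly c [:\<beta>:]) \<alpha> + t * poly s t" for t
    using p[rule_format, of t] by (simp add: ps ev_pCons)
  then show ?case
    by (intro exI[of _ "pCons s S"]) (simp add: ev_pCons S algebra_simps)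
qed (auto intro: exI[of _ 0])

lemma euler:
  assumes "homogeneous e P" "ev P x w y = 0"
  shows "ev (D1 P) x w y * x + ev (D2 P) x w y * w + ev (D3 P) x w y * y = 0"
proof -
  have d: "((\<lambda>t. t * c) has_field_derivative c) (at 1)" for c :: complex
    by (auto intro!: derivative_eq_intros)
  have "((\<lambda>t. ev P (t * x) (t * w) (t * y)) has_field_derivative 0) (at 1)"
    using assms(2) by (simp add: homogeneous_ev[OF assms(1)])
  from DERIV_unique[OF ev_chain[OF d d d, of P] this] show ?thesis by simp
qed

definition smooth_form :: "poly3 \<Rightarrow> bool" where
  "smooth_form P \<longleftrightarrow> (\<forall>x w y. (x, w, y) \<noteq> (0, 0, 0) \<longrightarrow> ev P x w y = 0 \<longrightarrow>
     ev (D1 P) x w y \<noteq> 0 \<or> ev (D2 P) x w y \<noteq> 0 \<or> ev (D3 P) x w y \<noteq> 0)"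

text \<open>
  On the curve, \<open>t s = - q(y)\<close> with \<open>q\<close> the restriction of \<open>P\<close> to the line \<open>t = 0\<close>, so that
  \<open>t\<close> vanishes at the ramification point to a higher order than the derivative of \<open>q\<close>.
\<close>

lemma ramification_limit:
  assumes P: "homogeneous e P" "smooth_form P" and ab: "\<alpha> * \<beta>' - \<beta> * \<alpha>' \<noteq> 0"
    and top: "slice \<alpha> \<beta> P \<noteq> 0"
    and t: "(t \<longlongrightarrow> 0) F" and y: "(y \<longlongrightarrow> b) F"
    and z: "eventually (\<lambda>n. ev P (\<alpha> + t n * \<alpha>') (\<beta> + t n * \<beta>') (y n) = 0) F" and F: "F \<noteq> bot"
  shows "((\<lambda>n. t n / ev (D3 P) (\<alpha> + t n * \<alpha>') (\<beta> + t n * \<beta>') (y n)) \<longlongrightarrow> 0) F"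
proof -
  have lim: "((\<lambda>n. ev Q (\<alpha> + t n * \<alpha>') (\<beta> + t n * \<beta>') (y n)) \<longlongrightarrow> ev Q \<alpha> \<beta> b) F" for Q
    by (auto intro!: tendsto_eq_intros t y)
  have b: "ev P \<alpha> \<beta> b = 0"
    using tendsto_unique[OF F lim[of P]] tendsto_eventually[OF z] by simp
  show ?thesis
  proof (cases "ev (D3 P) \<alpha> \<beta> b = 0")
    case False
    then show ?thesis using tendsto_divide[OF t lim[of "D3 P"]] by simp
  next
    case True
    obtain S where S: "\<And>t y. ev P (\<alpha> + t * \<alpha>') (\<beta> + t * \<beta>') y = ev P \<alpha> \<beta> y + t * poly (poly S [:y:]) t"
      using line_expansion[of P \<alpha> \<alpha>' \<beta> \<beta>'] by blast
    define s where "s n = poly (poly S [:y n:]) (t n)" for n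
    define s' where "s' n = poly (poly (pderiv S) [:y n:]) (t n)" for n
    define s0 where "s0 = poly (poly S [:b:]) 0"
    have s: "(s \<longlongrightarrow> s0) F" "(s' \<longlongrightarrow> poly (poly (pderiv S) [:b:]) 0) F"
      unfolding s_def s'_def s0_def by (intro tendsto_poly2 t y)+
    have d: "((\<lambda>t. \<alpha> + t * \<alpha>') has_field_derivative \<alpha>') (at 0)"
      "((\<lambda>t. \<beta> + t * \<beta>') has_field_derivative \<beta>') (at 0)" "((\<lambda>t. b) has_field_derivative 0) (at 0)"
      by (auto intro!: derivative_eq_intros)
    have dS: "((\<lambda>t. poly (poly S [:b:]) t) has_field_derivative
       poly (poly (map_poly pderiv S) [:b:]) 0 * 1 + poly (poly (pderiv S) [:b:]) 0 * 0) (at 0)"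
      by (rule poly2_chain[where f="\<lambda>t. t" and g="\<lambda>_. b"]) auto
    have "((\<lambda>t. ev P \<alpha> \<beta> b + t * poly (poly S [:b:]) t) has_field_derivative s0) (at 0)"
      by (rule derivative_eq_intros dS refl | simp add: s0_def)+
    then have "((\<lambda>t. ev P (\<alpha> + t * \<alpha>') (\<beta> + t * \<beta>') b) has_field_derivative s0) (at 0)"
      unfolding S .
    from DERIV_unique[OF this ev_chain[OF d, of P]]
    have s0: "s0 = ev (D1 P) \<alpha> \<beta> b * \<alpha>' + ev (D2 P) \<alpha> \<beta> b * \<beta>'" by simp
    \<comment> \<open>If \<open>s0\<close> vanished, Euler's relation would be a second linear
      equation for the first two partials. By \<open>ab\<close> the determinant is nonzero, so all
      three partials would vanish on the curve, against smoothness.\<close>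
    have "s0 \<noteq> 0"
    proof
      assume "s0 = 0"
      have eul: "ev (D1 P) \<alpha> \<beta> b * \<alpha> + ev (D2 P) \<alpha> \<beta> b * \<beta> = 0"
        using euler[OF P(1) b] True by simp
      have "ev (D1 P) \<alpha> \<beta> b * (\<alpha> * \<beta>' - \<beta> * \<alpha>') =
          (ev (D1 P) \<alpha> \<beta> b * \<alpha> + ev (D2 P) \<alpha> \<beta> b * \<beta>) * \<beta>' - s0 * \<beta>"
        unfolding s0 by (simp add: algebra_simps)
      moreover have "ev (D2 P) \<alpha> \<beta> b * (\<alpha> * \<beta>' - \<beta> * \<alpha>') =
          s0 * \<alpha> - (ev (D1 P) \<alpha> \<beta> b * \<alpha> + ev (D2 P) \<alpha> \<beta> b * \<beta>) * \<alpha>'"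
        unfolding s0 by (simp add: algebra_simps)
      ultimately have "ev (D1 P) \<alpha> \<beta> b = 0" "ev (D2 P) \<alpha> \<beta> b = 0"
        using ab eul \<open>s0 = 0\<close> by auto
      moreover have "(\<alpha>, \<beta>, b) \<noteq> (0, 0, 0)" using ab by auto
      ultimately show False using P(2) True b unfolding smooth_form_def by blast
    qed
    have D3: "ev (D3 P) (\<alpha> + u * \<alpha>') (\<beta> + u * \<beta>') v
        = poly (pderiv (slice \<alpha> \<beta> P)) v + u * poly (poly (pderiv S) [:v:]) u" for u v
    proof -
      have "((\<lambda>y. ev P (\<alpha> + u * \<alpha>') (\<beta> + u * \<beta>') y) has_field_derivative
          ev (D3 P) (\<alpha> + u * \<alpha>') (\<beta> + u * \<beta>') v) (at v)"
        using ev_chain[of "\<lambda>_. \<alpha> + u * \<alpha>'" 0 v UNIV "\<lambda>_. \<beta> + u * \<beta>'" 0 "\<lambda>t. t" 1] by simp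
      moreover have "((\<lambda>y. poly (slice \<alpha> \<beta> P) y + u * poly (poly S [:y:]) u) has_field_derivative
          poly (pderiv (slice \<alpha> \<beta> P)) v + u * poly (poly (pderiv S) [:v:]) u) (at v)"
        using poly2_chain[of "\<lambda>_. u" 0 v UNIV "\<lambda>y. y" 1 S]
        by (auto intro!: derivative_eq_intros poly_DERIV simp del: poly_slice poly_pderiv_slice)
      ultimately show ?thesis using DERIV_unique unfolding S poly_slice by blast
    qed
    \<comment> \<open>At a root \<open>b\<close> of order \<open>r = k + 1\<close> of the slice,
      \<open>t\<close> contains the factor \<open>(y - b) ^ (k + 1)\<close> but the derivative only
      \<open>(y - b) ^ k\<close>, which cancels.\<close>
    define r where "r = order b (slice \<alpha> \<beta> P)"
    obtain v where v: "slice \<alpha> \<beta> P = [:-b, 1:] ^ r * v" and "\<not> [:-b, 1:] dvd v"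
      unfolding r_def using order_decomp[OF top] by blast
    then have vb: "poly v b \<noteq> 0" by (simp add: poly_eq_0_iff_dvd)
    have "r \<noteq> 0" using b top unfolding r_def by (metis order_root poly_slice)
    then obtain k where k: "r = Suc k" by (cases r) auto
    have q: "ev P \<alpha> \<beta> u = (u - b) ^ k * ((u - b) * poly v u)" for u
      using arg_cong[OF v, of "\<lambda>p. poly p u"] by (simp add: k poly_power algebra_simps)
    have q': "poly (pderiv (slice \<alpha> \<beta> P)) u
        = (u - b) ^ k * (of_nat r * poly v u + (u - b) * poly (pderiv v) u)" for u
      unfolding v k pderiv_mult pderiv_power_Suc by (simp add: poly_power pderiv_pCons algebra_simps)
    \<comment> \<open>The quotient after this cancellation, with numerator and denominator
      multiplied by \<open>s\<close>. The denominator tends to \<open>s0 * r * v(b)\<close>, which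
      is nonzero.\<close>
    have 1: "((\<lambda>n. - ((y n - b) * poly v (y n)) /
        (s n * (of_nat r * poly v (y n) + (y n - b) * poly (pderiv v) (y n))
           - (y n - b) * poly v (y n) * s' n)) \<longlongrightarrow> 0) F"
      using vb \<open>s0 \<noteq> 0\<close> \<open>r \<noteq> 0\<close> by (auto intro!: tendsto_eq_intros s y)
    have "eventually (\<lambda>n. s n \<noteq> 0) F" by (rule tendsto_imp_eventually_ne[OF s(1) \<open>s0 \<noteq> 0\<close>])
    with z have "eventually (\<lambda>n. - ((y n - b) * poly v (y n)) /
        (s n * (of_nat r * poly v (y n) + (y n - b) * poly (pderiv v) (y n))
           - (y n - b) * poly v (y n) * s' n)
       = t n / ev (D3 P) (\<alpha> + t n * \<alpha>') (\<beta> + t n * \<beta>') (y n)) F"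
    proof eventually_elim
      case (elim n)
      then have e0: "ev P \<alpha> \<beta> (y n) + t n * s n = 0" unfolding S s_def by simp
      have tn: "t n = - ev P \<alpha> \<beta> (y n) / s n"
        using e0 elim(2) by (simp add: field_simps add_eq_0_iff)
      \<comment> \<open>At \<open>y n = b\<close> nothing can be cancelled, but there
        \<open>t n = 0\<close> and both quotients are 0.\<close>
      show ?case
      proof (cases "y n = b")
        case True
        then have "t n = 0" using tn b by simp
        with True show ?thesis by simp
      next
        case False
        define c where "c = (y n - b) ^ k"
        have "c \<noteq> 0" using False by (simp add: c_def)
        have ts: "t n * s n = c * - ((y n - b) * poly v (y n))"
          using e0 unfolding q c_def[symmetric] by (simp add: add_eq_0_iff2)
        have d3: "s n * ev (D3 P) (\<alpha> + t n * \<alpha>') (\<beta> + t n * \<beta>') (y n)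
           = c * (s n * (of_nat r * poly v (y n) + (y n - b) * poly (pderiv v) (y n))
           - (y n - b) * poly v (y n) * s' n)" (is "_ = c * ?R")
        proof -
          have "s n * (c * K + t n * s' n) = c * (s n * K) + (t n * s n) * s' n" for K
            by (simp add: algebra_simps)
          then show ?thesis
            unfolding D3 q' s'_def[symmetric] c_def[symmetric] ts by (simp add: algebra_simps)
        qed
        have "t n / ev (D3 P) (\<alpha> + t n * \<alpha>') (\<beta> + t n * \<beta>') (y n)
          = (t n * s n) / (s n * ev (D3 P) (\<alpha> + t n * \<alpha>') (\<beta> + t n * \<beta>') (y n))"
          using elim(2) by simp
        also note ts
        also have "c * - ((y n - b) * poly v (y n)) / (s n * ev (D3 P) (\<alpha> + t n * \<alpha>') (\<beta> + t n * \<beta>') (y n)) = - ((y n - b) * poly v (y n)) / ?R"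
          unfolding d3 using \<open>c \<noteq> 0\<close> by simp
        finally show ?thesis by simp
      qed
    qed
    then show ?thesis using 1 tendsto_cong by fast
  qed
qed

section \<open>Functions on a smooth curve\<close>

text \<open>The difference of \<open>l\<close>-th powers factors as
  \<open>(g x - g x1) * S x\<close>, and \<open>S\<close> tends to
  \<open>l * g x1 ^ (l - 1)\<close>, which is nonzero. Dividing the difference quotient of
  \<open>k\<close> by \<open>S\<close> gives that of \<open>g\<close>, with no choice of a
  branch.\<close>

lemma root_differentiable:
  fixes g k :: "complex \<Rightarrow> complex"
  assumes g: "(g \<longlongrightarrow> g x1) (at x1)" "g x1 \<noteq> 0" and l: "l > 0"
    and ev: "eventually (\<lambda>x. g x ^ l = k x) (at x1)" "g x1 ^ l = k x1"
    and k: "(k has_field_derivative k') (at x1)"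
  shows "\<exists>g'. (g has_field_derivative g') (at x1)"
proof -
  define S where "S x = (\<Sum>i<l. g x1 ^ (l - Suc i) * g x ^ i)" for x
  have "(S \<longlongrightarrow> (\<Sum>i<l. g x1 ^ (l - Suc i) * g x1 ^ i)) (at x1)"
    unfolding S_def by (intro tendsto_intros g)
  also have "(\<Sum>i<l. g x1 ^ (l - Suc i) * g x1 ^ i) = (\<Sum>i<l. g x1 ^ (l - 1))"
    by (intro sum.cong) (auto simp: power_add[symmetric])
  finally have S: "(S \<longlongrightarrow> of_nat l * g x1 ^ (l - 1)) (at x1)" by simp
  have nz: "of_nat l * g x1 ^ (l - 1) \<noteq> 0" using g(2) l by simp
  have "((\<lambda>x. ((k x - k x1) / (x - x1)) / S x) \<longlongrightarrow> k' / (of_nat l * g x1 ^ (l - 1))) (at x1)"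
    using k unfolding has_field_derivative_iff by (intro tendsto_divide S nz)
  moreover have "eventually (\<lambda>x. ((k x - k x1) / (x - x1)) / S x = (g x - g x1) / (x - x1)) (at x1)"
    using ev(1) tendsto_imp_eventually_ne[OF S nz]
  proof eventually_elim
    case (elim x)
    have "k x - k x1 = (g x - g x1) * S x"
      using elim ev(2) unfolding S_def by (metis power_diff_sumr2)
    with elim show ?case by simp
  qed
  ultimately have "((\<lambda>x. (g x - g x1) / (x - x1)) \<longlongrightarrow> k' / (of_nat l * g x1 ^ (l - 1))) (at x1)"
    using tendsto_cong by fast
  then show ?thesis unfolding has_field_derivative_iff by blast
qed

text \<open>Implicit differentiation for a root function known to be continuous only at
  \<open>x1\<close>: on the curve \<open>(\<sigma> x - b) * R + (x - x1) * S = 0\<close>, and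
  \<open>R\<close> tends to the \<open>y\<close>-derivative of \<open>P\<close>, which is
  nonzero.\<close>

lemma branch_differentiable:
  assumes b: "(\<sigma> \<longlongrightarrow> b) (at x1)" "\<sigma> x1 = b" and z: "\<And>x. ev P x 1 (\<sigma> x) = 0"
    and nz: "ev (D3 P) x1 1 b \<noteq> 0"
  shows "\<exists>\<sigma>'. (\<sigma> has_field_derivative \<sigma>') (at x1)"
proof -
  obtain S where S: "\<And>t y. ev P (x1 + t * 1) (1 + t * 0) y = ev P x1 1 y + t * poly (poly S [:y:]) t"
    using line_expansion[of P x1 1 1 0] by blast
  define R where "R = synthetic_div (slice x1 1 P) b"
  have "slice x1 1 P = [:-b, 1:] * R + [:poly (slice x1 1 P) b:]"
    unfolding R_def by (rule synthetic_div_correct'[symmetric])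
  moreover have 0: "ev P x1 1 b = 0" using z b(2) by metis
  ultimately have R: "slice x1 1 P = [:-b, 1:] * R" by simp
  have R': "ev P x1 1 y = (y - b) * poly R y" for y
    using arg_cong[OF R, of "\<lambda>p. poly p y"] by (simp add: algebra_simps)
  have "poly (pderiv (slice x1 1 P)) b = poly R b"
    unfolding R pderiv_mult by (simp add: pderiv_pCons)
  then have Rb: "poly R b \<noteq> 0" using nz by simp
  have tR: "((\<lambda>x. poly R (\<sigma> x)) \<longlongrightarrow> poly R b) (at x1)" by (intro tendsto_intros b)
  have "((\<lambda>x. - poly (poly S [:\<sigma> x:]) (x - x1) / poly R (\<sigma> x)) \<longlongrightarrow> - poly (poly S [:b:]) 0 / poly R b) (at x1)"
    by (intro tendsto_divide tendsto_minus tendsto_poly2 b tR Rb) (auto intro!: tendsto_eq_intros)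
  moreover have "eventually (\<lambda>x. - poly (poly S [:\<sigma> x:]) (x - x1) / poly R (\<sigma> x)
      = (\<sigma> x - \<sigma> x1) / (x - x1)) (at x1)"
    using tendsto_imp_eventually_ne[OF tR Rb] eventually_neq_at_within[of x1 x1 UNIV]
  proof eventually_elim
    case (elim x)
    have "(\<sigma> x - b) * poly R (\<sigma> x) + (x - x1) * poly (poly S [:\<sigma> x:]) (x - x1) = 0"
      using S[of "x - x1" "\<sigma> x"] z[of x] by (simp add: R')
    then show ?case using elim b(2) by (simp add: field_simps add_eq_0_iff2)
  qed
  ultimately have "((\<lambda>x. (\<sigma> x - \<sigma> x1) / (x - x1)) \<longlongrightarrow> - poly (poly S [:b:]) 0 / poly R b) (at x1)"
    using tendsto_cong by fast
  then show ?thesis unfolding has_field_derivative_iff by blast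
qed

lemma poly_shift_Suc: "poly_shift a p = pCons (coeff p a) (poly_shift (Suc a) p)"
  by (intro poly_eqI) (auto simp: coeff_poly_shift coeff_pCons split: nat.splits)

text \<open>The Horner tails \<open>poly_shift (Suc a) p\<close> at \<open>z\<close> are the
  coefficients in \<open>y\<close> of \<open>(p(y) - p(z)) / (y - z)\<close>, the kernel of Lagrange
  interpolation at the roots of \<open>p\<close>.\<close>

lemma difference_quotient:
  fixes p :: "complex poly"
  assumes "degree p = e"
  shows "(\<Sum>a<e. poly (poly_shift (Suc a) p) z * y ^ a) * (y - z) = poly p y - poly p z"
    and "(\<Sum>a<e. poly (poly_shift (Suc a) p) z * z ^ a) = poly (pderiv p) z"
proof -
  have 1: "(\<Sum>a<k. poly (poly_shift (Suc a) p) z * y ^ a) * (y - z)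
     = poly (poly_shift k p) z * y ^ k + (\<Sum>a<k. coeff p a * y ^ a) - poly p z" for k y
  proof (induction k)
    case (Suc k)
    show ?case
      using Suc unfolding sum.lessThan_Suc distrib_right
      by (subst (asm) (2) poly_shift_Suc) (simp add: algebra_simps)
  qed simp
  have "poly_shift e p = [:coeff p e:]"
    by (intro poly_eqI) (auto simp: coeff_poly_shift coeff_pCons coeff_eq_0 assms split: nat.splits)
  then have 2: "(\<Sum>a<e. poly (poly_shift (Suc a) p) z * y ^ a) * (y - z) = poly p y - poly p z" for y
    using 1[where k=e and y=y] assms by (simp add: poly_altdef lessThan_Suc_atMost[symmetric])
  then show "(\<Sum>a<e. poly (poly_shift (Suc a) p) z * y ^ a) * (y - z) = poly p y - poly p z" .
  \<comment> \<open>The value on the diagonal comes from differentiating the identity in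
    \<open>y\<close> at \<open>z\<close>.\<close>
  have "((\<lambda>y. (\<Sum>a<e. poly (poly_shift (Suc a) p) z * y ^ a) * (y - z)) has_field_derivative
      (\<Sum>a<e. poly (poly_shift (Suc a) p) z * z ^ a)) (at z)"
    by (rule derivative_eq_intros refl | simp)+
  moreover have "((\<lambda>y. poly p y - poly p z) has_field_derivative poly (pderiv p) z) (at z)"
    by (auto intro!: derivative_eq_intros poly_DERIV)
  ultimately show "(\<Sum>a<e. poly (poly_shift (Suc a) p) z * z ^ a) = poly (pderiv p) z"
    unfolding 2 using DERIV_unique by blast
qed

lemma slice_shift: "slice x w (poly_shift a P) = poly_shift a (slice x w P)"
  by (intro poly_eqI) (simp add: coeff_slice coeff_poly_shift)

lemma homogeneous_shift: "homogeneous e P \<Longrightarrow> homogeneous (e - a) (poly_shift a P)"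
  unfolding homogeneous_def coeff_poly_shift by force

definition pcone :: "poly3 \<Rightarrow> poly3 \<Rightarrow> (complex \<times> complex \<times> complex) set" where
  "pcone P B = {(x, w, y). ev P x w y = 0 \<and> ev B x w y \<noteq> 0 \<and> (x, w, y) \<noteq> (0, 0, 0)}"

lemma pcone_iff: "(x, w, y) \<in> pcone P B \<longleftrightarrow> ev P x w y = 0 \<and> ev B x w y \<noteq> 0 \<and> (x, w, y) \<noteq> (0, 0, 0)"
  by (simp add: pcone_def)

text \<open>\<open>\<eta>\<close> is a section of \<open>O(N)\<close> off \<open>B\<close> and an
  \<open>l\<close>-th root of \<open>A / Q\<close>. As \<open>Q\<close> has no zero on the curve,
  \<open>\<eta>\<close> stays locally bounded near \<open>B\<close>; as \<open>A\<close> has none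
  off \<open>B\<close>, the root can be differentiated. Instances are a root of \<open>F\<close>, a
  locally constant sign, and the inverse of a form; the last one needs a negative
  \<open>N\<close>.\<close>

locale curve_function =
  fixes P B A Q :: poly3 and e b l :: nat and N :: int
    and \<eta> :: "complex \<Rightarrow> complex \<Rightarrow> complex \<Rightarrow> complex"
  assumes hP: "homogeneous e P" and e: "e > 0" and irr: "irreducible P" and sm: "smooth_form P"
    and hB: "homogeneous b B" and PB: "\<not> P dvd B"
    and Q: "\<And>x w y. ev P x w y = 0 \<Longrightarrow> (x, w, y) \<noteq> (0, 0, 0) \<Longrightarrow> ev Q x w y \<noteq> 0"
    and A: "\<And>x w y. (x, w, y) \<in> pcone P B \<Longrightarrow> ev A x w y \<noteq> 0"
    and l: "l > 0" and cont: "continuous_on (pcone P B) (\<lambda>(x, w, y). \<eta> x w y)"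
    and hom: "\<And>c x w y. c \<noteq> 0 \<Longrightarrow> (x, w, y) \<in> pcone P B \<Longrightarrow>
       \<eta> (c * x) (c * w) (c * y) = c powi N * \<eta> x w y"
    and root: "\<And>x w y. (x, w, y) \<in> pcone P B \<Longrightarrow> \<eta> x w y ^ l * ev Q x w y = ev A x w y"

locale monic_curve_function = curve_function +
  assumes top: "ev P 0 0 1 \<noteq> 0"
begin

lemma degP: "degree P = e"
  using slice_degree(4)[OF hP top] .

lemma P_pderiv: "\<not> P dvd D3 P"
proof
  assume "P dvd D3 P"
  moreover have "D3 P \<noteq> 0" using e degP by (auto simp: pderiv_eq_0_iff)
  ultimately have "degree P \<le> degree (D3 P)" by (rule dvd_imp_degree_le)
  then show False using degree_pderiv[of P] degP e by simp
qed

definition ram :: "complex set" where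
  "ram = {x. \<exists>y. ev P x 1 y = 0 \<and> ev (D3 P) x 1 y = 0} \<union> {x. \<exists>y. ev P x 1 y = 0 \<and> ev B x 1 y = 0}"

lemma finite_ram: "finite ram"
  unfolding ram_def using e degP
  by (intro finite_UnI finite_common_zeros[OF irr _ hP P_pderiv homogeneous_D3[OF hP]]
      finite_common_zeros[OF irr _ hP PB hB]) auto

lemma ram_cone: "x \<notin> ram \<Longrightarrow> ev P x 1 y = 0 \<Longrightarrow> (x, 1, y) \<in> pcone P B \<and> ev (D3 P) x 1 y \<noteq> 0"
  by (auto simp: ram_def pcone_iff)

lemma finite_roots: "finite {y. ev P x w y = 0}" and card_roots_le: "card {y. ev P x w y = 0} \<le> e"
  using poly_roots_finite[of "slice x w P"] card_poly_roots_bound[of "slice x w P"]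
    slice_degree(1,3)[where x=x and w=w, OF hP top] by auto

lemma card_roots:
  assumes "x \<notin> ram" shows "card {y. ev P x 1 y = 0} = e"
proof -
  have "rsquarefree (slice x 1 P)"
    unfolding rsquarefree_roots using assms by (auto simp: ram_def)
  from complex_poly_decompose_rsquarefree[OF this]
  have "e = degree (smult (ev P 0 0 1) (\<Prod>z\<in>{z. ev P x 1 z = 0}. [:-z, 1:]))"
    using slice_degree(1,2)[where x=x and w=1, OF hP top] by simp
  also have "\<dots> = card {z. ev P x 1 z = 0}"
    using top by (simp add: degree_prod_sum_eq)
  finally show ?thesis by simp
qed

text \<open>The contribution of the root \<open>y\<close> to the coefficient of degree
  \<open>a\<close> in the Lagrange interpolation of \<open>\<eta>\<close> over its fibre. Summation
  over the fibre makes \<open>tr\<close> a trace.\<close>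

definition theta :: "nat \<Rightarrow> complex \<Rightarrow> complex \<Rightarrow> complex \<Rightarrow> complex" where
  "theta a x w y = \<eta> x w y * ev (poly_shift (Suc a) P) x w y / ev (D3 P) x w y"

definition tr :: "nat \<Rightarrow> complex \<Rightarrow> complex" where
  "tr a x = (\<Sum>y | ev P x 1 y = 0. theta a x 1 y)"

text \<open>The weights are \<open>N\<close> for \<open>\<eta>\<close>, \<open>e - 1 - a\<close> for
  the Horner tail and \<open>e - 1\<close> for the derivative; where the derivative vanishes, both
  sides are 0.\<close>

lemma theta_hom:
  assumes "c \<noteq> 0" "(x, w, y) \<in> pcone P B" "a < e"
  shows "theta a (c * x) (c * w) (c * y) = c powi (N - int a) * theta a x w y"
proof -
  have h: "homogeneous (e - Suc a) (poly_shift (Suc a) P)" by (rule homogeneous_shift[OF hP])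
  have "c ^ (e - 1) = c ^ (e - Suc a) * c ^ a"
    using assms(3) by (simp add: power_add[symmetric])
  moreover have "c powi N = c powi (N - int a) * c ^ a"
    using assms(1) by (simp add: power_int_diff)
  ultimately show ?thesis
    using assms(1) unfolding theta_def hom[OF assms(1,2)] homogeneous_ev[OF h] homogeneous_ev[OF homogeneous_D3[OF hP]]
    by (cases "ev (D3 P) x w y = 0") (simp_all add: field_simps)
qed

text \<open>Uniformity over the fibre is a compactness argument: the roots of a bad sequence are
  bounded by \<open>root_bound\<close>, a subsequence converges to a point of the curve, and there
  \<open>t / D3 P\<close> tends to 0 by \<open>ramification_limit\<close> while
  \<open>\<eta>\<close> stays bounded. The homogeneous form of the base covers finite points and
  infinity alike.\<close>

lemma theta_small:
  assumes ab: "\<alpha> * \<beta>' - \<beta> * \<alpha>' \<noteq> 0" and "\<epsilon> > 0"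
  obtains \<delta> where "\<delta> > 0" "\<And>t y. t \<noteq> 0 \<Longrightarrow> cmod t < \<delta> \<Longrightarrow> (\<alpha> + t * \<alpha>', \<beta> + t * \<beta>', y) \<in> pcone P B \<Longrightarrow>
      cmod (t * theta a (\<alpha> + t * \<alpha>') (\<beta> + t * \<beta>') y) \<le> \<epsilon>"
proof (rule ccontr)
  assume "\<not> thesis"
  then have "\<exists>t y. t \<noteq> 0 \<and> cmod t < inverse (real (Suc n)) \<and> (\<alpha> + t * \<alpha>', \<beta> + t * \<beta>', y) \<in> pcone P B \<and>
      \<not> cmod (t * theta a (\<alpha> + t * \<alpha>') (\<beta> + t * \<beta>') y) \<le> \<epsilon>" for n
    using that[of "inverse (real (Suc n))"] by (metis inverse_positive_iff_positive of_nat_0_less_iff zero_less_Suc)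
  then obtain t y where ty: "\<And>n. t n \<noteq> 0" "\<And>n. cmod (t n) < inverse (real (Suc n))"
    "\<And>n. (\<alpha> + t n * \<alpha>', \<beta> + t n * \<beta>', y n) \<in> pcone P B"
    "\<And>n. \<not> cmod (t n * theta a (\<alpha> + t n * \<alpha>') (\<beta> + t n * \<beta>') (y n)) \<le> \<epsilon>"
    by metis
  have t0: "t \<longlonglongrightarrow> 0"
    using ty(2) by (intro Lim_null_comparison[OF _ LIMSEQ_inverse_real_of_nat]) (auto intro!: always_eventually less_imp_le)
  obtain M where M: "M > 0" "\<And>x w y. ev P x w y = 0 \<Longrightarrow> cmod y \<le> M * max (cmod x) (cmod w)"
    using root_bound[OF hP top] by blast
  have "cmod (y n) \<le> M * max (cmod \<alpha> + cmod \<alpha>') (cmod \<beta> + cmod \<beta>')" for n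
  proof -
    have "inverse (real (Suc n)) \<le> 1" by (simp add: field_simps)
    with ty(2)[of n] have "cmod (t n) \<le> 1" by linarith
    then have *: "cmod (u + t n * v) \<le> cmod u + cmod v" for u v
      by (metis add_left_mono mult_left_le_one_le norm_ge_zero norm_mult norm_triangle_le)
    have "cmod (y n) \<le> M * max (cmod (\<alpha> + t n * \<alpha>')) (cmod (\<beta> + t n * \<beta>'))"
      using ty(3)[of n] by (intro M) (simp add: pcone_iff)
    also have "\<dots> \<le> M * max (cmod \<alpha> + cmod \<alpha>') (cmod \<beta> + cmod \<beta>')"
      using M(1) * by (intro mult_left_mono max.mono) auto
    finally show ?thesis .
  qed
  then have "bounded (range y)" unfolding bounded_iff by blast
  then obtain b' r where r: "strict_mono r" "(y \<circ> r) \<longlonglongrightarrow> b'"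
    using bounded_imp_convergent_subsequence by blast
  define t' y' where "t' = t \<circ> r" and "y' = y \<circ> r"
  have t': "t' \<longlonglongrightarrow> 0" unfolding t'_def by (rule LIMSEQ_subseq_LIMSEQ[OF t0 r(1)])
  have y': "y' \<longlonglongrightarrow> b'" using r by (simp add: y'_def)
  have cn: "(\<alpha> + t' n * \<alpha>', \<beta> + t' n * \<beta>', y' n) \<in> pcone P B" for n using ty(3) by (simp add: t'_def y'_def)
  have lim: "(\<lambda>n. ev F (\<alpha> + t' n * \<alpha>') (\<beta> + t' n * \<beta>') (y' n)) \<longlonglongrightarrow> ev F \<alpha> \<beta> b'" for F
    by (auto intro!: tendsto_eq_intros t' y')
  have Pz: "ev P (\<alpha> + t' n * \<alpha>') (\<beta> + t' n * \<beta>') (y' n) = 0" for n using cn[of n] by (simp add: pcone_iff)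
  have "ev P \<alpha> \<beta> b' = 0"
    using lim[of P] unfolding Pz by (simp add: LIMSEQ_const_iff)
  then have Q0: "ev Q \<alpha> \<beta> b' \<noteq> 0" using ab by (intro Q) auto
  define h where "h n = \<eta> (\<alpha> + t' n * \<alpha>') (\<beta> + t' n * \<beta>') (y' n)" for n
  have hl: "cmod (h n) ^ l = cmod (ev A (\<alpha> + t' n * \<alpha>') (\<beta> + t' n * \<beta>') (y' n) / ev Q (\<alpha> + t' n * \<alpha>') (\<beta> + t' n * \<beta>') (y' n))" for n
  proof -
    have "ev Q (\<alpha> + t' n * \<alpha>') (\<beta> + t' n * \<beta>') (y' n) \<noteq> 0" using cn[of n] by (intro Q) (auto simp: pcone_iff)
    then show ?thesis using root[OF cn[of n]] unfolding h_def norm_power[symmetric]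
      by (metis nonzero_eq_divide_eq)
  qed
  define c where "c = cmod (ev A \<alpha> \<beta> b' / ev Q \<alpha> \<beta> b')"
  have "(\<lambda>n. cmod (h n) ^ l) \<longlonglongrightarrow> c" unfolding hl c_def by (intro tendsto_norm tendsto_divide lim Q0)
  then have "eventually (\<lambda>n. cmod (h n) ^ l < c + 1) sequentially" by (rule order_tendstoD) simp
  \<comment> \<open>Since \<open>c + 1\<close> is at least 1, a value of modulus above it would have
    an \<open>l\<close>-th power above it as well.\<close>
  then have hb: "eventually (\<lambda>n. cmod (h n) \<le> c + 1) sequentially"
  proof eventually_elim
    case (elim n)
    show ?case
    proof (rule ccontr)
      assume "\<not> cmod (h n) \<le> c + 1"
      moreover have "c \<ge> 0" by (simp add: c_def)
      ultimately have "1 \<le> cmod (h n)" "c + 1 < cmod (h n)" by linarith+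
      moreover from this have "cmod (h n) \<le> cmod (h n) ^ l" using l by (intro self_le_power) auto
      ultimately show False using elim by linarith
    qed
  qed
  have rl: "(\<lambda>n. t' n / ev (D3 P) (\<alpha> + t' n * \<alpha>') (\<beta> + t' n * \<beta>') (y' n)) \<longlonglongrightarrow> 0"
    using slice_degree(3)[OF hP top]
    by (intro ramification_limit[OF hP sm ab _ t' y']) (auto simp: Pz)
  define g where "g n = (c + 1) * cmod (ev (poly_shift (Suc a) P) (\<alpha> + t' n * \<alpha>') (\<beta> + t' n * \<beta>') (y' n)) *
     cmod (t' n / ev (D3 P) (\<alpha> + t' n * \<alpha>') (\<beta> + t' n * \<beta>') (y' n))" for n
  have "g \<longlonglongrightarrow> (c + 1) * cmod (ev (poly_shift (Suc a) P) \<alpha> \<beta> b') * cmod 0"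
    unfolding g_def by (intro tendsto_intros lim rl)
  then have "g \<longlonglongrightarrow> 0" by simp
  then have "eventually (\<lambda>n. g n < \<epsilon>) sequentially" using assms(2) by (rule order_tendstoD)
  with hb have "eventually (\<lambda>n. False) sequentially"
  proof eventually_elim
    case (elim n)
    have "cmod (t' n * theta a (\<alpha> + t' n * \<alpha>') (\<beta> + t' n * \<beta>') (y' n))
      = cmod (h n) * cmod (ev (poly_shift (Suc a) P) (\<alpha> + t' n * \<alpha>') (\<beta> + t' n * \<beta>') (y' n)) *
     cmod (t' n / ev (D3 P) (\<alpha> + t' n * \<alpha>') (\<beta> + t' n * \<beta>') (y' n))"
      by (simp add: theta_def h_def norm_mult norm_divide)
    also have "\<dots> \<le> g n" unfolding g_def using elim by (intro mult_right_mono) auto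
    finally show False using elim ty(4)[of "r n"] by (simp add: t'_def y'_def)
  qed
  then show False by simp
qed

end

section \<open>Meromorphic functions of bounded growth\<close>

lemma prod_linear_dvd:
  fixes q :: "'a::idom poly"
  assumes "finite D" "\<And>d. d \<in> D \<Longrightarrow> poly q d = 0"
  shows "(\<Prod>d\<in>D. [:-d, 1:]) dvd q"
  using assms
proof (induction D)
  case (insert d D)
  then obtain r where r: "q = (\<Prod>d\<in>D. [:-d, 1:]) * r" by (auto elim: dvdE)
  have "(\<Prod>d'\<in>D. poly [:-d', 1:] d) \<noteq> 0" using insert by auto
  moreover have "(\<Prod>d'\<in>D. poly [:-d', 1:] d) * poly r d = 0"
    using insert.prems[of d] unfolding r by (simp add: poly_prod)
  ultimately have "poly r d = 0" by simp
  then have "[:-d, 1:] dvd r" by (simp add: poly_eq_0_iff_dvd)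
  then have "[:-d, 1:] * (\<Prod>d\<in>D. [:-d, 1:]) dvd r * (\<Prod>d\<in>D. [:-d, 1:])"
    by (intro mult_dvd_mono dvd_refl)
  then show ?case unfolding prod.insert[OF insert.hyps] r by (simp only: mult.commute)
qed simp

text \<open>Multiplying by \<open>W\<close>, with simple zeros on \<open>D\<close>, removes the
  singularities; Liouville's theorem makes the product a polynomial, and since it vanishes on
  \<open>D\<close>, \<open>W\<close> can be divided out. Growth below every multiple of the power
  \<open>K + 1\<close> lowers the degree bound to \<open>K\<close>, so \<open>p = 0\<close> for
  negative \<open>K\<close>.\<close>

lemma meromorphic_growth_poly:
  assumes D: "finite D" and holo: "f holomorphic_on - D"
    and sing: "\<And>d. d \<in> D \<Longrightarrow> ((\<lambda>x. (x - d) * f x) \<longlongrightarrow> 0) (at d)"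
    and growth: "\<And>\<epsilon>. \<epsilon> > 0 \<Longrightarrow> \<exists>R. \<forall>x. R \<le> cmod x \<longrightarrow> x \<notin> D \<longrightarrow> cmod (f x) \<le> \<epsilon> * cmod x powi (K + 1)"
  shows "\<exists>p. (\<forall>x. x \<notin> D \<longrightarrow> f x = poly p x) \<and> (p \<noteq> 0 \<longrightarrow> int (degree p) \<le> K)"
proof -
  define W where "W = (\<Prod>d\<in>D. [:-d, 1:])"
  have W0: "poly W x = 0 \<longleftrightarrow> x \<in> D" for x using D by (auto simp: W_def poly_prod)
  \<comment> \<open>The value 0 on \<open>D\<close> is the continuous extension because
    \<open>(x - d) * f x\<close> tends to 0.\<close>
  define h where "h x = (if x \<in> D then 0 else f x * poly W x)" for x
  have "h holomorphic_on UNIV"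
  proof (rule no_isolated_singularity'[OF _ _ open_UNIV D])
    fix d assume d: "d \<in> D"
    have W: "poly W x = (x - d) * poly (\<Prod>d\<in>D - {d}. [:-d, 1:]) x" for x
      unfolding W_def using D d by (subst prod.remove[of D d]) (auto simp: algebra_simps)
    have "((\<lambda>x. ((x - d) * f x) * poly (\<Prod>d\<in>D - {d}. [:-d, 1:]) x) \<longlongrightarrow>
       0 * poly (\<Prod>d\<in>D - {d}. [:-d, 1:]) d) (at d)"
      by (intro tendsto_intros sing d)
    moreover have "eventually (\<lambda>x. ((x - d) * f x) * poly (\<Prod>d\<in>D - {d}. [:-d, 1:]) x = h x) (at d)"
      using eventually_notin_finite[OF D] by eventually_elim (simp add: h_def W)
    ultimately have "(h \<longlongrightarrow> 0 * poly (\<Prod>d\<in>D - {d}. [:-d, 1:]) d) (at d)"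
      by (rule Lim_transform_eventually)
    then show "(h \<longlongrightarrow> h d) (at d)"
      using d by (simp add: h_def)
  next
    have "(\<lambda>x. f x * poly W x) holomorphic_on - D" by (intro holomorphic_intros holo)
    then have "h holomorphic_on - D" by (rule holomorphic_transform) (simp add: h_def)
    then show "h holomorphic_on UNIV - D" by (simp add: Compl_eq_Diff_UNIV)
  qed
  moreover obtain R where R: "\<And>x. R \<le> cmod x \<Longrightarrow> x \<notin> D \<Longrightarrow> cmod (f x) \<le> 1 * cmod x powi (K + 1)"
    using growth[of 1] by auto
  define R' where "R' = max R (1 + (\<Sum>d\<in>D. cmod d))"
  have R'D: "x \<notin> D" "cmod x \<ge> 1" "\<And>d. d \<in> D \<Longrightarrow> cmod d \<le> cmod x" if "R' \<le> cmod x" for x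
  proof -
    have s: "cmod d \<le> (\<Sum>d\<in>D. cmod d)" if "d \<in> D" for d
      using D that by (intro member_le_sum) auto
    have "(\<Sum>d\<in>D. cmod d) \<ge> 0" by (intro sum_nonneg) auto
    with that s show "x \<notin> D" "cmod x \<ge> 1" "\<And>d. d \<in> D \<Longrightarrow> cmod d \<le> cmod x"
      unfolding R'_def by fastforce+
  qed
  \<comment> \<open>A crude exponent suffices for Liouville: replacing \<open>K + 1\<close> by
    \<open>nat (K + 1)\<close> only weakens the bound for \<open>cmod x\<close> at least 1.\<close>
  have "cmod (h x) \<le> 2 ^ card D * cmod x ^ (nat (K + 1) + card D)" if x: "R' \<le> cmod x" for x
  proof -
    note d = R'D[OF x]
    have "cmod (f x) \<le> cmod x powi (K + 1)" using R[of x] x d(1) by (simp add: R'_def)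
    also have "\<dots> \<le> cmod x powi (int (nat (K + 1)))" by (intro power_int_increasing d(2)) auto
    finally have 1: "cmod (f x) \<le> cmod x ^ nat (K + 1)" by (simp only: power_int_of_nat)
    have "cmod (poly W x) = (\<Prod>d\<in>D. cmod (x - d))"
      by (simp add: W_def poly_prod prod_norm)
    also have "\<dots> \<le> (\<Prod>d\<in>D. 2 * cmod x)"
    proof (intro prod_mono conjI norm_ge_zero)
      fix d' assume "d' \<in> D"
      then show "cmod (x - d') \<le> 2 * cmod x"
        using d(3)[of d'] norm_triangle_ineq4[of x d'] by linarith
    qed
    finally have 2: "cmod (poly W x) \<le> (2 * cmod x) ^ card D" by simp
    have "cmod (h x) = cmod (f x) * cmod (poly W x)" using d(1) by (simp add: h_def norm_mult)
    also have "\<dots> \<le> cmod x ^ nat (K + 1) * (2 * cmod x) ^ card D" by (intro mult_mono 1 2) auto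
    finally show ?thesis by (simp add: power_add power_mult_distrib mult_ac)
  qed
  ultimately have L: "h \<xi> = (\<Sum>k\<le>nat (K + 1) + card D. (deriv ^^ k) h 0 / fact k * \<xi> ^ k)" for \<xi>
    by (intro Liouville_polynomial) auto
  define q where "q = (\<Sum>k\<le>nat (K + 1) + card D. monom ((deriv ^^ k) h 0 / fact k) k)"
  have q: "poly q x = h x" for x
    by (rule trans[OF _ L[of x, symmetric]]) (simp add: q_def poly_sum poly_monom)
  have "W dvd q" unfolding W_def by (intro prod_linear_dvd D) (simp add: q h_def)
  then obtain p where p: "q = W * p" by (rule dvdE)
  have fp: "f x = poly p x" if "x \<notin> D" for x
  proof -
    have "poly W x * f x = poly W x * poly p x"
      using q[of x] that unfolding p poly_mult h_def by (metis mult.commute)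
    with that show ?thesis using W0[of x] by (metis mult_cancel_left)
  qed
  have "int (degree p) \<le> K" if "p \<noteq> 0"
  proof (rule ccontr)
    assume K: "\<not> int (degree p) \<le> K"
    \<comment> \<open>Far out, \<open>p\<close> exceeds \<open>c / 2\<close> times its leading
      power, while growth with \<open>\<epsilon> = c / 2\<close> bounds it by just that if the
      degree is at least \<open>K + 1\<close>.\<close>
    define c where "c = cmod (lead_coeff p)"
    have c: "c > 0" using that by (simp add: c_def)
    have "((\<lambda>x. cmod (poly p x / x ^ degree p)) \<longlongrightarrow> c) at_infinity"
      unfolding c_def by (intro tendsto_norm poly_divide_tendsto_aux)
    then have "eventually (\<lambda>x. cmod (poly p x / x ^ degree p) > c / 2) at_infinity"
      using c by (intro order_tendstoD(1)) auto
    then obtain b where b: "\<And>x. cmod x \<ge> b \<Longrightarrow> cmod (poly p x / x ^ degree p) > c / 2"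
      unfolding eventually_at_infinity by blast
    obtain R1 where R1: "\<And>x. R1 \<le> cmod x \<Longrightarrow> x \<notin> D \<Longrightarrow> cmod (f x) \<le> c / 2 * cmod x powi (K + 1)"
      using growth[of "c / 2"] c by auto
    define x where "x = complex_of_real (max 0 (max R' (max b R1)))"
    have x: "cmod x \<ge> R'" "cmod x \<ge> b" "cmod x \<ge> R1" by (auto simp: x_def)
    note d = R'D[OF x(1)]
    have x0: "cmod x ^ degree p > 0" using d(2) by (intro zero_less_power) linarith
    have "c / 2 * cmod x ^ degree p < cmod (poly p x)"
      using b[OF x(2)] x0 by (simp add: norm_divide norm_power pos_less_divide_eq)
    also have "\<dots> \<le> c / 2 * cmod x powi (K + 1)" using R1[OF x(3) d(1)] fp[OF d(1)] by simp
    also have "\<dots> \<le> c / 2 * cmod x powi (int (degree p))"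
      using K c d(2) by (intro mult_left_mono power_int_increasing) auto
    finally show False by simp
  qed
  with fp show ?thesis by blast
qed

definition "X1 = ([:[:[:0, 1:]:]:] :: poly3)"
definition "X2 = ([:[:0, 1:]:] :: poly3)"
definition "X3 = ([:0, 1:] :: poly3)"

lemma ev_X [simp]: "ev X1 x w y = x" "ev X2 x w y = w" "ev X3 x w y = y"
  by (simp_all add: ev_def X1_def X2_def X3_def)

lemma homogeneous_X: "homogeneous 1 X1" "homogeneous 1 X2" "homogeneous 1 X3"
  by (rule homogeneousI_ev; simp)+

definition const3 :: "complex \<Rightarrow> poly3" where "const3 c = [:[:[:c:]:]:]"

lemma ev_const3 [simp]: "ev (const3 c) x w y = c" by (simp add: const3_def)

lemma cone_scale:
  assumes "homogeneous e P" "homogeneous b B" "c \<noteq> 0" "(x, w, y) \<in> pcone P B"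
  shows "(c * x, c * w, c * y) \<in> pcone P B"
  using assms(3,4) unfolding pcone_iff homogeneous_ev[OF assms(1)] homogeneous_ev[OF assms(2)] by auto

section \<open>Polynomiality of the traces and interpolation by a form\<close>

context monic_curve_function
begin

text \<open>Near an unramified \<open>x1\<close> the trace is a sum over \<open>e\<close> branches.
  The roots \<open>\<sigma> b x\<close> are chosen separately at each \<open>x\<close>;
  \<open>near_root\<close> makes them continuous at \<open>x1\<close>, which is enough for a
  derivative there, and holomorphy follows by varying \<open>x1\<close>.\<close>

lemma tr_differentiable:
  assumes x1: "x1 \<notin> ram"
  shows "tr a field_differentiable (at x1)"
proof -
  define Y where "Y = {y. ev P x1 1 y = 0}"
  define \<sigma> where "\<sigma> b x = (SOME r. ev P x 1 r = 0 \<and> cmod (r - b) ^ e \<le> cmod (ev P x 1 b) / cmod (ev P 0 0 1))" for b x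
  have \<sigma>: "ev P x 1 (\<sigma> b x) = 0" "cmod (\<sigma> b x - b) ^ e \<le> cmod (ev P x 1 b) / cmod (ev P 0 0 1)" for b x
    using someI_ex[OF near_root[OF hP top e, of x 1 b]] unfolding \<sigma>_def by blast+
  have fin: "finite Y" unfolding Y_def by (rule finite_roots)
  have \<sigma>1: "\<sigma> b x1 = b" if "b \<in> Y" for b
  proof -
    have "cmod (\<sigma> b x1 - b) ^ e \<le> 0" using \<sigma>(2)[of b x1] that by (simp add: Y_def)
    then have "cmod (\<sigma> b x1 - b) ^ e = 0" by (intro antisym) auto
    then show ?thesis by simp
  qed
  have lim: "(\<sigma> b \<longlongrightarrow> b) (at x1)" if "b \<in> Y" for b
  proof (rule tendstoI)
    fix r :: real assume r: "r > 0"
    have "((\<lambda>x. cmod (ev P x 1 b) / cmod (ev P 0 0 1)) \<longlongrightarrow> cmod (ev P x1 1 b) / cmod (ev P 0 0 1)) (at x1)"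
      using top by (intro tendsto_intros) auto
    then have "eventually (\<lambda>x. cmod (ev P x 1 b) / cmod (ev P 0 0 1) < r ^ e) (at x1)"
      using r that by (intro order_tendstoD(2)) (auto simp: Y_def)
    then show "eventually (\<lambda>x. dist (\<sigma> b x) b < r) (at x1)"
    proof eventually_elim
      case (elim x)
      then have "cmod (\<sigma> b x - b) ^ e < r ^ e" using \<sigma>(2)[of b x] by linarith
      then show ?case using r by (auto simp: dist_norm intro: power_less_imp_less_base)
    qed
  qed
  have nram: "eventually (\<lambda>x. x \<notin> ram) (at x1)" by (rule eventually_notin_finite[OF finite_ram])
  have diff: "\<exists>d. ((\<lambda>x. theta a x 1 (\<sigma> b x)) has_field_derivative d) (at x1)" if b: "b \<in> Y" for b
  proof -
    have cn: "(x1, 1, b) \<in> pcone P B" "ev (D3 P) x1 1 b \<noteq> 0"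
      using ram_cone[OF x1, of b] b by (auto simp: Y_def)
    obtain \<sigma>' where s': "(\<sigma> b has_field_derivative \<sigma>') (at x1)"
      using branch_differentiable[OF lim[OF b] \<sigma>1[OF b] \<sigma>(1) cn(2)] by blast
    have dF: "\<exists>d. ((\<lambda>x. ev F x 1 (\<sigma> b x)) has_field_derivative d) (at x1)" for F
      using ev_chain[OF DERIV_ident DERIV_const s', of F 1] by blast
    obtain dA dQ dS dD where d: "((\<lambda>x. ev A x 1 (\<sigma> b x)) has_field_derivative dA) (at x1)"
      "((\<lambda>x. ev Q x 1 (\<sigma> b x)) has_field_derivative dQ) (at x1)"
      "((\<lambda>x. ev (poly_shift (Suc a) P) x 1 (\<sigma> b x)) has_field_derivative dS) (at x1)"
      "((\<lambda>x. ev (D3 P) x 1 (\<sigma> b x)) has_field_derivative dD) (at x1)"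
      using dF by metis
    have Q1: "ev Q x 1 (\<sigma> b x) \<noteq> 0" for x using \<sigma>(1)[of x b] by (intro Q) auto
    have cv: "eventually (\<lambda>x. (x, 1, \<sigma> b x) \<in> pcone P B) (at x1)"
      using nram by eventually_elim (use ram_cone \<sigma>(1) in blast)
    have "((\<lambda>x. (\<lambda>(x, w, y). \<eta> x w y) (x, 1, \<sigma> b x)) \<longlongrightarrow> (\<lambda>(x, w, y). \<eta> x w y) (x1, 1, b)) (at x1)"
      by (rule continuous_on_tendsto_compose[OF cont _ cn(1) cv]) (intro tendsto_intros lim b)
    then have lim\<eta>: "((\<lambda>x. \<eta> x 1 (\<sigma> b x)) \<longlongrightarrow> \<eta> x1 1 (\<sigma> b x1)) (at x1)" using \<sigma>1[OF b] by simp
    have pw: "\<eta> x 1 (\<sigma> b x) ^ l = ev A x 1 (\<sigma> b x) / ev Q x 1 (\<sigma> b x)" if "(x, 1, \<sigma> b x) \<in> pcone P B" for x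
      using root[OF that] Q1[of x] by (simp add: field_simps)
    have "ev A x1 1 b \<noteq> 0" by (rule A[OF cn(1)])
    with pw[of x1] cn(1) Q1[of x1] \<sigma>1[OF b] l have "\<eta> x1 1 (\<sigma> b x1) \<noteq> 0"
      by (auto simp: zero_power)
    moreover have "eventually (\<lambda>x. \<eta> x 1 (\<sigma> b x) ^ l = ev A x 1 (\<sigma> b x) / ev Q x 1 (\<sigma> b x)) (at x1)"
      using cv by eventually_elim (rule pw)
    ultimately obtain dE where "((\<lambda>x. \<eta> x 1 (\<sigma> b x)) has_field_derivative dE) (at x1)"
      using root_differentiable[OF lim\<eta> _ l _ _ DERIV_divide[OF d(1,2) Q1]] pw[of x1] cn(1) \<sigma>1[OF b] by auto
    from DERIV_divide[OF DERIV_mult[OF this d(3)] d(4)] cn(2) \<sigma>1[OF b]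
    show ?thesis unfolding theta_def by auto
  qed
  then obtain d where d: "\<And>b. b \<in> Y \<Longrightarrow> ((\<lambda>x. theta a x 1 (\<sigma> b x)) has_field_derivative d b) (at x1)"
    by metis
  have "eventually (\<lambda>x. \<sigma> b x \<noteq> \<sigma> c x) (at x1)" if "b \<in> Y" "c \<in> Y" "b \<noteq> c" for b c
  proof -
    have "((\<lambda>x. \<sigma> b x - \<sigma> c x) \<longlongrightarrow> b - c) (at x1)" by (intro tendsto_diff lim that)
    then have "eventually (\<lambda>x. \<sigma> b x - \<sigma> c x \<noteq> 0) (at x1)"
      using that by (intro tendsto_imp_eventually_ne) auto
    then show ?thesis by simp
  qed
  then have "eventually (\<lambda>x. \<forall>b\<in>Y. \<forall>c\<in>Y. b \<noteq> c \<longrightarrow> \<sigma> b x \<noteq> \<sigma> c x) (at x1)"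
    using fin by (intro eventually_ball_finite ballI) (auto intro: eventually_mono)
  with nram have e1: "eventually (\<lambda>x. tr a x = (\<Sum>b\<in>Y. theta a x 1 (\<sigma> b x))) (at x1)"
  proof eventually_elim
    case (elim x)
    then have inj: "inj_on (\<lambda>b. \<sigma> b x) Y" unfolding inj_on_def by blast
    \<comment> \<open>The branches give \<open>e\<close> distinct roots, and the fibre has exactly
      \<open>e\<close>, so none is missed.\<close>
    have "(\<lambda>b. \<sigma> b x) ` Y = {y. ev P x 1 y = 0}"
    proof (rule card_subset_eq)
      show "finite {y. ev P x 1 y = 0}" by (rule finite_roots)
      show "(\<lambda>b. \<sigma> b x) ` Y \<subseteq> {y. ev P x 1 y = 0}" using \<sigma>(1) by auto
      show "card ((\<lambda>b. \<sigma> b x) ` Y) = card {y. ev P x 1 y = 0}"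
        using card_image[OF inj] card_roots[OF x1] card_roots[of x] elim by (simp add: Y_def)
    qed
    then show ?case unfolding tr_def using sum.reindex[OF inj, of "\<lambda>y. theta a x 1 y"] by simp
  qed
  have "tr a x1 = (\<Sum>b\<in>Y. theta a x1 1 (\<sigma> b x1))"
    unfolding tr_def Y_def[symmetric] using \<sigma>1 by (intro sum.cong) auto
  with e1 have "eventually (\<lambda>x. tr a x = (\<Sum>b\<in>Y. theta a x 1 (\<sigma> b x))) (nhds x1)"
    by (simp add: eventually_nhds_conv_at)
  moreover have "((\<lambda>x. \<Sum>b\<in>Y. theta a x 1 (\<sigma> b x)) has_field_derivative (\<Sum>b\<in>Y. d b)) (at x1)"
    by (intro DERIV_sum d)
  ultimately have "(tr a has_field_derivative (\<Sum>b\<in>Y. d b)) (at x1)"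
    by (subst DERIV_cong_ev[OF refl _ refl])
  then show ?thesis unfolding field_differentiable_def by blast
qed

lemma tr_holomorphic: "tr a holomorphic_on - ram"
  unfolding holomorphic_on_def using tr_differentiable field_differentiable_at_within by blast

lemma tr_bound:
  assumes "\<And>y. ev P x 1 y = 0 \<Longrightarrow> cmod (c * theta a x 1 y) \<le> r" "r \<ge> 0"
  shows "cmod (c * tr a x) \<le> real e * r"
proof -
  have "cmod (c * tr a x) \<le> (\<Sum>y | ev P x 1 y = 0. r)"
    unfolding tr_def sum_distrib_left using assms(1) by (intro sum_norm_le) auto
  also have "\<dots> \<le> real e * r" using card_roots_le[of x 1] assms(2) by (auto intro!: mult_right_mono)
  finally show ?thesis .
qed

lemma tr_singular: "((\<lambda>x. (x - d) * tr a x) \<longlongrightarrow> 0) (at d)"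
proof (rule tendstoI)
  fix r :: real assume r: "r > 0"
  define r' where "r' = r / (real e + 1)"
  have r': "r' > 0" "real e * r' < r" using r by (auto simp: r'_def field_simps)
  obtain \<delta> where \<delta>: "\<delta> > 0" "\<And>t y. t \<noteq> 0 \<Longrightarrow> cmod t < \<delta> \<Longrightarrow> (d + t * 1, 1 + t * 0, y) \<in> pcone P B \<Longrightarrow>
      cmod (t * theta a (d + t * 1) (1 + t * 0) y) \<le> r'"
    using theta_small[of d 0 1 1 r' a] r' by auto
  have "eventually (\<lambda>x. x \<noteq> d \<and> dist x d < \<delta>) (at d)"
    using \<delta>(1) unfolding eventually_at by blast
  with eventually_notin_finite[OF finite_ram, of d]
  show "eventually (\<lambda>x. dist ((x - d) * tr a x) 0 < r) (at d)"
  proof eventually_elim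
    case (elim x)
    have "cmod ((x - d) * theta a x 1 y) \<le> r'" if "ev P x 1 y = 0" for y
      using \<delta>(2)[of "x - d" y] elim ram_cone[OF _ that] by (simp add: dist_norm)
    from tr_bound[OF this] r' show ?case by simp
  qed
qed

text \<open>In the coordinate \<open>t = 1 / x\<close> at infinity, homogeneity contributes
  \<open>x\<close> to the power \<open>N - a\<close>, and the factor \<open>t\<close> in
  \<open>theta_small\<close> costs one more power.\<close>

lemma tr_growth:
  assumes "r > 0" "a < e"
  shows "\<exists>R. \<forall>x. R \<le> cmod x \<longrightarrow> x \<notin> ram \<longrightarrow> cmod (tr a x) \<le> r * cmod x powi (N - int a + 1)"
proof -
  define r' where "r' = r / real e"
  have r': "r' > 0" "real e * r' = r" using e assms by (auto simp: r'_def)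
  obtain \<delta> where \<delta>: "\<delta> > 0" "\<And>t y. t \<noteq> 0 \<Longrightarrow> cmod t < \<delta> \<Longrightarrow> (1 + t * 0, 0 + t * 1, y) \<in> pcone P B \<Longrightarrow>
      cmod (t * theta a (1 + t * 0) (0 + t * 1) y) \<le> r'"
    using theta_small[of 1 1 0 0 r' a] r' by auto
  show ?thesis
  proof (intro exI[of _ "2 / \<delta>"] allI impI)
    fix x assume x: "2 / \<delta> \<le> cmod x" "x \<notin> ram"
    have "2 / \<delta> > 0" using \<delta> by simp
    then have x0: "x \<noteq> 0" using x(1) by auto
    define t where "t = 1 / x"
    have t: "t \<noteq> 0" "cmod t < \<delta>"
      using x x0 \<delta>(1) by (auto simp: t_def norm_divide field_simps)
    have "cmod (1 * theta a x 1 y) \<le> r' * cmod x powi (N - int a + 1)" if "ev P x 1 y = 0" for y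
    proof -
      have "(t * x, t * 1, t * y) \<in> pcone P B"
        using ram_cone[OF x(2) that] by (intro cone_scale[OF hP hB t(1)]) auto
      then have c: "(1, t, t * y) \<in> pcone P B" using x0 by (simp add: t_def)
      have "theta a (x * 1) (x * t) (x * (t * y)) = x powi (N - int a) * theta a 1 t (t * y)"
        by (rule theta_hom[OF x0 c assms(2)])
      then have "cmod (theta a x 1 y) = cmod x powi (N - int a) * cmod (theta a 1 t (t * y))"
        using x0 by (simp add: t_def norm_mult norm_power_int)
      also have "cmod (theta a 1 t (t * y)) = cmod x * cmod (t * theta a 1 t (t * y))"
        using x0 by (simp add: t_def norm_divide norm_mult)
      also have "\<dots> \<le> cmod x * r'" using \<delta>(2)[OF t, of "t * y"] c by (intro mult_left_mono) auto
      finally show ?thesis using x0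
        by (simp add: power_int_add mult_ac mult_left_mono)
    qed
    from tr_bound[OF this] r' show "cmod (tr a x) \<le> r * cmod x powi (N - int a + 1)"
      by (simp add: mult.assoc[symmetric])
  qed
qed

lemma tr_polynomial:
  assumes "a < e"
  shows "\<exists>p. (\<forall>x. x \<notin> ram \<longrightarrow> tr a x = poly p x) \<and> (p \<noteq> 0 \<longrightarrow> int (degree p) \<le> N - int a)"
  using tr_growth[OF _ assms]
  by (intro meromorphic_growth_poly finite_ram tr_holomorphic tr_singular) auto

text \<open>Exchanging the sums leaves, for each root \<open>z\<close>, the difference quotient of
  the slice at \<open>(y, z)\<close>. It vanishes for \<open>z \<noteq> y\<close>, both being roots,
  and for \<open>z = y\<close> it equals the denominator of \<open>theta\<close>.\<close>

lemma interpolation: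
  assumes "x \<notin> ram" "ev P x 1 y = 0"
  shows "(\<Sum>a<e. tr a x * y ^ a) = \<eta> x 1 y"
proof -
  note deg = slice_degree(1)[where x=x and w=1, OF hP top]
  have "(\<Sum>a<e. tr a x * y ^ a) = (\<Sum>z | ev P x 1 z = 0. \<Sum>a<e. theta a x 1 z * y ^ a)"
    unfolding tr_def sum_distrib_right by (rule sum.swap)
  also have "\<dots> = (\<Sum>z | ev P x 1 z = 0. \<eta> x 1 z / ev (D3 P) x 1 z *
       (\<Sum>a<e. poly (poly_shift (Suc a) (slice x 1 P)) z * y ^ a))"
    unfolding theta_def sum_distrib_left slice_shift[symmetric] by (intro sum.cong) auto
  also have "\<dots> = (\<Sum>z | ev P x 1 z = 0. if z = y then \<eta> x 1 y else 0)"
  proof (intro sum.cong refl)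
    fix z assume "z \<in> {z. ev P x 1 z = 0}"
    then have z: "ev P x 1 z = 0" by simp
    have "(\<Sum>a<e. poly (poly_shift (Suc a) (slice x 1 P)) z * y ^ a) * (y - z) = 0"
      using difference_quotient(1)[OF deg, of z y] z assms(2) by simp
    moreover have "(\<Sum>a<e. poly (poly_shift (Suc a) (slice x 1 P)) z * z ^ a) = ev (D3 P) x 1 z"
      using difference_quotient(2)[OF deg, of z] by simp
    ultimately show "\<eta> x 1 z / ev (D3 P) x 1 z * (\<Sum>a<e. poly (poly_shift (Suc a) (slice x 1 P)) z * y ^ a)
        = (if z = y then \<eta> x 1 y else 0)"
      using ram_cone[OF assms(1) z] by auto
  qed
  also have "\<dots> = \<eta> x 1 y" using assms(2) finite_roots by simp
  finally show ?thesis .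
qed

text \<open>Interpolation gives a polynomial in \<open>x\<close> and \<open>y\<close> on
  \<open>w = 1\<close>, and powers of \<open>w\<close> homogenise it. Equality extends by scaling to
  \<open>w \<noteq> 0\<close>, and by density and continuity to the points over \<open>ram\<close>
  and over \<open>w = 0\<close>.\<close>

lemma function_is_form:
  "\<exists>G. (N \<ge> 0 \<longrightarrow> homogeneous (nat N) G) \<and> (N < 0 \<longrightarrow> G = 0) \<and>
     (\<forall>x w y. (x, w, y) \<in> pcone P B \<longrightarrow> \<eta> x w y = ev G x w y)"
proof -
  obtain p where p: "\<And>a x. a < e \<Longrightarrow> x \<notin> ram \<Longrightarrow> tr a x = poly (p a) x"
    "\<And>a. a < e \<Longrightarrow> p a \<noteq> 0 \<Longrightarrow> int (degree (p a)) \<le> N - int a"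
    using tr_polynomial by metis
  \<comment> \<open>The degree bound for a nonzero \<open>p a\<close> makes the exponent of
    \<open>X2\<close> a true difference; for \<open>p a = 0\<close> the term vanishes whatever the
    exponent is.\<close>
  define G where "G = (\<Sum>a<e. \<Sum>i\<le>degree (p a). const3 (coeff (p a) i) * X1 ^ i * X2 ^ (nat (N - int a) - i) * X3 ^ a)"
  have hG: "homogeneous (nat N) G" if "N \<ge> 0"
    unfolding G_def
  proof (intro homogeneous_sum)
    fix a i assume a: "a \<in> {..<e}" and i: "i \<in> {..degree (p a)}"
    show "homogeneous (nat N) (const3 (coeff (p a) i) * X1 ^ i * X2 ^ (nat (N - int a) - i) * X3 ^ a)"
    proof (cases "p a = 0")
      case False
      then have "0 + 1 * i + 1 * (nat (N - int a) - i) + 1 * a = nat N"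
        using p(2)[of a] a i by auto
      then show ?thesis
        unfolding const3_def
        by (metis homogeneous_mult homogeneous_power homogeneous_X homogeneous_const)
    qed (simp add: const3_def)
  qed
  have zG: "G = 0" if "N < 0"
  proof -
    have "p a = 0" if "a < e" for a using p(2)[OF that] \<open>N < 0\<close> by linarith
    then show ?thesis unfolding G_def by (intro sum.neutral ballI) (simp add: const3_def)
  qed
  have 1: "\<eta> x 1 y = ev G x 1 y" if "x \<notin> ram" "ev P x 1 y = 0" for x y
  proof -
    have "ev G x 1 y = (\<Sum>a<e. poly (p a) x * y ^ a)"
      unfolding G_def by (simp add: poly_altdef sum_distrib_right)
    also have "\<dots> = (\<Sum>a<e. tr a x * y ^ a)" using p(1) that by (intro sum.cong) auto
    finally show ?thesis using interpolation[OF that] by simp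
  qed
  have 2: "(x, w, y) \<in> pcone P B \<and> \<eta> x w y = ev G x w y" if z: "ev P x w y = 0" "w \<noteq> 0" "x / w \<notin> ram" for x w y
  proof -
    have eq: "w * (x / w) = x" "w * 1 = w" "w * (y / w) = y" using z by auto
    have "ev P (w * (x / w)) (w * 1) (w * (y / w)) = 0" unfolding eq by fact
    then have r: "ev P (x / w) 1 (y / w) = 0" unfolding homogeneous_ev[OF hP] using z by simp
    have c: "(x / w, 1, y / w) \<in> pcone P B" using ram_cone[OF z(3) r] by blast
    have "(w * (x / w), w * 1, w * (y / w)) \<in> pcone P B" by (rule cone_scale[OF hP hB z(2) c])
    moreover have "\<eta> (w * (x / w)) (w * 1) (w * (y / w)) = ev G (w * (x / w)) (w * 1) (w * (y / w))"
    proof (cases "N \<ge> 0")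
      case True
      then show ?thesis unfolding hom[OF z(2) c] homogeneous_ev[OF hG[OF True]] 1[OF z(3) r]
        by (simp add: power_int_def)
    next
      case False
      then show ?thesis unfolding hom[OF z(2) c] 1[OF z(3) r] using zG by simp
    qed
    ultimately show ?thesis unfolding eq by blast
  qed
  have 3: "\<eta> x0 w0 y0 = ev G x0 w0 y0" if c: "(x0, w0, y0) \<in> pcone P B" for x0 w0 y0
  proof -
    have P0: "ev P x0 w0 y0 = 0" using c by (simp add: pcone_iff)
    have xw: "(x0, w0) \<noteq> (0, 0)"
    proof
      assume "(x0, w0) = (0, 0)"
      then have "ev P (y0 * 0) (y0 * 0) (y0 * 1) = 0" "y0 \<noteq> 0" using c by (auto simp: pcone_iff)
      then show False unfolding homogeneous_ev[OF hP] using top by simp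
    qed
    have "\<exists>z. ev P (fst z) (fst (snd z)) (snd (snd z)) = 0 \<and> fst (snd z) \<noteq> 0 \<and> fst z / fst (snd z) \<notin> ram \<and>
      cmod (fst z - x0) < inverse (real (Suc n)) \<and> cmod (fst (snd z) - w0) < inverse (real (Suc n)) \<and>
      cmod (snd (snd z) - y0) < inverse (real (Suc n))" for n
    proof -
      have "inverse (real (Suc n)) > 0" by simp
      from dense_points[OF hP top e finite_ram xw P0 this] show ?thesis
        by (metis fst_conv snd_conv)
    qed
    then obtain z where z: "\<And>n. ev P (fst (z n)) (fst (snd (z n))) (snd (snd (z n))) = 0"
      "\<And>n. fst (snd (z n)) \<noteq> 0" "\<And>n. fst (z n) / fst (snd (z n)) \<notin> ram"
      and zl: "\<And>n. cmod (fst (z n) - x0) < inverse (real (Suc n))"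
      "\<And>n. cmod (fst (snd (z n)) - w0) < inverse (real (Suc n))"
      "\<And>n. cmod (snd (snd (z n)) - y0) < inverse (real (Suc n))"
      by metis
    have l: "(\<lambda>n. u n) \<longlonglongrightarrow> v" if "\<And>n. cmod (u n - v) < inverse (real (Suc n))" for u v
      using that by (intro LIM_zero_cancel[OF Lim_null_comparison[OF _ LIMSEQ_inverse_real_of_nat]])
        (auto intro!: always_eventually less_imp_le)
    have zz: "z \<longlonglongrightarrow> (x0, w0, y0)"
      using tendsto_Pair[OF l[OF zl(1)] tendsto_Pair[OF l[OF zl(2)] l[OF zl(3)]]] by simp
    have zc: "z n \<in> pcone P B" "(\<lambda>(x, w, y). \<eta> x w y - ev G x w y) (z n) = 0" for n
      using 2[OF z(1,2,3)] by (auto simp: case_prod_beta)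
    have cG: "continuous_on (pcone P B) (\<lambda>(x, w, y). \<eta> x w y - ev G x w y)"
      using cont unfolding case_prod_beta by (intro continuous_intros) auto
    have "(\<lambda>n. (\<lambda>(x, w, y). \<eta> x w y - ev G x w y) (z n)) \<longlonglongrightarrow>
       (\<lambda>(x, w, y). \<eta> x w y - ev G x w y) (x0, w0, y0)"
      by (rule continuous_on_tendsto_compose[OF cG zz c]) (use zc(1) in simp)
    then show ?thesis unfolding zc(2) by (simp add: LIMSEQ_const_iff)
  qed
  show ?thesis
    by (intro exI[of _ G] conjI impI allI) (rule hG zG 3; assumption)+
qed

end

context curve_function
begin

text \<open>Some point \<open>(u, v, 1)\<close> lies off the curve, and the shear puts it at
  \<open>(0, 0, 1)\<close>; the hypotheses on curve and function are carried along.\<close>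

lemma function_is_form_shear:
  "\<exists>G. (N \<ge> 0 \<longrightarrow> homogeneous (nat N) G) \<and> (N < 0 \<longrightarrow> G = 0) \<and>
     (\<forall>x w y. (x, w, y) \<in> pcone P B \<longrightarrow> \<eta> x w y = ev G x w y)"
proof -
  have "P \<noteq> 0" using irr by auto
  then obtain u v where uv: "ev P u v 1 \<noteq> 0" using homogeneous_nonzero_point[OF hP] by blast
  define \<eta>' where "\<eta>' x w y = \<eta> (x + u * y) (w + v * y) y" for x w y
  have cone: "(x, w, y) \<in> pcone (shear u v P) (shear u v B) \<longleftrightarrow> (x + u * y, w + v * y, y) \<in> pcone P B" for x w y
    by (auto simp: pcone_iff)
  interpret M: monic_curve_function "shear u v P" "shear u v B" "shear u v A" "shear u v Q" e b l N \<eta>'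
  proof
    show "homogeneous e (shear u v P)" "homogeneous b (shear u v B)"
      by (rule homogeneous_shear hP hB)+
    show "e > 0" "l > 0" by (rule e l)+
    show "irreducible (shear u v P)" by (rule irreducible_shear[OF irr])
    show "smooth_form (shear u v P)"
      unfolding smooth_form_def
    proof (intro allI impI)
      fix x w y assume z: "(x, w, y) \<noteq> (0, 0, 0)" "ev (shear u v P) x w y = 0"
      have nz: "(x + u * y, w + v * y, y) \<noteq> (0, 0, 0)" using z by auto
      show "ev (D1 (shear u v P)) x w y \<noteq> 0 \<or> ev (D2 (shear u v P)) x w y \<noteq> 0 \<or> ev (D3 (shear u v P)) x w y \<noteq> 0"
        using sm[unfolded smooth_form_def, rule_format, OF nz] z(2) unfolding ev_partials_shear by auto
    qed
    show "\<not> shear u v P dvd shear u v B" using PB by (simp add: shear_dvd_iff)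
    show "ev (shear u v Q) x w y \<noteq> 0" if "ev (shear u v P) x w y = 0" "(x, w, y) \<noteq> (0, 0, 0)" for x w y
      using Q[of "x + u * y" "w + v * y" y] that by (cases "y = 0") auto
    show "ev (shear u v A) x w y \<noteq> 0" if "(x, w, y) \<in> pcone (shear u v P) (shear u v B)" for x w y
      using A that unfolding cone by simp
    have "continuous_on (pcone (shear u v P) (shear u v B)) (\<lambda>z. (\<lambda>(x, w, y). \<eta> x w y) ((\<lambda>(x, w, y). (x + u * y, w + v * y, y)) z))"
    proof (rule continuous_on_compose2[OF cont])
      show "continuous_on (pcone (shear u v P) (shear u v B)) (\<lambda>(x, w, y). (x + u * y, w + v * y, y))"
        unfolding case_prod_beta by (intro continuous_intros)
      show "(\<lambda>(x, w, y). (x + u * y, w + v * y, y)) ` pcone (shear u v P) (shear u v B) \<subseteq> pcone P B"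
        using cone by auto
    qed
    then show "continuous_on (pcone (shear u v P) (shear u v B)) (\<lambda>(x, w, y). \<eta>' x w y)"
      by (simp add: \<eta>'_def case_prod_beta)
    show "\<eta>' (c * x) (c * w) (c * y) = c powi N * \<eta>' x w y"
      if "c \<noteq> 0" "(x, w, y) \<in> pcone (shear u v P) (shear u v B)" for c x w y
      using hom[OF that(1) that(2)[unfolded cone]] unfolding \<eta>'_def by (simp add: algebra_simps)
    show "\<eta>' x w y ^ l * ev (shear u v Q) x w y = ev (shear u v A) x w y"
      if "(x, w, y) \<in> pcone (shear u v P) (shear u v B)" for x w y
      using root[OF that[unfolded cone]] by (simp add: \<eta>'_def)
    show "ev (shear u v P) 0 0 1 \<noteq> 0" using uv by simp
  qed
  obtain G where G: "N \<ge> 0 \<longrightarrow> homogeneous (nat N) G" "N < 0 \<longrightarrow> G = 0"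
    "\<forall>x w y. (x, w, y) \<in> pcone (shear u v P) (shear u v B) \<longrightarrow> \<eta>' x w y = ev G x w y"
    using M.function_is_form by blast
  have z: "shear (- u) (- v) 0 = 0" by (rule ev_zero) simp
  have eq: "\<eta> x w y = ev (shear (- u) (- v) G) x w y" if "(x, w, y) \<in> pcone P B" for x w y
  proof -
    have "(x - u * y, w - v * y, y) \<in> pcone (shear u v P) (shear u v B)" unfolding cone using that by simp
    then have "\<eta>' (x - u * y) (w - v * y) y = ev G (x - u * y) (w - v * y) y" using G(3) by blast
    then show ?thesis by (simp add: \<eta>'_def)
  qed
  show ?thesis
    by (intro exI[of _ "shear (- u) (- v) G"] conjI allI impI eq) (use G z homogeneous_shear in auto)
qed

end

text \<open>This is \<open>dense_points\<close> after a shear, with the projections of the points of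
  \<open>B\<close> as forbidden ratios.\<close>

lemma pcone_dense:
  assumes P: "homogeneous e P" "e > 0" "irreducible P" and B: "homogeneous b B" "\<not> P dvd B"
    and z: "(x0, w0, y0) \<noteq> (0, 0, 0)" "ev P x0 w0 y0 = 0" and \<epsilon>: "\<epsilon> > 0"
  obtains x w y where "(x, w, y) \<in> pcone P B" "cmod (x - x0) < \<epsilon>" "cmod (w - w0) < \<epsilon>" "cmod (y - y0) < \<epsilon>"
proof -
  have "P \<noteq> 0" using P by auto
  then obtain u v where uv: "ev P u v 1 \<noteq> 0" using homogeneous_nonzero_point[OF P(1)] by blast
  define P' where "P' = shear u v P"
  define B' where "B' = shear u v B"
  have P': "homogeneous e P'" "ev P' 0 0 1 \<noteq> 0" "irreducible P'" "homogeneous b B'" "\<not> P' dvd B'"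
    unfolding P'_def B'_def using uv P B
    by (auto intro: homogeneous_shear irreducible_shear simp: shear_dvd_iff)
  have deg: "degree P' > 0" using slice_degree(4)[OF P'(1,2)] P(2) by simp
  define D where "D = {x. \<exists>y. ev P' x 1 y = 0 \<and> ev B' x 1 y = 0}"
  have finD: "finite D" unfolding D_def by (rule finite_common_zeros[OF P'(3) deg P'(1,5,4)])
  \<comment> \<open>Undoing the shear enlarges distances by at most the factor
    \<open>1 + cmod u + cmod v\<close>.\<close>
  define \<epsilon>' where "\<epsilon>' = \<epsilon> / (1 + cmod u + cmod v)"
  have pos: "1 + cmod u + cmod v > 0" by (intro add_pos_nonneg) auto
  have \<epsilon>': "\<epsilon>' > 0" using \<epsilon> pos by (simp add: \<epsilon>'_def)
  have P0: "ev P' (x0 - u * y0) (w0 - v * y0) y0 = 0" using z by (simp add: P'_def)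
  have "(x0 - u * y0, w0 - v * y0) \<noteq> (0, 0)"
  proof
    assume "(x0 - u * y0, w0 - v * y0) = (0, 0)"
    moreover from this have "y0 \<noteq> 0" using z(1) by auto
    ultimately show False using P0 homogeneous_ev[OF P'(1), of y0 0 0 1] P'(2) by simp
  qed
  from dense_points[OF P'(1,2) P(2) finD this P0 \<epsilon>'] obtain x w y where
    d: "ev P' x w y = 0" "w \<noteq> 0" "x / w \<notin> D" "cmod (x - (x0 - u * y0)) < \<epsilon>'"
    "cmod (w - (w0 - v * y0)) < \<epsilon>'" "cmod (y - y0) < \<epsilon>'"
    by blast
  have eq: "w * (x / w) = x" "w * 1 = w" "w * (y / w) = y" using d(2) by auto
  have "ev P' (w * (x / w)) (w * 1) (w * (y / w)) = 0" unfolding eq by fact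
  then have "ev P' (x / w) 1 (y / w) = 0" unfolding homogeneous_ev[OF P'(1)] using d(2) by simp
  then have "ev B' (x / w) 1 (y / w) \<noteq> 0" using d(3) by (auto simp: D_def)
  then have "ev B' (w * (x / w)) (w * 1) (w * (y / w)) \<noteq> 0" unfolding homogeneous_ev[OF P'(4)] using d(2) by simp
  then have "ev B' x w y \<noteq> 0" unfolding eq .
  with d have c: "(x + u * y, w + v * y, y) \<in> pcone P B" by (auto simp: pcone_iff P'_def B'_def)
  have bd: "cmod (a + k * y - a0) < \<epsilon>" if "cmod (a - (a0 - k * y0)) < \<epsilon>'" "cmod k \<le> cmod u + cmod v" for a a0 k
  proof -
    have "a + k * y - a0 = (a - (a0 - k * y0)) + k * (y - y0)" by (simp add: algebra_simps)
    then have "cmod (a + k * y - a0) \<le> cmod (a - (a0 - k * y0)) + cmod k * cmod (y - y0)"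
      by (metis norm_mult norm_triangle_ineq)
    also have "\<dots> < \<epsilon>' + (cmod u + cmod v) * \<epsilon>'"
      using that d(6) by (intro add_less_le_mono mult_mono) auto
    also have "\<dots> = \<epsilon>' * (1 + cmod u + cmod v)" by (simp add: algebra_simps)
    also have "\<dots> = \<epsilon>" using pos unfolding \<epsilon>'_def by (subst nonzero_eq_divide_eq[symmetric]) auto
    finally show ?thesis .
  qed
  show ?thesis
    using bd[OF d(4)] bd[OF d(5)] bd[of y y0 0] d(6) by (intro that[OF c]) auto
qed

section \<open>Cones over curves in affine space\<close>

definition vcone :: "poly3 \<Rightarrow> poly3 \<Rightarrow> (complex ^ 3) set" where
  "vcone P B = {z. z \<noteq> 0 \<and> eval3 P z = 0 \<and> eval3 B z \<noteq> 0}"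

definition v3 :: "complex \<Rightarrow> complex \<Rightarrow> complex \<Rightarrow> complex ^ 3" where
  "v3 x w y = (\<chi> i. if i = 1 then x else if i = 2 then w else y)"

lemma v3_nth [simp]: "v3 x w y $ 1 = x" "v3 x w y $ 2 = w" "v3 x w y $ 3 = y"
  by (simp_all add: v3_def)

lemma v3_eta [simp]: "v3 (z $ 1) (z $ 2) (z $ 3) = z"
  by (simp add: vec_eq_iff forall_3)

lemma v3_eq_0 [simp]: "v3 x w y = 0 \<longleftrightarrow> x = 0 \<and> w = 0 \<and> y = 0"
  by (simp add: vec_eq_iff forall_3)

lemma v3_scale: "v3 (c * x) (c * w) (c * y) = c *s v3 x w y"
  by (simp add: vec_eq_iff forall_3)

lemma eval3_v3 [simp]: "eval3 F (v3 x w y) = ev F x w y"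
  by (simp add: eval3_ev)

lemma continuous_on_v3:
  assumes "continuous_on S f" "continuous_on S g" "continuous_on S h"
  shows "continuous_on S (\<lambda>x. v3 (f x) (g x) (h x))"
  unfolding v3_def
proof (rule continuous_on_vec_lambda)
  fix i :: 3
  show "continuous_on S (\<lambda>x. if i = 1 then f x else if i = 2 then g x else h x)"
    by (cases "i = 1"; cases "i = 2"; simp add: assms)
qed

lemma continuous_on_eval3 [continuous_intros]:
  "continuous_on S f \<Longrightarrow> continuous_on S (\<lambda>x. eval3 F (f x))"
  unfolding eval3_ev by (intro continuous_intros)

lemma eval3_homogeneous: "homogeneous d F \<Longrightarrow> eval3 F (c *s z) = c ^ d * eval3 F z"
  by (simp add: eval3_ev homogeneous_ev)

lemma eval3_simps [simp]:
  "eval3 0 z = 0" "eval3 1 z = 1" "eval3 (F + G) z = eval3 F z + eval3 G z"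
  "eval3 (F - G) z = eval3 F z - eval3 G z"
  "eval3 (F * G) z = eval3 F z * eval3 G z" "eval3 (F ^ k) z = eval3 F z ^ k"
  "eval3 (prod f I) z = (\<Prod>i\<in>I. eval3 (f i) z)"
  by (simp_all add: eval3_ev)

lemma vcone_pcone: "v3 x w y \<in> vcone P B \<longleftrightarrow> (x, w, y) \<in> pcone P B"
  by (auto simp: vcone_def pcone_iff)

lemma eval3_dvd: "F dvd G \<Longrightarrow> eval3 F z = 0 \<Longrightarrow> eval3 G z = 0"
  by (auto elim!: dvdE)

text \<open>Allows identities proved off \<open>B\<close> to be extended to the points of
  \<open>B\<close> by continuity.\<close>

lemma vcone_closure:
  assumes P: "homogeneous e P" "e > 0" "irreducible P" and B: "homogeneous b B" "\<not> P dvd B"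
    and z: "z \<noteq> 0" "eval3 P z = 0"
  shows "z \<in> closure (vcone P B)"
  unfolding closure_approachable
proof (intro allI impI)
  fix \<epsilon> :: real assume \<epsilon>: "\<epsilon> > 0"
  have "v3 (z $ 1) (z $ 2) (z $ 3) \<noteq> 0" using z by simp
  then have z': "(z $ 1, z $ 2, z $ 3) \<noteq> (0, 0, 0)" unfolding v3_eq_0 by simp
  have "\<epsilon> / 3 > 0" using \<epsilon> by simp
  from pcone_dense[OF P B z' _ this] z(2) obtain x w y where
    d: "(x, w, y) \<in> pcone P B" "cmod (x - z $ 1) < \<epsilon> / 3" "cmod (w - z $ 2) < \<epsilon> / 3" "cmod (y - z $ 3) < \<epsilon> / 3"
    unfolding eval3_ev by blast
  have "norm (v3 x w y - z) \<le> (\<Sum>i\<in>UNIV. norm ((v3 x w y - z) $ i))" unfolding norm_vec_def by (rule L2_set_le_sum) simp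
  also have "\<dots> < \<epsilon>" using d by (simp add: sum_3)
  finally show "\<exists>y\<in>vcone P B. dist y z < \<epsilon>" using d(1) by (auto simp: vcone_pcone[symmetric] dist_norm)
qed

lemma curve_nonempty:
  assumes P: "homogeneous e P" "e > 0" "irreducible P"
  obtains z where "z \<noteq> 0" "eval3 P z = 0"
proof -
  have "P \<noteq> 0" using P by auto
  then obtain u v where uv: "ev P u v 1 \<noteq> 0" using homogeneous_nonzero_point[OF P(1)] by blast
  have "ev (shear u v P) 0 0 1 \<noteq> 0" using uv by simp
  from near_root[OF homogeneous_shear[OF P(1)] this P(2), of 1 0 0]
  obtain y where "ev (shear u v P) 1 0 y = 0" by blast
  then show ?thesis by (intro that[of "v3 (1 + u * y) (v * y) y"]) auto
qed

lemma vcone_nonempty: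
  assumes P: "homogeneous e P" "e > 0" "irreducible P" and B: "homogeneous b B" "\<not> P dvd B"
  shows "vcone P B \<noteq> {}"
  using curve_nonempty[OF P] vcone_closure[OF P B] by (metis closure_empty empty_iff)

lemma vcone_function_is_form:
  assumes P: "homogeneous e P" "e > 0" "irreducible P"
    and sm: "\<And>z. z \<noteq> 0 \<Longrightarrow> eval3 P z = 0 \<Longrightarrow> smooth_at P z"
    and B: "homogeneous b B" "\<not> P dvd B"
    and Q: "\<And>z. z \<noteq> 0 \<Longrightarrow> eval3 P z = 0 \<Longrightarrow> eval3 Q z \<noteq> 0"
    and A: "\<And>z. z \<in> vcone P B \<Longrightarrow> eval3 A z \<noteq> 0"
    and l: "l > 0" and cont: "continuous_on (vcone P B) h"
    and hom: "\<And>c z. c \<noteq> 0 \<Longrightarrow> z \<in> vcone P B \<Longrightarrow> h (c *s z) = c powi N * h z"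
    and root: "\<And>z. z \<in> vcone P B \<Longrightarrow> h z ^ l * eval3 Q z = eval3 A z"
  shows "\<exists>G. (N \<ge> 0 \<longrightarrow> homogeneous (nat N) G) \<and> (N < 0 \<longrightarrow> G = 0) \<and> (\<forall>z\<in>vcone P B. h z = eval3 G z)"
proof -
  interpret curve_function P B A Q e b l N "\<lambda>x w y. h (v3 x w y)"
  proof
    show "homogeneous e P" "e > 0" "irreducible P" "homogeneous b B" "\<not> P dvd B" "l > 0" by fact+
    show "smooth_form P"
      unfolding smooth_form_def
    proof (intro allI impI)
      fix x w y assume "(x, w, y) \<noteq> (0, 0, 0)" "ev P x w y = 0"
      then have "smooth_at P (v3 x w y)" by (intro sm) auto
      then show "ev (D1 P) x w y \<noteq> 0 \<or> ev (D2 P) x w y \<noteq> 0 \<or> ev (D3 P) x w y \<noteq> 0"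
        by (simp add: smooth_at_def)
    qed
    show "ev Q x w y \<noteq> 0" if "ev P x w y = 0" "(x, w, y) \<noteq> (0, 0, 0)" for x w y
      using Q[of "v3 x w y"] that by auto
    show "ev A x w y \<noteq> 0" if "(x, w, y) \<in> pcone P B" for x w y
      using A[of "v3 x w y"] that by (simp add: vcone_pcone)
    have "continuous_on (pcone P B) (\<lambda>z. h (v3 (fst z) (fst (snd z)) (snd (snd z))))"
    proof (rule continuous_on_compose2[OF cont])
      show "continuous_on (pcone P B) (\<lambda>z. v3 (fst z) (fst (snd z)) (snd (snd z)))"
        by (intro continuous_on_v3 continuous_intros)
      show "(\<lambda>z. v3 (fst z) (fst (snd z)) (snd (snd z))) ` pcone P B \<subseteq> vcone P B"
        by (auto simp: vcone_pcone)
    qed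
    then show "continuous_on (pcone P B) (\<lambda>(x, w, y). h (v3 x w y))" by (simp add: case_prod_beta)
    show "h (v3 (c * x) (c * w) (c * y)) = c powi N * h (v3 x w y)"
      if "c \<noteq> 0" "(x, w, y) \<in> pcone P B" for c x w y
      using hom[of c "v3 x w y"] that by (simp add: v3_scale vcone_pcone)
    show "h (v3 x w y) ^ l * ev Q x w y = ev A x w y" if "(x, w, y) \<in> pcone P B" for x w y
      using root[of "v3 x w y"] that by (simp add: vcone_pcone)
  qed
  obtain G where G: "N \<ge> 0 \<longrightarrow> homogeneous (nat N) G" "N < 0 \<longrightarrow> G = 0"
    "\<forall>x w y. (x, w, y) \<in> pcone P B \<longrightarrow> h (v3 x w y) = ev G x w y"
    using function_is_form_shear by blast
  have eq: "h z = eval3 G z" if "z \<in> vcone P B" for z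
    using G(3)[rule_format, of "z $ 1" "z $ 2" "z $ 3"] that vcone_pcone[of "z $ 1" "z $ 2" "z $ 3" P B]
    by (simp add: eval3_ev)
  show ?thesis by (intro exI[of _ G] conjI ballI eq) (rule G)+
qed

text \<open>
  If the curves did not meet, \<open>1 / Q\<close> would be a function of negative degree on the first one.
\<close>

lemma curves_meet:
  assumes P: "homogeneous e P" "e > 0" "irreducible P"
    and sm: "\<And>z. z \<noteq> 0 \<Longrightarrow> eval3 P z = 0 \<Longrightarrow> smooth_at P z"
    and Q: "homogeneous q Q" "q > 0"
  obtains z where "z \<noteq> 0" "eval3 P z = 0" "eval3 Q z = 0"
proof (rule ccontr)
  assume "\<not> thesis"
  then have nz: "\<And>z. z \<noteq> 0 \<Longrightarrow> eval3 P z = 0 \<Longrightarrow> eval3 Q z \<noteq> 0" using that by blast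
  have P1: "\<not> P dvd 1" using P(3) by (simp add: irreducible_def)
  have "\<exists>G. (- int q \<ge> 0 \<longrightarrow> homogeneous (nat (- int q)) G) \<and> (- int q < 0 \<longrightarrow> G = 0) \<and>
      (\<forall>z\<in>vcone P 1. 1 / eval3 Q z = eval3 G z)"
  proof (rule vcone_function_is_form[OF P sm homogeneous_1 P1 nz, where A=1 and l=1])
    show "continuous_on (vcone P 1) (\<lambda>z. 1 / eval3 Q z)"
      using nz by (intro continuous_intros) (auto simp: vcone_def)
    show "1 / eval3 Q (c *s z) = c powi (- int q) * (1 / eval3 Q z)" if "c \<noteq> 0" "z \<in> vcone P 1" for c z
      using that by (simp add: eval3_homogeneous[OF Q(1)] power_int_minus field_simps)
    show "(1 / eval3 Q z) ^ 1 * eval3 Q z = eval3 1 z" if "z \<in> vcone P 1" for z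
      using nz[of z] that by (simp add: vcone_def)
  qed auto
  then have "\<forall>z\<in>vcone P 1. 1 / eval3 Q z = 0" using Q(2) by auto
  moreover obtain z where "z \<in> vcone P 1" using vcone_nonempty[OF P homogeneous_1 P1] by blast
  ultimately show False using nz[of z] by (auto simp: vcone_def)
qed

lemma not_smooth_at_product:
  assumes "P * Q dvd H" "eval3 P z = 0" "eval3 Q z = 0"
  shows "\<not> smooth_at H z"
proof -
  from assms(1) obtain K where "H = P * Q * K" by (rule dvdE)
  then have H: "H = P * (Q * K)" by (simp only: mult.assoc)
  show ?thesis
    using partials_mult_at_zero[of P "z $ 1" "z $ 2" "z $ 3" "Q * K"] assms
    unfolding H smooth_at_def eval3_ev by simp
qed

section \<open>Connectedness of the complement of the branch curve\<close>

lemma clopen_absorbs: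
  assumes "openin (top_of_set S) T" "closedin (top_of_set S) T" "connected C" "C \<subseteq> S" "C \<inter> T \<noteq> {}"
  shows "C \<subseteq> T"
proof -
  have "connectedin (top_of_set S) C" using assms(3,4) by (simp add: connectedin_subtopology)
  from connectedin_clopen_cases[OF this assms(2,1)] show ?thesis using assms(5) by (auto simp: disjnt_def)
qed

lemma connected_punctured_complex: "connected (- {0 :: complex})"
  by (intro connected_punctured_universe) auto

lemma connected_orbit: "connected ((\<lambda>c. c *s z) ` (- {0 :: complex}))"
proof (rule connected_continuous_image[OF _ connected_punctured_complex])
  have "continuous_on (- {0}) (\<lambda>c. \<chi> i. c * z $ i)" by (intro continuous_intros)
  then show "continuous_on (- {0}) (\<lambda>c. c *s z)" by (simp add: vector_scalar_mult_def)
qed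

lemma vcone_connected:
  assumes P: "homogeneous e P" "e > 0" "irreducible P"
    and sm: "\<And>z. z \<noteq> 0 \<Longrightarrow> eval3 P z = 0 \<Longrightarrow> smooth_at P z"
    and B: "homogeneous b B" "\<not> P dvd B"
  shows "connected (vcone P B)"
  unfolding connected_clopen
proof (intro allI impI)
  fix T assume T: "openin (top_of_set (vcone P B)) T \<and> closedin (top_of_set (vcone P B)) T"
  let ?S = "vcone P B"
  have TS: "T \<subseteq> ?S" using T by (auto dest: openin_imp_subset)
  define \<kappa> :: "complex ^ 3 \<Rightarrow> complex" where "\<kappa> z = (if z \<in> T then 1 else - 1)" for z
  have "closedin (top_of_set ?S) (?S - T)" using T by (auto intro: closedin_diff)
  then have "continuous_on (T \<union> (?S - T)) (\<lambda>z. if z \<in> T then 1 else (- 1 :: complex))"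
    using T TS by (intro continuous_on_cases_local) (auto simp: Un_absorb1)
  moreover have "T \<union> (?S - T) = ?S" using TS by blast
  ultimately have cont: "continuous_on ?S \<kappa>" by (simp add: \<kappa>_def)
  \<comment> \<open>The sign function has degree 0 because the punctured line through
    \<open>z\<close> is connected: a clopen set contains all of it or misses it.\<close>
  have orb: "\<kappa> (c *s z) = \<kappa> z" if "c \<noteq> 0" "z \<in> ?S" for c z
  proof -
    define C where "C = (\<lambda>c. c *s z) ` (- {0})"
    have C: "connected C" unfolding C_def by (rule connected_orbit)
    have CS: "C \<subseteq> ?S"
      using that(2) by (auto simp: C_def vcone_def eval3_homogeneous[OF P(1)] eval3_homogeneous[OF B(1)])
    have mem: "c *s z \<in> C" "z \<in> C" using that(1) unfolding C_def by (auto intro: image_eqI[of _ _ 1])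
    have "C \<inter> T \<noteq> {} \<Longrightarrow> C \<subseteq> T" using clopen_absorbs[OF _ _ C CS] T by blast
    then show ?thesis using mem unfolding \<kappa>_def by auto
  qed
  have "\<exists>G. ((0::int) \<ge> 0 \<longrightarrow> homogeneous (nat 0) G) \<and> ((0::int) < 0 \<longrightarrow> G = 0) \<and> (\<forall>z\<in>?S. \<kappa> z = eval3 G z)"
    by (rule vcone_function_is_form[OF P sm B, where A=1 and Q=1 and l=2])
      (auto simp: cont orb, auto simp: \<kappa>_def)
  then obtain G where G: "homogeneous 0 G" "\<And>z. z \<in> ?S \<Longrightarrow> \<kappa> z = eval3 G z" by auto
  have "\<kappa> z = eval3 G 0" if "z \<in> ?S" for z
    using eval3_homogeneous[OF G(1), of 0 z] G(2)[OF that] by simp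
  then have "(\<forall>z\<in>?S. z \<in> T) \<or> (\<forall>z\<in>?S. z \<notin> T)" unfolding \<kappa>_def
    by (metis one_neq_neg_one)
  then show "T = {} \<or> T = ?S" using TS by blast
qed

text \<open>Components are determined only up to units; normalisation selects the representative
  among the prime factors.\<close>

lemma component_associated:
  assumes "component P H" "H \<noteq> 0"
  shows "normalize P \<in> prime_factors H"
  using assms irreducible_prime_elem3[of P] unfolding component_def
  by (intro in_prime_factors_iff[THEN iffD2]) (auto simp: prime_def)

lemma prime_factors_component: "P \<in> prime_factors H \<Longrightarrow> component P H" for H :: poly3
  unfolding component_def by (auto simp: in_prime_factors_iff prime_elem_imp_irreducible prime_def)

lemma eval3_prime_factors:
  assumes "H \<noteq> 0" "eval3 H z = 0"
  obtains P where "P \<in> prime_factors H" "eval3 P z = 0"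
proof -
  have "H dvd prod_mset (prime_factorization H)"
    using prod_mset_prime_factorization_weak[OF assms(1)] by (metis dvd_normalize_iff dvd_refl)
  then have "eval3 (prod_mset (prime_factorization H)) z = 0" using assms(2) by (rule eval3_dvd)
  moreover have "eval3 (prod_mset M) z = 0 \<Longrightarrow> \<exists>P\<in>#M. eval3 P z = 0" for M
    by (induction M) auto
  ultimately show ?thesis using that by blast
qed

lemma prime_factors_mult_dvd:
  assumes "P \<in> prime_factors H" "Q \<in> prime_factors H" "P \<noteq> Q"
  shows "P * Q dvd (H :: poly3)"
  using assms by (intro divides_mult primes_coprime) (auto simp: in_prime_factors_iff)

section \<open>The ring of functions of a cyclic cover\<close>

lemma eval4_coeffs: "eval4 G z s = (\<Sum>k\<le>degree G. eval3 (coeff G k) z * s ^ k)"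
proof -
  have "poly G [:[:[:s:]:]:] = (\<Sum>k\<le>degree G. coeff G k * const3 s ^ k)"
    by (simp add: poly_altdef const3_def)
  then show ?thesis unfolding eval4_def eval3_ev by simp
qed

lemma eval4_simps [simp]:
  "eval4 0 z s = 0" "eval4 1 z s = 1" "eval4 (G + H) z s = eval4 G z s + eval4 H z s"
  "eval4 (G - H) z s = eval4 G z s - eval4 H z s" "eval4 (G * H) z s = eval4 G z s * eval4 H z s"
  "eval4 [:c:] z s = eval3 c z" "eval4 (monom c k) z s = eval3 c z * s ^ k"
proof -
  have "[:[:[:s:]:]:] ^ k = const3 (s ^ k)" for k
    by (simp add: const3_def poly_const_pow)
  then have "eval3 ([:[:[:s:]:]:] ^ k) z = s ^ k" for k by (simp add: eval3_ev)
  then show "eval4 (monom c k) z s = eval3 c z * s ^ k" unfolding eval4_def poly_monom eval3_simps by simp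
qed (simp_all add: eval4_def eval3_ev)

lemma eval4_dvd: "G dvd H \<Longrightarrow> eval4 G z s = 0 \<Longrightarrow> eval4 H z s = 0"
  by (auto elim!: dvdE)

lemma eval4_prod [simp]: "eval4 (prod f I) z s = (\<Prod>i\<in>I. eval4 (f i) z s)"
  by (induction I rule: infinite_finite_induct) auto

lemma continuous_on_eval4 [continuous_intros]:
  assumes "continuous_on S f" "continuous_on S g"
  shows "continuous_on S (\<lambda>x. eval4 G (f x) (g x))"
  unfolding eval4_coeffs by (intro continuous_intros assms)

lemma weighted_homogeneous_0 [simp]: "weighted_homogeneous n d 0"
  by (simp add: weighted_homogeneous_def)

lemma weighted_homogeneous_const: "homogeneous d c \<Longrightarrow> weighted_homogeneous n d [:c:]"
  by (auto simp: weighted_homogeneous_def coeff_pCons split: nat.splits)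

lemma weighted_homogeneous_1 [simp]: "weighted_homogeneous n 0 1"
  using weighted_homogeneous_const[OF homogeneous_1, of n] by (simp add: pCons_one)

lemma weighted_homogeneous_monom:
  "homogeneous (d - k * n) c \<Longrightarrow> k * n \<le> d \<Longrightarrow> weighted_homogeneous n d (monom c k)"
  by (auto simp: weighted_homogeneous_def)

lemma weighted_homogeneous_add:
  "weighted_homogeneous n d G \<Longrightarrow> weighted_homogeneous n d H \<Longrightarrow> weighted_homogeneous n d (G + H)"
  unfolding weighted_homogeneous_def coeff_add
  by (metis add.right_neutral add_0 homogeneous_add)

lemma weighted_homogeneous_minus: "weighted_homogeneous n d G \<Longrightarrow> weighted_homogeneous n d (- G)"
  by (simp add: weighted_homogeneous_def homogeneous_minus)

lemma weighted_homogeneous_diff: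
  "weighted_homogeneous n d G \<Longrightarrow> weighted_homogeneous n d H \<Longrightarrow> weighted_homogeneous n d (G - H)"
  using weighted_homogeneous_add[OF _ weighted_homogeneous_minus, of n d G H] by simp

lemma weighted_homogeneous_sum:
  "(\<And>i. i \<in> I \<Longrightarrow> weighted_homogeneous n d (f i)) \<Longrightarrow> weighted_homogeneous n d (sum f I)"
  by (induction I rule: infinite_finite_induct) (auto intro: weighted_homogeneous_add)

lemma weighted_homogeneous_mult:
  assumes "weighted_homogeneous n d G" "weighted_homogeneous n k H"
  shows "weighted_homogeneous n (d + k) (G * H)"
proof -
  have c: "homogeneous (d + k - j * n) (coeff G i * coeff H (j - i)) \<and>
      (coeff G i * coeff H (j - i) \<noteq> 0 \<longrightarrow> j * n \<le> d + k)" if "i \<le> j" for i j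
  proof (cases "coeff G i * coeff H (j - i) = 0")
    case False
    then have nz: "coeff G i \<noteq> 0" "coeff H (j - i) \<noteq> 0" by auto
    then have l: "i * n \<le> d" "(j - i) * n \<le> k"
      and h: "homogeneous (d - i * n) (coeff G i)" "homogeneous (k - (j - i) * n) (coeff H (j - i))"
      using assms unfolding weighted_homogeneous_def by blast+
    have e: "j * n = i * n + (j - i) * n" using that by (simp add: add_mult_distrib[symmetric])
    have "(d - i * n) + (k - (j - i) * n) = d + k - j * n" using l e by linarith
    with homogeneous_mult[OF h] l e show ?thesis by simp
  qed auto
  show ?thesis
    unfolding weighted_homogeneous_def
  proof (intro allI impI conjI)
    fix j assume "coeff (G * H) j \<noteq> 0"
    then obtain i where "i \<le> j" "coeff G i * coeff H (j - i) \<noteq> 0"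
      unfolding coeff_mult by (metis (no_types, lifting) atMost_iff sum.neutral)
    then show "j * n \<le> d + k" using c by blast
  next
    fix j show "homogeneous (d + k - j * n) (coeff (G * H) j)"
      unfolding coeff_mult using c by (intro homogeneous_sum) auto
  qed
qed

lemma weighted_homogeneous_prod:
  "(\<And>i. i \<in> I \<Longrightarrow> weighted_homogeneous n (d i) (f i)) \<Longrightarrow> weighted_homogeneous n (sum d I) (prod f I)"
  by (induction I rule: infinite_finite_induct) (auto intro: weighted_homogeneous_mult)

lemma weighted_homogeneous_eval4:
  assumes "weighted_homogeneous n d G"
  shows "eval4 G (c *s z) (c ^ n * s) = c ^ d * eval4 G z s"
  unfolding eval4_coeffs sum_distrib_left
proof (intro sum.cong refl)
  fix k
  show "eval3 (coeff G k) (c *s z) * (c ^ n * s) ^ k = c ^ d * (eval3 (coeff G k) z * s ^ k)"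
  proof (cases "coeff G k = 0")
    case False
    then have h: "homogeneous (d - k * n) (coeff G k)" "k * n \<le> d"
      using assms by (auto simp: weighted_homogeneous_def)
    have "c ^ d = c ^ (d - k * n) * c ^ (n * k)"
      using h(2) by (simp add: power_add[symmetric] mult.commute)
    then show ?thesis
      by (simp add: eval3_homogeneous[OF h(1)] power_mult_distrib power_mult[symmetric] mult_ac)
  qed simp
qed

lemma nzd_mult: "nonzerodivisor_mod W G \<Longrightarrow> nonzerodivisor_mod W H \<Longrightarrow> nonzerodivisor_mod W (G * H)"
  unfolding nonzerodivisor_mod_def by (metis mult.assoc)

lemma nzd_1: "nonzerodivisor_mod W 1"
  unfolding nonzerodivisor_mod_def by simp

lemma nzd_prod: "(\<And>i. i \<in> I \<Longrightarrow> nonzerodivisor_mod W (f i)) \<Longrightarrow> nonzerodivisor_mod W (prod f I)"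
  by (induction I rule: infinite_finite_induct) (auto intro: nzd_mult nzd_1)

text \<open>Otherwise all \<open>m\<close> solutions of \<open>z ^ m = 1\<close> would solve
  \<open>z ^ (k mod m) = 1\<close>, which has fewer solutions.\<close>

lemma roots_of_unity_separate:
  assumes "m > 0" "\<not> m dvd k"
  obtains \<omega> :: complex where "\<omega> ^ m = 1" "\<omega> ^ k \<noteq> 1"
proof (rule ccontr)
  assume "\<not> thesis"
  then have a: "\<And>\<omega> :: complex. \<omega> ^ m = 1 \<Longrightarrow> \<omega> ^ k = 1" using that by blast
  define r where "r = k mod m"
  have r: "0 < r" "r < m" using assms by (auto simp: r_def mod_greater_zero_iff_not_dvd)
  have "{z :: complex. z ^ m = 1} \<subseteq> {z. z ^ r = 1}"
  proof safe
    fix z :: complex assume z: "z ^ m = 1"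
    have "z ^ k = (z ^ m) ^ (k div m) * z ^ r"
      unfolding r_def power_mult[symmetric] power_add[symmetric] by simp
    then show "z ^ r = 1" using a[OF z] z by simp
  qed
  then have "card {z :: complex. z ^ m = 1} \<le> card {z :: complex. z ^ r = 1}"
    using r by (intro card_mono finite_roots_unity) auto
  then show False using r by (simp add: card_roots_unity_eq)
qed

lemma sum_roots_of_unity:
  assumes "m > 0" "\<not> m dvd k"
  shows "(\<Sum>\<omega> | \<omega> ^ m = 1. \<omega> ^ k :: complex) = 0"
proof -
  obtain w :: complex where w: "w ^ m = 1" "w ^ k \<noteq> 1" using roots_of_unity_separate[OF assms] by blast
  have "w \<noteq> 0" using w assms(1) by (auto simp: zero_power)
  have "(\<Sum>\<omega> | \<omega> ^ m = 1. \<omega> ^ k) = (\<Sum>\<omega> | \<omega> ^ m = 1. (w * \<omega>) ^ k)"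
    by (rule sum.reindex_bij_witness[of _ "\<lambda>\<omega>. w * \<omega>" "\<lambda>\<omega>. \<omega> / w"])
      (use w \<open>w \<noteq> 0\<close> in \<open>auto simp: power_mult_distrib power_divide\<close>)
  also have "\<dots> = w ^ k * (\<Sum>\<omega> | \<omega> ^ m = 1. \<omega> ^ k)" by (simp add: power_mult_distrib sum_distrib_left)
  finally have "(1 - w ^ k) * (\<Sum>\<omega> | \<omega> ^ m = 1. \<omega> ^ k) = 0" by (simp add: algebra_simps)
  with w show ?thesis by simp
qed

text \<open>The deck transformation multiplying the tautological section by \<open>\<omega>\<close>,
  as it acts on functions. For \<open>\<omega> ^ m = 1\<close> it fixes the equation
  \<open>W\<close> of the cover.\<close>

definition rot :: "complex \<Rightarrow> poly4 \<Rightarrow> poly4" where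
  "rot \<omega> G = pcompose G [:0, const3 \<omega>:]"

lemma const3_power: "const3 c ^ k = const3 (c ^ k)"
  by (simp add: const3_def poly_const_pow)

lemma const3_mult: "const3 c * const3 d = const3 (c * d)"
  by (simp add: const3_def)

lemma const3_1 [simp]: "const3 1 = 1" and const3_0 [simp]: "const3 0 = 0"
  by (simp_all add: const3_def pCons_one)

lemma const3_sum: "(\<Sum>i\<in>I. const3 (f i)) = const3 (\<Sum>i\<in>I. f i)"
  by (rule ev_eqI) simp

lemma coeff_rot: "coeff (rot \<omega> G) k = const3 (\<omega> ^ k) * coeff G k"
  by (simp add: rot_def coeff_pcompose_linear const3_power)

lemma rot_mult: "rot \<omega> (G * H) = rot \<omega> G * rot \<omega> H" and rot_const: "rot \<omega> [:c:] = [:c:]"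
  and rot_add: "rot \<omega> (G + H) = rot \<omega> G + rot \<omega> H" and rot_1: "rot \<omega> 1 = 1"
  by (simp_all add: rot_def pcompose_mult pcompose_add pcompose_1)

lemma rot_prod: "rot \<omega> (prod f I) = (\<Prod>i\<in>I. rot \<omega> (f i))"
  by (induction I rule: infinite_finite_induct) (auto simp: rot_mult rot_1)

lemma rot_power: "rot \<omega> (G ^ k) = rot \<omega> G ^ k"
  by (induction k) (auto simp: rot_mult rot_1)

lemma rot_rot: "rot \<omega> (rot w G) = rot (\<omega> * w) G"
  by (rule poly_eqI) (simp add: coeff_rot power_mult_distrib const3_mult[symmetric] mult_ac)

lemma rot_one [simp]: "rot 1 G = G"
  by (rule poly_eqI) (simp add: coeff_rot)

lemma weighted_homogeneous_rot: "weighted_homogeneous n d G \<Longrightarrow> weighted_homogeneous n d (rot \<omega> G)"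
  unfolding weighted_homogeneous_def coeff_rot
  using homogeneous_mult[OF homogeneous_const] by (force simp: const3_def)

locale cyclic_algebra =
  fixes m :: nat and F :: poly3
  assumes m: "m > 0"
begin

definition "W = cyclic_equation m F"

lemma W_alt: "W = monom 1 m + [:- F:]"
  by (simp add: W_def cyclic_equation_def)

lemma coeff_W: "coeff W k = (if k = m then 1 else if k = 0 then - F else 0)"
  using m by (auto simp: W_alt coeff_pCons split: nat.splits)

lemma degree_W: "degree W = m"
  by (intro antisym degree_le le_degree) (auto simp: coeff_W m)

lemma W_dvd_small:
  assumes "W dvd G" "degree G < m" shows "G = 0"
proof (rule ccontr)
  assume "G \<noteq> 0"
  with assms(1) have "degree W \<le> degree G" by (rule dvd_imp_degree_le)
  with assms(2) degree_W show False by simp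
qed

text \<open>Normal form modulo the monic \<open>W\<close>, in which each \<open>t ^ m\<close>
  becomes \<open>F\<close>. The quotient ring is free over \<open>poly3\<close> with basis
  \<open>1, ..., t ^ (m - 1)\<close>.\<close>

definition red :: "poly4 \<Rightarrow> poly4" where
  "red G = (\<Sum>k\<le>degree G. monom (coeff G k * F ^ (k div m)) (k mod m))"

lemma W_dvd_red: "W dvd G - red G"
proof -
  have 1: "W dvd monom c k - monom (c * F ^ (k div m)) (k mod m)" for c k
  proof -
    have "monom c k = monom c (k mod m) * monom 1 m ^ (k div m)"
      by (simp add: monom_power mult_monom)
    moreover have "monom (c * F ^ (k div m)) (k mod m) = monom c (k mod m) * [:F:] ^ (k div m)"
      by (simp add: poly_const_pow smult_monom mult.commute)
    ultimately have "monom c k - monom (c * F ^ (k div m)) (k mod m)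
        = monom c (k mod m) * (monom 1 m ^ (k div m) - [:F:] ^ (k div m))"
      by (simp only: right_diff_distrib)
    also have "\<dots> = monom c (k mod m) * ((monom 1 m - [:F:]) * (\<Sum>i<k div m. [:F:] ^ (k div m - Suc i) * monom 1 m ^ i))"
      by (simp only: power_diff_sumr2)
    finally show ?thesis unfolding W_def cyclic_equation_def by (simp only:) (intro dvd_mult dvd_triv_left)
  qed
  have "G = (\<Sum>k\<le>degree G. monom (coeff G k) k)" by (rule poly_as_sum_of_monoms[symmetric])
  then have "G - red G = (\<Sum>k\<le>degree G. monom (coeff G k) k - monom (coeff G k * F ^ (k div m)) (k mod m))"
    unfolding red_def sum_subtractf by simp
  then show ?thesis using 1 by (simp add: dvd_sum)
qed

lemma degree_red: "degree (red G) < m"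
  unfolding red_def using m by (intro degree_sum_less) (auto intro: le_less_trans[OF degree_monom_le])

lemma weighted_homogeneous_red:
  assumes "weighted_homogeneous n d G" "homogeneous (m * n) F"
  shows "weighted_homogeneous n d (red G)"
  unfolding red_def
proof (intro weighted_homogeneous_sum)
  fix k
  show "weighted_homogeneous n d (monom (coeff G k * F ^ (k div m)) (k mod m))"
  proof (cases "coeff G k = 0")
    case False
    then have h: "k * n \<le> d" "homogeneous (d - k * n) (coeff G k)"
      using assms(1) by (auto simp: weighted_homogeneous_def)
    have "k * n = k mod m * n + m * n * (k div m)"
      by (metis add.commute add_mult_distrib mult.assoc mult.commute mult_div_mod_eq)
    then have "k mod m * n \<le> d" "(d - k * n) + m * n * (k div m) = d - k mod m * n" using h(1) by linarith+
    moreover have "homogeneous ((d - k * n) + m * n * (k div m)) (coeff G k * F ^ (k div m))"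
      by (intro homogeneous_mult h(2) homogeneous_power assms(2))
    ultimately show ?thesis by (intro weighted_homogeneous_monom) auto
  qed simp
qed

lemma dvd_trans_diff: "W dvd x - y \<Longrightarrow> W dvd x \<longleftrightarrow> W dvd y"
  by (metis diff_add_cancel dvd_add dvd_diff add_diff_cancel_left')

text \<open>In a free module over an integral domain a nonzero scalar is not a zero divisor;
  freeness enters as uniqueness of the normal form, by \<open>W_dvd_small\<close>.\<close>

lemma nzd_const:
  assumes "r \<noteq> 0" shows "nonzerodivisor_mod W [:r:]"
  unfolding nonzerodivisor_mod_def
proof (intro allI impI)
  fix K assume a: "W dvd [:r:] * K"
  have "W dvd [:r:] * K - [:r:] * red K"
    using W_dvd_red[of K] by (simp only: right_diff_distrib[symmetric] dvd_mult)
  with a have "W dvd [:r:] * red K" using dvd_trans_diff by blast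
  moreover have "degree ([:r:] * red K) < m" using degree_red[of K] by simp
  ultimately have "[:r:] * red K = 0" by (rule W_dvd_small)
  then have "red K = 0" using assms by simp
  then show "W dvd K" using W_dvd_red[of K] by simp
qed

lemma nzd_nonzero: "nonzerodivisor_mod W H \<Longrightarrow> H \<noteq> 0"
  unfolding nonzerodivisor_mod_def
  using W_dvd_small[of 1] m by (metis degree_1 dvd_0_right mult_zero_left one_neq_zero)

lemma rot_W: "\<omega> ^ m = 1 \<Longrightarrow> rot \<omega> W = W"
  by (rule poly_eqI) (auto simp: coeff_rot coeff_W)

lemma rot_dvd: "\<omega> ^ m = 1 \<Longrightarrow> W dvd G \<Longrightarrow> W dvd rot \<omega> G"
  by (metis dvdE dvdI rot_W rot_mult)

lemma nzd_rot:
  assumes w: "\<omega> ^ m = 1" and H: "nonzerodivisor_mod W H"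
  shows "nonzerodivisor_mod W (rot \<omega> H)"
  unfolding nonzerodivisor_mod_def
proof (intro allI impI)
  fix K assume "W dvd rot \<omega> H * K"
  have nz: "\<omega> \<noteq> 0" using w m by (auto simp: zero_power)
  then have w': "inverse \<omega> ^ m = 1" using w by (simp add: power_inverse)
  have "W dvd rot (inverse \<omega>) (rot \<omega> H * K)" by (rule rot_dvd) fact+
  then have "W dvd H * rot (inverse \<omega>) K" using nz by (simp add: rot_mult rot_rot)
  then have "W dvd rot (inverse \<omega>) K" using H unfolding nonzerodivisor_mod_def by blast
  then have "W dvd rot \<omega> (rot (inverse \<omega>) K)" by (rule rot_dvd[OF w])
  then show "W dvd K" using nz by (simp add: rot_rot)
qed

text \<open>The norm down to the plane. It is invariant under all deck transformations, so only
  powers of \<open>t ^ m\<close> occur and its normal form is constant in \<open>t\<close>.\<close>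

definition Nm :: "poly4 \<Rightarrow> poly4" where
  "Nm H = (\<Prod>\<omega> | \<omega> ^ m = 1. rot \<omega> H)"

lemma finite_units: "finite {\<omega> :: complex. \<omega> ^ m = 1}"
  using m by (intro finite_roots_unity) auto

lemma rot_Nm:
  assumes w: "w ^ m = 1" shows "rot w (Nm H) = Nm H"
proof -
  have nz: "w \<noteq> 0" using w m by (auto simp: zero_power)
  show ?thesis unfolding Nm_def rot_prod rot_rot
    by (rule prod.reindex_bij_witness[of _ "\<lambda>\<omega>. \<omega> / w" "\<lambda>\<omega>. w * \<omega>"])
      (use w nz in \<open>auto simp: power_mult_distrib power_divide\<close>)
qed

lemma coeff_Nm:
  assumes "\<not> m dvd k" shows "coeff (Nm H) k = 0"
proof -
  obtain w :: complex where w: "w ^ m = 1" "w ^ k \<noteq> 1" using roots_of_unity_separate[OF m assms] by blast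
  have "const3 (w ^ k) * coeff (Nm H) k = coeff (Nm H) k"
    using rot_Nm[OF w(1), of H] by (metis coeff_rot)
  then have "(const3 (w ^ k) - 1) * coeff (Nm H) k = 0" by (simp add: algebra_simps)
  moreover have "const3 (w ^ k) - 1 \<noteq> 0"
  proof
    assume "const3 (w ^ k) - 1 = 0"
    from arg_cong[OF this, of "\<lambda>f. ev f 0 0 0"] w(2) show False by simp
  qed
  ultimately show ?thesis by simp
qed

lemma red_Nm: "degree (red (Nm H)) = 0"
proof -
  have "coeff (red (Nm H)) j = 0" if "j > 0" for j
    unfolding red_def coeff_sum
  proof (intro sum.neutral ballI)
    fix k
    show "coeff (monom (coeff (Nm H) k * F ^ (k div m)) (k mod m)) j = 0"
      using coeff_Nm[of k H] that by (cases "m dvd k") (auto simp: coeff_monom)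
  qed
  then have "degree (red (Nm H)) \<le> 0" by (intro degree_le) auto
  then show ?thesis by simp
qed

text \<open>Rationalising a denominator: multiplied by its other conjugates, \<open>H\<close>
  becomes its norm, a form \<open>r\<close> on the plane. Conjugates of nonzerodivisors are
  nonzerodivisors, so \<open>r\<close> is nonzero.\<close>

lemma norm_multiple:
  assumes H: "nonzerodivisor_mod W H" "weighted_homogeneous n d H" and F: "homogeneous (m * n) F"
  obtains H' r d' where "W dvd H * H' - [:r:]" "r \<noteq> 0" "weighted_homogeneous n d' H'" "homogeneous (d + d') r"
proof -
  define U where "U = {\<omega> :: complex. \<omega> ^ m = 1} - {1}"
  define H' where "H' = (\<Prod>\<omega>\<in>U. rot \<omega> H)"
  have N: "Nm H = H * H'"
    unfolding Nm_def H'_def U_def by (subst prod.remove[of _ 1]) (auto simp: finite_units)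
  obtain r where r: "red (Nm H) = [:r:]" using red_Nm degree_eq_zeroE by blast
  have H': "weighted_homogeneous n (\<Sum>\<omega>\<in>U. d) H'"
    unfolding H'_def by (intro weighted_homogeneous_prod weighted_homogeneous_rot H)
  have dv: "W dvd H * H' - [:r:]" using W_dvd_red[of "Nm H"] unfolding r by (simp only: N)
  have nz: "nonzerodivisor_mod W (Nm H)"
    unfolding Nm_def by (intro nzd_prod nzd_rot H) auto
  have "r \<noteq> 0"
  proof
    assume "r = 0"
    then have "W dvd Nm H * 1" using dv N by simp
    then have "W dvd 1" using nz unfolding nonzerodivisor_mod_def by blast
    then show False using W_dvd_small[of 1] m by simp
  qed
  moreover have "weighted_homogeneous n (d + (\<Sum>\<omega>\<in>U. d)) [:r:]"
    unfolding r[symmetric] N by (intro weighted_homogeneous_red weighted_homogeneous_mult H H' F)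
  then have "homogeneous (d + (\<Sum>\<omega>\<in>U. d)) r" unfolding weighted_homogeneous_def by (force dest: spec[of _ 0])
  ultimately show ?thesis using that[OF dv _ H'] by blast
qed

section \<open>Reduction of the cover modulo a prime of the base ring\<close>

definition Idl :: "poly3 \<Rightarrow> poly4 set" where
  "Idl \<pi> = {[:\<pi>:] * x + W * y | x y. True}"

lemma Idl_intros:
  "x \<in> Idl \<pi> \<Longrightarrow> y \<in> Idl \<pi> \<Longrightarrow> x + y \<in> Idl \<pi>" "x \<in> Idl \<pi> \<Longrightarrow> c * x \<in> Idl \<pi>"
  "[:\<pi>:] * x \<in> Idl \<pi>" "W * x \<in> Idl \<pi>" "0 \<in> Idl \<pi>"
proof -
  show "x + y \<in> Idl \<pi>" if xy: "x \<in> Idl \<pi>" "y \<in> Idl \<pi>"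
  proof -
    obtain a b a' b' where e: "x = [:\<pi>:] * a + W * b" "y = [:\<pi>:] * a' + W * b'"
      using xy unfolding Idl_def by blast
    have "x + y = [:\<pi>:] * (a + a') + W * (b + b')" unfolding e by (simp only: distrib_left add_ac)
    then show ?thesis unfolding Idl_def by blast
  qed
  show "c * x \<in> Idl \<pi>" if xy: "x \<in> Idl \<pi>"
  proof -
    obtain a b where e: "x = [:\<pi>:] * a + W * b" using xy unfolding Idl_def by blast
    have "c * x = [:\<pi>:] * (c * a) + W * (c * b)" unfolding e by (simp only: distrib_left mult_ac)
    then show ?thesis unfolding Idl_def by blast
  qed
  have "[:\<pi>:] * x = [:\<pi>:] * x + W * 0" "W * x = [:\<pi>:] * 0 + W * x" "0 = [:\<pi>:] * 0 + W * 0" by simp_all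
  then show "[:\<pi>:] * x \<in> Idl \<pi>" "W * x \<in> Idl \<pi>" "0 \<in> Idl \<pi>" unfolding Idl_def by blast+
qed

lemma Idl_sum: "(\<And>i. i \<in> I \<Longrightarrow> f i \<in> Idl \<pi>) \<Longrightarrow> sum f I \<in> Idl \<pi>"
  by (induction I rule: infinite_finite_induct) (auto intro: Idl_intros)

lemma Idl_rot:
  assumes "\<omega> ^ m = 1" "x \<in> Idl \<pi>" shows "rot \<omega> x \<in> Idl \<pi>"
proof -
  obtain a b where x: "x = [:\<pi>:] * a + W * b" using assms(2) unfolding Idl_def by blast
  have "rot \<omega> x = [:\<pi>:] * rot \<omega> a + W * rot \<omega> b"
    unfolding x by (simp only: rot_add rot_mult rot_const rot_W[OF assms(1)])
  then show ?thesis unfolding Idl_def by blast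
qed

text \<open>With the cofactor of \<open>\<pi>\<close> in normal form, the difference is a multiple
  of \<open>W\<close> of degree below \<open>m\<close>, hence zero.\<close>

lemma Idl_small:
  assumes "x \<in> Idl \<pi>" "degree x < m" shows "[:\<pi>:] dvd x"
proof -
  obtain a b where x: "x = [:\<pi>:] * a + W * b" using assms(1) unfolding Idl_def by blast
  obtain q where q: "a - red a = W * q" using W_dvd_red[of a] by (rule dvdE)
  have "x - [:\<pi>:] * red a = [:\<pi>:] * (a - red a) + W * b" unfolding x by (simp only: algebra_simps)
  also have "\<dots> = W * ([:\<pi>:] * q + b)" unfolding q by (simp only: algebra_simps)
  finally have "W dvd x - [:\<pi>:] * red a" by simp
  moreover have "degree (x - [:\<pi>:] * red a) < m"
    using assms(2) degree_red[of a] by (intro degree_diff_less) (auto intro: le_less_trans[OF degree_smult_le])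
  ultimately have "x = [:\<pi>:] * red a" using W_dvd_small by fastforce
  then show ?thesis by (rule dvdI)
qed

definition Rad :: "poly3 \<Rightarrow> poly4 set" where
  "Rad \<pi> = {x. \<exists>k. x ^ k \<in> Idl \<pi>}"

lemma Rad_add:
  assumes "x \<in> Rad \<pi>" "y \<in> Rad \<pi>" shows "x + y \<in> Rad \<pi>"
proof -
  obtain a b where ab: "x ^ a \<in> Idl \<pi>" "y ^ b \<in> Idl \<pi>" using assms unfolding Rad_def by blast
  have "(x + y) ^ (a + b) \<in> Idl \<pi>"
    unfolding binomial_ring
  proof (intro Idl_sum)
    fix i
    show "of_nat (a + b choose i) * x ^ i * y ^ (a + b - i) \<in> Idl \<pi>"
    proof (cases "i \<ge> a")
      case True
      then have "x ^ i = x ^ (i - a) * x ^ a" by (simp add: power_add[symmetric])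
      then have eq: "of_nat (a + b choose i) * x ^ i * y ^ (a + b - i)
        = (of_nat (a + b choose i) * x ^ (i - a) * y ^ (a + b - i)) * x ^ a" by (simp only: mult_ac)
      show ?thesis unfolding eq by (rule Idl_intros(2)[OF ab(1)])
    next
      case False
      then have "y ^ (a + b - i) = y ^ (a - i) * y ^ b" by (simp add: power_add[symmetric])
      then have eq: "of_nat (a + b choose i) * x ^ i * y ^ (a + b - i)
        = (of_nat (a + b choose i) * x ^ i * y ^ (a - i)) * y ^ b" by (simp only: mult_ac)
      show ?thesis unfolding eq by (rule Idl_intros(2)[OF ab(2)])
    qed
  qed
  then show ?thesis unfolding Rad_def by blast
qed

lemma Rad_mult: "x \<in> Rad \<pi> \<Longrightarrow> c * x \<in> Rad \<pi>"
  unfolding Rad_def mem_Collect_eq power_mult_distrib by (blast intro: Idl_intros(2))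

lemma Rad_0: "0 \<in> Rad \<pi>"
  unfolding Rad_def using Idl_intros(5)[of \<pi>] by (auto intro: exI[of _ 1])

lemma Rad_sum: "(\<And>i. i \<in> I \<Longrightarrow> f i \<in> Rad \<pi>) \<Longrightarrow> sum f I \<in> Rad \<pi>"
  by (induction I rule: infinite_finite_induct) (auto intro: Rad_add Rad_0)

lemma Rad_rot: "\<omega> ^ m = 1 \<Longrightarrow> x \<in> Rad \<pi> \<Longrightarrow> rot \<omega> x \<in> Rad \<pi>"
  unfolding Rad_def using Idl_rot by (auto simp: rot_power[symmetric])

text \<open>
  Modulo a prime not dividing \<open>F\<close> the cover is reduced: averaging over the deck transformations
  splits a nilpotent element into nilpotent monomials.
\<close>

lemma Rad_small:
  assumes \<pi>: "prime_elem \<pi>" "\<not> \<pi> dvd F" and g: "g \<in> Rad \<pi>" "degree g < m"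
  shows "[:\<pi>:] dvd g"
  unfolding const_poly_dvd_iff
proof
  fix j
  show "\<pi> dvd coeff g j"
  proof (cases "j < m")
    case False
    then show ?thesis using g(2) by (simp add: coeff_eq_0)
  next
    case j: True
    \<comment> \<open>Projection onto the \<open>t ^ j\<close> part: the exponent
      \<open>m - j\<close> stands for \<open>- j\<close>, as \<open>\<omega> ^ m = 1\<close>, and
      the sum over \<open>\<omega>\<close> annihilates all other powers below
      \<open>m\<close>.\<close>
    define y where "y = [:const3 (1 / of_nat m):] * (\<Sum>\<omega> | \<omega> ^ m = 1. [:const3 (\<omega> ^ (m - j)):] * rot \<omega> g)"
    have "y \<in> Rad \<pi>"
      unfolding y_def using g by (intro Rad_mult Rad_sum Rad_rot) auto
    moreover have "y = monom (coeff g j) j"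
    proof (rule poly_eqI)
      fix i
      have c1: "coeff ([:const3 (\<omega> ^ (m - j)):] * rot \<omega> g) i = const3 (\<omega> ^ (m - j + i)) * coeff g i" for \<omega>
        by (simp add: coeff_rot power_add const3_mult[symmetric] mult.assoc)
      have "coeff y i = const3 (1 / of_nat m) * (\<Sum>\<omega> | \<omega> ^ m = 1. const3 (\<omega> ^ (m - j + i)) * coeff g i)"
        unfolding y_def c1[symmetric] coeff_sum[symmetric] by simp
      also have "\<dots> = const3 ((1 / of_nat m) * (\<Sum>\<omega> | \<omega> ^ m = 1. \<omega> ^ (m - j + i))) * coeff g i"
        by (simp only: sum_distrib_right[symmetric] const3_sum const3_mult mult.assoc[symmetric])
      also have "\<dots> = coeff (monom (coeff g j) j) i"
      proof (cases "i < m")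
        case False
        then show ?thesis using g(2) j by (simp add: coeff_eq_0)
      next
        case i: True
        show ?thesis
        proof (cases "i = j")
          case True
          then have "(\<Sum>\<omega> :: complex | \<omega> ^ m = 1. \<omega> ^ (m - j + i)) = (\<Sum>\<omega> :: complex | \<omega> ^ m = 1. 1)"
            using j by (intro sum.cong) auto
          also have "\<dots> = of_nat m" using m by (simp add: card_roots_unity_eq)
          finally show ?thesis using True m by simp
        next
          case False
          have "\<not> m dvd m - j + i"
          proof
            assume "m dvd m - j + i"
            then obtain q where q: "m - j + i = m * q" by (rule dvdE)
            moreover have "0 < m - j + i" "m - j + i < m * 2" using i j by auto
            ultimately have "0 < q" "q < 2" by auto
            then have "q = 1" by simp
            with q False j show False by simp
          qed
          then show ?thesis using False sum_roots_of_unity[OF m] by simp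
        qed
      qed
      finally show "coeff y i = coeff (monom (coeff g j) j) i" .
    qed
    ultimately obtain k where "monom (coeff g j) j ^ k \<in> Idl \<pi>" unfolding Rad_def by auto
    \<comment> \<open>A further power \<open>m\<close> makes the exponent of \<open>t\<close> a
      multiple of \<open>m\<close>. The normal form is then constant in \<open>t\<close>, a product
      of powers of \<open>coeff g j\<close> and \<open>F\<close>, to which primality of
      \<open>\<pi>\<close> applies.\<close>
    then have "(monom (coeff g j) j ^ k) * (monom (coeff g j) j ^ k) ^ (m - 1) \<in> Idl \<pi>"
      by (subst mult.commute) (rule Idl_intros)
    also have "(monom (coeff g j) j ^ k) * (monom (coeff g j) j ^ k) ^ (m - 1) = (monom (coeff g j) j ^ k) ^ m"
      using m by (simp add: power_eq_if)
    also have "\<dots> = monom (coeff g j ^ (k * m)) (j * k * m)"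
      by (simp add: monom_power power_mult[symmetric] mult_ac)
    finally have I: "monom (coeff g j ^ (k * m)) (j * k * m) \<in> Idl \<pi>" .
    define M where "M = monom (coeff g j ^ (k * m)) (j * k * m)"
    obtain q where q: "M - red M = W * q" using W_dvd_red by (rule dvdE)
    have "red M = M + W * (- q)" using q by (simp add: algebra_simps)
    moreover have "M + W * (- q) \<in> Idl \<pi>" using I unfolding M_def[symmetric] by (intro Idl_intros)
    ultimately have "red M \<in> Idl \<pi>" by simp
    then have d: "[:\<pi>:] dvd red M" using degree_red by (rule Idl_small)
    have "red M = [:coeff g j ^ (k * m) * F ^ (j * k):]"
    proof (cases "coeff g j ^ (k * m) = 0")
      case True
      have "M = 0" unfolding M_def True by simp
      then show ?thesis unfolding True by (simp add: red_def)
    next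
      case False
      then have "degree M = j * k * m" by (simp add: M_def degree_monom_eq)
      then have "red M = (\<Sum>i\<le>j * k * m. if i = j * k * m then [:coeff g j ^ (k * m) * F ^ (j * k):] else 0)"
        unfolding red_def using m
        by (intro sum.cong) (auto simp: M_def coeff_monom monom_0)
      then show ?thesis by simp
    qed
    then have "\<pi> dvd coeff g j ^ (k * m) * F ^ (j * k)" using d by (simp add: const_poly_dvd_const_poly_iff)
    then show ?thesis
      using \<pi> by (auto simp: prime_elem_dvd_mult_iff dest: prime_elem_dvd_power)
  qed
qed

text \<open>Integrality of \<open>g / r\<close>, read modulo a prime \<open>\<pi>\<close> of
  \<open>r\<close>, makes \<open>g\<close> nilpotent modulo \<open>\<pi>\<close> and
  \<open>W\<close>. If \<open>\<pi>\<close> does not divide \<open>F\<close>, it divides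
  \<open>g\<close> by \<open>Rad_small\<close> and cancels. Induction on the number of prime factors
  of \<open>r\<close> leaves a denominator with primes of \<open>F\<close> only.\<close>

lemma denominator_descent:
  assumes "r \<noteq> 0" "degree g < m" "W dvd g ^ k + (\<Sum>i<k. e i * g ^ i * [:r:] ^ (k - i))"
  shows "\<exists>u g' r'. g = [:u:] * g' \<and> r = u * r' \<and> (\<forall>\<pi>. prime_elem \<pi> \<longrightarrow> \<pi> dvd r' \<longrightarrow> \<pi> dvd F)"
  using assms
proof (induction "size (prime_factorization r)" arbitrary: r g rule: less_induct)
  case less
  show ?case
  proof (cases "\<forall>\<pi>. prime_elem \<pi> \<longrightarrow> \<pi> dvd r \<longrightarrow> \<pi> dvd F")
    case True
    then show ?thesis by (intro exI[of _ 1] exI[of _ g] exI[of _ r]) (simp add: pCons_one)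
  next
    case False
    then obtain \<pi> where \<pi>: "prime_elem \<pi>" "\<pi> dvd r" "\<not> \<pi> dvd F" by blast
    then obtain r1 where r1: "r = \<pi> * r1" by (auto elim: dvdE)
    have r1nz: "r1 \<noteq> 0" and \<pi>nz: "\<pi> \<noteq> 0" using less.prems(1) r1 by auto
    obtain y where y: "g ^ k + (\<Sum>i<k. e i * g ^ i * [:r:] ^ (k - i)) = W * y" using less.prems(3) by (rule dvdE)
    have "(\<Sum>i<k. e i * g ^ i * [:r:] ^ (k - i)) \<in> Idl \<pi>"
    proof (intro Idl_sum)
      fix i assume "i \<in> {..<k}"
      then have "[:r:] ^ (k - i) = [:r:] * [:r:] ^ (k - i - 1)"
        by (intro power_eq_if[THEN trans]) auto
      moreover have "[:r:] = [:\<pi>:] * [:r1:]" by (simp add: r1 mult.commute)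
      ultimately have "[:r:] ^ (k - i) = [:\<pi>:] * ([:r1:] * [:r:] ^ (k - i - 1))"
        by (simp only: mult.assoc)
      then have eq: "e i * g ^ i * [:r:] ^ (k - i) = [:\<pi>:] * (e i * g ^ i * ([:r1:] * [:r:] ^ (k - i - 1)))"
        by (simp only: mult_ac)
      show "e i * g ^ i * [:r:] ^ (k - i) \<in> Idl \<pi>" unfolding eq by (rule Idl_intros(3))
    qed
    then have "W * y + (- 1) * (\<Sum>i<k. e i * g ^ i * [:r:] ^ (k - i)) \<in> Idl \<pi>"
      by (intro Idl_intros)
    also have "W * y + (- 1) * (\<Sum>i<k. e i * g ^ i * [:r:] ^ (k - i)) = g ^ k" using y by (simp add: algebra_simps)
    finally have "g \<in> Rad \<pi>" unfolding Rad_def by blast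
    then have "[:\<pi>:] dvd g" using less.prems(2) \<pi> by (intro Rad_small) auto
    then obtain g1 where g1: "g = [:\<pi>:] * g1" by (rule dvdE)
    have eq: "g ^ k + (\<Sum>i<k. e i * g ^ i * [:r:] ^ (k - i))
       = [:\<pi> ^ k:] * (g1 ^ k + (\<Sum>i<k. e i * g1 ^ i * [:r1:] ^ (k - i)))"
    proof -
      have "e i * g ^ i * [:r:] ^ (k - i) = [:\<pi>:] ^ k * (e i * g1 ^ i * [:r1:] ^ (k - i))" if "i < k" for i
      proof -
        have "[:r:] = [:\<pi>:] * [:r1:]" by (simp add: r1 mult.commute)
        moreover have "[:\<pi>:] ^ k = [:\<pi>:] ^ i * [:\<pi>:] ^ (k - i)" using that by (simp add: power_add[symmetric])
        ultimately show ?thesis unfolding g1 by (simp only: power_mult_distrib mult_ac)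
      qed
      then have "(\<Sum>i<k. e i * g ^ i * [:r:] ^ (k - i)) = [:\<pi>:] ^ k * (\<Sum>i<k. e i * g1 ^ i * [:r1:] ^ (k - i))"
        unfolding sum_distrib_left by (intro sum.cong) auto
      then show ?thesis unfolding g1 power_mult_distrib poly_const_pow[symmetric] distrib_left by simp
    qed
    \<comment> \<open>The factor \<open>\<pi> ^ k\<close> common to all terms is a nonzero scalar
      and cancels modulo \<open>W\<close>.\<close>
    have "nonzerodivisor_mod W [:\<pi> ^ k:]" by (rule nzd_const) (use \<pi>nz in simp)
    from this[unfolded nonzerodivisor_mod_def, rule_format, OF less.prems(3)[unfolded eq]]
    have W1: "W dvd g1 ^ k + (\<Sum>i<k. e i * g1 ^ i * [:r1:] ^ (k - i))" .
    have deg: "degree g1 < m" using less.prems(2) \<pi>nz unfolding g1 by simp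
    have "prime_factorization r = prime_factorization \<pi> + prime_factorization r1"
      unfolding r1 using \<pi>nz r1nz by (rule prime_factorization_mult)
    moreover have "prime_factorization \<pi> \<noteq> {#}"
      using \<pi>(1) by (auto simp: prime_factorization_empty_iff prime_elem_def)
    ultimately have "size (prime_factorization r1) < size (prime_factorization r)"
      by (simp add: size_union nonempty_has_size)
    from less.hyps[OF this r1nz deg W1]
    obtain u g' r' where u: "g1 = [:u:] * g'" "r1 = u * r'" "\<forall>\<pi>. prime_elem \<pi> \<longrightarrow> \<pi> dvd r' \<longrightarrow> \<pi> dvd F"
      by blast
    have "g = [:\<pi> * u:] * g'" "r = (\<pi> * u) * r'"
      unfolding g1 r1 u by (simp_all add: mult_ac)
    with u(3) show ?thesis by blast
  qed
qed

end

section \<open>The normalization over the unramified part\<close>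

lemma bundle_point_mem: "(z', s') \<in> bundle_point n (z, s) \<longleftrightarrow> (\<exists>c. c \<noteq> 0 \<and> z' = c *s z \<and> s' = c ^ n * s)"
  by (auto simp: bundle_point_def)

lemma bundle_point_self: "(z, s) \<in> bundle_point n (z, s)"
  unfolding bundle_point_mem by (rule exI[of _ 1]) simp

text \<open>By weighted homogeneity, nonvanishing of the denominator at one representative gives it
  at all of them.\<close>

lemma local_fraction_point:
  "local_fraction n W (bundle_point n (z, s)) G H \<longleftrightarrow>
     (\<exists>d. weighted_homogeneous n d G \<and> weighted_homogeneous n d H) \<and> nonzerodivisor_mod W H \<and> eval4 H z s \<noteq> 0"
  (is "?L \<longleftrightarrow> ?R")
proof
  assume ?L then show ?R unfolding local_fraction_def using bundle_point_self by blast
next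
  assume R: ?R
  then obtain d where "weighted_homogeneous n d H" by blast
  then show ?L unfolding local_fraction_def using R
    by (auto simp: bundle_point_mem weighted_homogeneous_eval4)
qed

lemma to_fract_power: "to_fract (x ^ k) = to_fract x ^ k"
  by (induction k) auto

lemma local_fraction_value:
  assumes "local_fraction n W (bundle_point n (z, s)) G H" "(z', s') \<in> bundle_point n (z, s)"
  shows "eval4 G z' s' / eval4 H z' s' = eval4 G z s / eval4 H z s"
  using assms unfolding local_fraction_point bundle_point_mem by (auto simp: weighted_homogeneous_eval4)

context cyclic_algebra
begin

lemma dvd_diff_mult:
  assumes "W dvd x - y" "W dvd u - v" shows "W dvd x * u - y * v"
proof -
  have "x * u - y * v = (x - y) * u + y * (u - v)" by (simp add: algebra_simps)
  then show ?thesis using assms by simp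
qed

lemma dvd_diff_power: "W dvd x - y \<Longrightarrow> W dvd x ^ k - y ^ k"
  unfolding power_diff_sumr2 by (rule dvd_mult2)

lemma rational_functionsI:
  "weighted_homogeneous n d G \<Longrightarrow> weighted_homogeneous n d H \<Longrightarrow> nonzerodivisor_mod W H \<Longrightarrow>
     Fract G H \<in> rational_functions n W"
  unfolding rational_functions_def by blast

lemma vanishingI:
  "weighted_homogeneous n d G \<Longrightarrow> weighted_homogeneous n d H \<Longrightarrow> nonzerodivisor_mod W H \<Longrightarrow> W dvd G \<Longrightarrow>
     Fract G H \<in> vanishing n W"
  unfolding vanishing_def by blast

lemma vanishing_rational: "a \<in> vanishing n W \<Longrightarrow> a \<in> rational_functions n W"
  unfolding vanishing_def rational_functions_def by blast

lemma rational_add: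
  assumes "a \<in> rational_functions n W" "b \<in> rational_functions n W"
  shows "a + b \<in> rational_functions n W"
proof -
  obtain G H d G' H' d' where *: "a = Fract G H" "weighted_homogeneous n d G" "weighted_homogeneous n d H"
    "nonzerodivisor_mod W H" "b = Fract G' H'" "weighted_homogeneous n d' G'" "weighted_homogeneous n d' H'"
    "nonzerodivisor_mod W H'"
    using assms unfolding rational_functions_def by blast
  have "a + b = Fract (G * H' + G' * H) (H * H')"
    using nzd_nonzero[OF *(4)] nzd_nonzero[OF *(8)] unfolding *(1,5) by simp
  moreover have "weighted_homogeneous n (d + d') (G * H' + G' * H)"
    using weighted_homogeneous_add[OF weighted_homogeneous_mult[OF *(2,7)] weighted_homogeneous_mult[OF *(3,6)]]
    by (simp add: mult.commute)
  ultimately show ?thesis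
    using rational_functionsI[OF _ weighted_homogeneous_mult[OF *(3,7)] nzd_mult[OF *(4,8)]] by simp
qed

lemma rational_mult:
  assumes "a \<in> rational_functions n W" "b \<in> rational_functions n W"
  shows "a * b \<in> rational_functions n W"
proof -
  obtain G H d G' H' d' where *: "a = Fract G H" "weighted_homogeneous n d G" "weighted_homogeneous n d H"
    "nonzerodivisor_mod W H" "b = Fract G' H'" "weighted_homogeneous n d' G'" "weighted_homogeneous n d' H'"
    "nonzerodivisor_mod W H'"
    using assms unfolding rational_functions_def by blast
  have "a * b = Fract (G * G') (H * H')" unfolding *(1,5) by simp
  then show ?thesis
    using rational_functionsI[OF weighted_homogeneous_mult[OF *(2,6)] weighted_homogeneous_mult[OF *(3,7)] nzd_mult[OF *(4,8)]]
    by simp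
qed

lemma vanishing_add:
  assumes "a \<in> vanishing n W" "b \<in> vanishing n W"
  shows "a + b \<in> vanishing n W"
proof -
  obtain G H d G' H' d' where *: "a = Fract G H" "weighted_homogeneous n d G" "weighted_homogeneous n d H"
    "nonzerodivisor_mod W H" "b = Fract G' H'" "weighted_homogeneous n d' G'" "weighted_homogeneous n d' H'"
    "nonzerodivisor_mod W H'" "W dvd G" "W dvd G'"
    using assms unfolding vanishing_def by blast
  have "a + b = Fract (G * H' + G' * H) (H * H')"
    using nzd_nonzero[OF *(4)] nzd_nonzero[OF *(8)] unfolding *(1,5) by simp
  moreover have "weighted_homogeneous n (d + d') (G * H' + G' * H)"
    using weighted_homogeneous_add[OF weighted_homogeneous_mult[OF *(2,7)] weighted_homogeneous_mult[OF *(3,6)]]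
    by (simp add: mult.commute)
  moreover have "W dvd G * H' + G' * H" using *(9,10) by simp
  ultimately show ?thesis
    using vanishingI[OF _ weighted_homogeneous_mult[OF *(3,7)] nzd_mult[OF *(4,8)]] by simp
qed

lemma vanishing_mult:
  assumes "a \<in> vanishing n W" "b \<in> rational_functions n W"
  shows "a * b \<in> vanishing n W"
proof -
  obtain G H d G' H' d' where *: "a = Fract G H" "weighted_homogeneous n d G" "weighted_homogeneous n d H"
    "nonzerodivisor_mod W H" "b = Fract G' H'" "weighted_homogeneous n d' G'" "weighted_homogeneous n d' H'"
    "nonzerodivisor_mod W H'" "W dvd G"
    using assms unfolding vanishing_def rational_functions_def by blast
  have "a * b = Fract (G * G') (H * H')" unfolding *(1,5) by simp
  moreover have "W dvd G * G'" using *(9) by simp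
  ultimately show ?thesis
    using vanishingI[OF weighted_homogeneous_mult[OF *(2,6)] weighted_homogeneous_mult[OF *(3,7)] nzd_mult[OF *(4,8)]]
    by simp
qed

lemma vanishing_minus:
  assumes "a \<in> vanishing n W" shows "- a \<in> vanishing n W"
proof -
  obtain G H d where *: "a = Fract G H" "weighted_homogeneous n d G" "weighted_homogeneous n d H"
    "nonzerodivisor_mod W H" "W dvd G" using assms unfolding vanishing_def by blast
  then show ?thesis using vanishingI[OF weighted_homogeneous_minus[OF *(2)] *(3,4)] by simp
qed

lemma zero_vanishing: "0 \<in> vanishing n W"
  using vanishingI[of n 0 0 1] nzd_1 by (simp add: Zero_fract_def)

lemma vanishing_diff: "a \<in> vanishing n W \<Longrightarrow> b \<in> vanishing n W \<Longrightarrow> a - b \<in> vanishing n W"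
  using vanishing_add[OF _ vanishing_minus] by fastforce

lemma local_fraction_add:
  assumes "local_fraction n W (bundle_point n (z, s)) G H" "local_fraction n W (bundle_point n (z, s)) G' H'"
  shows "local_fraction n W (bundle_point n (z, s)) (G * H' + G' * H) (H * H')"
    "Fract G H + Fract G' H' = Fract (G * H' + G' * H) (H * H')"
proof -
  obtain d d' where *: "weighted_homogeneous n d G" "weighted_homogeneous n d H" "nonzerodivisor_mod W H"
    "weighted_homogeneous n d' G'" "weighted_homogeneous n d' H'" "nonzerodivisor_mod W H'"
    "eval4 H z s \<noteq> 0" "eval4 H' z s \<noteq> 0"
    using assms unfolding local_fraction_point by blast
  have "weighted_homogeneous n (d + d') (G * H' + G' * H)"
    using weighted_homogeneous_add[OF weighted_homogeneous_mult[OF *(1,5)] weighted_homogeneous_mult[OF *(2,4)]]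
    by (simp add: mult.commute)
  then show "local_fraction n W (bundle_point n (z, s)) (G * H' + G' * H) (H * H')"
    unfolding local_fraction_point
    using weighted_homogeneous_mult[OF *(2,5)] nzd_mult[OF *(3,6)] *(7,8) by auto
  show "Fract G H + Fract G' H' = Fract (G * H' + G' * H) (H * H')"
    using nzd_nonzero[OF *(3)] nzd_nonzero[OF *(6)] by simp
qed

lemma local_fraction_mult:
  assumes "local_fraction n W (bundle_point n (z, s)) G H" "local_fraction n W (bundle_point n (z, s)) G' H'"
  shows "local_fraction n W (bundle_point n (z, s)) (G * G') (H * H')"
proof -
  obtain d d' where *: "weighted_homogeneous n d G" "weighted_homogeneous n d H" "nonzerodivisor_mod W H"
    "weighted_homogeneous n d' G'" "weighted_homogeneous n d' H'" "nonzerodivisor_mod W H'"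
    "eval4 H z s \<noteq> 0" "eval4 H' z s \<noteq> 0"
    using assms unfolding local_fraction_point by blast
  show ?thesis
    unfolding local_fraction_point
    using weighted_homogeneous_mult[OF *(1,4)] weighted_homogeneous_mult[OF *(2,5)] nzd_mult[OF *(3,6)] *(7,8) by auto
qed

lemma local_fraction_minus:
  "local_fraction n W \<tau> G H \<Longrightarrow> local_fraction n W \<tau> (- G) H"
  unfolding local_fraction_def using weighted_homogeneous_minus by blast

lemma local_rational: "local_fraction n W \<tau> G H \<Longrightarrow> Fract G H \<in> rational_functions n W"
  unfolding local_fraction_def by (blast intro: rational_functionsI)

lemma eval4_W: "eval4 W z s = s ^ m - eval3 F z"
  unfolding W_def by (rule eval4_cyclic_equation)

text \<open>Multiplying the integral equation by the \<open>k\<close>-th power of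
  \<open>b * H\<close> clears all denominators; \<open>e i\<close> is
  \<open>c i * b ^ (k - i)\<close> written without fractions, since \<open>h i\<close> divides
  \<open>b\<close>.\<close>

lemma integral_equation_lift:
  assumes c: "\<And>i. i < k \<Longrightarrow> c i = Fract (g i) (h i)" "\<And>i. i < k \<Longrightarrow> nonzerodivisor_mod W (h i)"
    and H: "nonzerodivisor_mod W H" and v: "Fract G H ^ k + (\<Sum>i<k. c i * Fract G H ^ i) \<in> vanishing n W"
  defines "b \<equiv> \<Prod>i<k. h i"
  defines "e \<equiv> \<lambda>i. g i * (\<Prod>j\<in>{..<k} - {i}. h j) * b ^ (k - i - 1)"
  shows "W dvd (b * G) ^ k + (\<Sum>i<k. e i * (b * G) ^ i * H ^ (k - i))"
proof -
  define X where "X = (b * G) ^ k + (\<Sum>i<k. e i * (b * G) ^ i * H ^ (k - i))"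
  define a where "a = Fract G H"
  have TH: "to_fract H \<noteq> 0" using nzd_nonzero[OF H] by simp
  have aH: "to_fract G = a * to_fract H" using TH by (simp add: a_def Fract_conv_to_fract)
  have e: "to_fract (e i) = c i * to_fract b ^ (k - i)" if "i < k" for i
  proof -
    have hi: "to_fract (h i) \<noteq> 0" using nzd_nonzero[OF c(2)[OF that]] by simp
    have "b = h i * (\<Prod>j\<in>{..<k} - {i}. h j)" unfolding b_def using that by (subst prod.remove[of _ i]) auto
    then have X: "to_fract (g i * (\<Prod>j\<in>{..<k} - {i}. h j)) = c i * to_fract b"
      using hi by (simp add: c(1)[OF that] Fract_conv_to_fract)
    have pw: "to_fract b ^ (k - i) = to_fract b * to_fract b ^ (k - i - 1)"
      using that by (cases "k - i") auto
    show ?thesis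
      unfolding e_def to_fract_mult[of _ "b ^ (k - i - 1)"] to_fract_power pw X by (simp only: mult.assoc)
  qed
  have "to_fract X = (to_fract b * to_fract H) ^ k * (a ^ k + (\<Sum>i<k. c i * a ^ i))"
  proof -
    have t: "to_fract (e i * (b * G) ^ i * H ^ (k - i)) = (to_fract b * to_fract H) ^ k * (c i * a ^ i)" if "i < k" for i
    proof -
      have "(to_fract b * to_fract H) ^ k = (to_fract b * to_fract H) ^ i * (to_fract b * to_fract H) ^ (k - i)"
        using that by (simp add: power_add[symmetric])
      then show ?thesis
        unfolding to_fract_mult to_fract_power e[OF that] aH by (simp only: power_mult_distrib mult_ac)
    qed
    have s: "to_fract (\<Sum>i<k. f i) = (\<Sum>i<k. to_fract (f i))" for f :: "nat \<Rightarrow> poly4" and k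
      by (induction k) auto
    have "(\<Sum>i<k. to_fract (e i * (b * G) ^ i * H ^ (k - i))) = (\<Sum>i<k. (to_fract b * to_fract H) ^ k * (c i * a ^ i))"
      using t by (intro sum.cong) auto
    moreover have "to_fract ((b * G) ^ k) = (to_fract b * to_fract H) ^ k * a ^ k"
      unfolding to_fract_power to_fract_mult aH by (simp only: power_mult_distrib mult_ac)
    ultimately show ?thesis
      unfolding X_def to_fract_add s distrib_left sum_distrib_left by (simp only:)
  qed
  moreover obtain V M where V: "a ^ k + (\<Sum>i<k. c i * a ^ i) = Fract V M" "nonzerodivisor_mod W M" "W dvd V"
    using v unfolding a_def vanishing_def by blast
  ultimately have "to_fract X * to_fract M = to_fract ((b * H) ^ k * V)"
    using nzd_nonzero[OF V(2)] by (simp add: to_fract_power Fract_conv_to_fract)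
  then have "M * X = (b * H) ^ k * V" by (metis mult.commute to_fract_eq_iff to_fract_mult)
  then have "W dvd M * X" using V(3) by simp
  then show ?thesis using V(2) unfolding nonzerodivisor_mod_def X_def by blast
qed

text \<open>Normality of the cover where \<open>F\<close> does not vanish. The denominators of the
  coefficients are collected in \<open>b\<close>, that of \<open>a\<close> is replaced by its norm
  \<open>r\<close>, and \<open>denominator_descent\<close> removes from \<open>r\<close> all primes
  except those of \<open>F\<close>. What remains is nonzero at \<open>z\<close>.\<close>

lemma integral_local:
  assumes F: "homogeneous (m * n) F" and z: "eval3 F z \<noteq> 0"
    and a: "a \<in> integral_functions n W (bundle_point n (z, s))"
  shows "\<exists>G H. local_fraction n W (bundle_point n (z, s)) G H \<and> a - Fract G H \<in> vanishing n W"
proof -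
  let ?\<tau> = "bundle_point n (z, s)"
  obtain G H d where G: "a = Fract G H" "weighted_homogeneous n d G" "weighted_homogeneous n d H" "nonzerodivisor_mod W H"
    using a unfolding integral_functions_def rational_functions_def by blast
  obtain k c where c: "\<forall>i<k. c i \<in> local_functions n W ?\<tau>" "a ^ k + (\<Sum>i<k. c i * a ^ i) \<in> vanishing n W"
    using a unfolding integral_functions_def by blast
  have "\<forall>i. \<exists>g h d. i < k \<longrightarrow> c i = Fract g h \<and> weighted_homogeneous n d h \<and> nonzerodivisor_mod W h \<and> eval4 h z s \<noteq> 0"
    using c(1) unfolding local_functions_def local_fraction_point by blast
  then obtain g h dd where gh: "\<And>i. i < k \<Longrightarrow> c i = Fract (g i) (h i)" "\<And>i. i < k \<Longrightarrow> weighted_homogeneous n (dd i) (h i)"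
    "\<And>i. i < k \<Longrightarrow> nonzerodivisor_mod W (h i)" "\<And>i. i < k \<Longrightarrow> eval4 (h i) z s \<noteq> 0"
    by metis
  define b where "b = (\<Prod>i<k. h i)"
  define db where "db = (\<Sum>i<k. dd i)"
  have b: "weighted_homogeneous n db b" "nonzerodivisor_mod W b" "eval4 b z s \<noteq> 0"
    unfolding b_def db_def using gh by (auto intro: weighted_homogeneous_prod nzd_prod)
  define e where "e i = g i * (\<Prod>j\<in>{..<k} - {i}. h j) * b ^ (k - i - 1)" for i
  have e: "W dvd (b * G) ^ k + (\<Sum>i<k. e i * (b * G) ^ i * H ^ (k - i))"
    unfolding e_def b_def
    by (rule integral_equation_lift[OF _ _ G(4) c(2)[unfolded G(1)]]) (use gh in auto)
  obtain H' r d' where H': "W dvd H * H' - [:r:]" "r \<noteq> 0" "weighted_homogeneous n d' H'" "homogeneous (d + d') r"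
    using norm_multiple[OF G(4,3) F] by blast
  define x where "x = b * G * H'"
  \<comment> \<open>The numerator of \<open>b * a\<close> over \<open>r\<close>, in normal form,
    because the descent requires degree below \<open>m\<close>.\<close>
  define y where "y = red x"
  have xy: "W dvd x - y" unfolding y_def by (rule W_dvd_red)
  have "W dvd H' ^ k * ((b * G) ^ k + (\<Sum>i<k. e i * (b * G) ^ i * H ^ (k - i)))" using e by (rule dvd_mult)
  also have "H' ^ k * ((b * G) ^ k + (\<Sum>i<k. e i * (b * G) ^ i * H ^ (k - i)))
     = x ^ k + (\<Sum>i<k. e i * x ^ i * (H * H') ^ (k - i))"
  proof -
    have "H' ^ k * (e i * (b * G) ^ i * H ^ (k - i)) = e i * x ^ i * (H * H') ^ (k - i)" if "i < k" for i
    proof -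
      have "H' ^ k = H' ^ i * H' ^ (k - i)" using that by (simp add: power_add[symmetric])
      then show ?thesis unfolding x_def by (simp only: power_mult_distrib mult_ac)
    qed
    then have "(\<Sum>i<k. H' ^ k * (e i * (b * G) ^ i * H ^ (k - i))) = (\<Sum>i<k. e i * x ^ i * (H * H') ^ (k - i))"
      by (intro sum.cong) auto
    then show ?thesis unfolding distrib_left sum_distrib_left by (simp only: x_def power_mult_distrib mult_ac)
  qed
  finally have "W dvd x ^ k + (\<Sum>i<k. e i * x ^ i * (H * H') ^ (k - i))" .
  moreover have "W dvd (x ^ k + (\<Sum>i<k. e i * x ^ i * (H * H') ^ (k - i))) - (y ^ k + (\<Sum>i<k. e i * y ^ i * [:r:] ^ (k - i)))"
  proof -
    have "W dvd (\<Sum>i<k. e i * x ^ i * (H * H') ^ (k - i) - e i * y ^ i * [:r:] ^ (k - i))"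
      using xy H'(1) by (intro dvd_sum dvd_diff_mult dvd_diff_power) auto
    then have "W dvd (x ^ k - y ^ k) + (\<Sum>i<k. e i * x ^ i * (H * H') ^ (k - i) - e i * y ^ i * [:r:] ^ (k - i))"
      by (intro dvd_add dvd_diff_power xy)
    then show ?thesis by (simp only: sum_subtractf add_diff_add)
  qed
  ultimately have "W dvd y ^ k + (\<Sum>i<k. e i * y ^ i * [:r:] ^ (k - i))" using dvd_trans_diff by blast
  from denominator_descent[OF H'(2) _ this] obtain u y' r' where
    u: "y = [:u:] * y'" "r = u * r'" "\<And>\<pi>. prime_elem \<pi> \<Longrightarrow> \<pi> dvd r' \<Longrightarrow> \<pi> dvd F"
    using degree_red[of x] unfolding y_def by blast
  have nz: "u \<noteq> 0" "r' \<noteq> 0" using H'(2) u(2) by auto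
  have rz: "eval3 r' z \<noteq> 0"
  proof
    assume "eval3 r' z = 0"
    then obtain \<pi> where "\<pi> \<in> prime_factors r'" "eval3 \<pi> z = 0" using eval3_prime_factors[OF nz(2)] by blast
    then have "\<pi> dvd F" "eval3 \<pi> z = 0" by (auto intro: u(3) simp: in_prime_factors_iff prime_def)
    then show False using z eval3_dvd by blast
  qed
  obtain \<alpha> where \<alpha>: "homogeneous \<alpha> u" using homogeneous_dvd[OF H'(4) _ H'(2), of u] u(2) by auto
  obtain \<beta> where \<beta>: "homogeneous \<beta> r'" using homogeneous_dvd[OF H'(4) _ H'(2), of r'] u(2) by auto
  have ab: "\<alpha> + \<beta> = d + d'"
    using homogeneous_unique[OF homogeneous_mult[OF \<alpha> \<beta>] _ H'(2)[unfolded u(2)]] H'(4) u(2) by simp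
  have wy: "weighted_homogeneous n (db + d + d') y"
    unfolding y_def x_def by (intro weighted_homogeneous_red weighted_homogeneous_mult b G H' F)
  \<comment> \<open>Dividing by \<open>u\<close> preserves weighted homogeneity because factors of
    forms are forms; the weight drops by the degree \<open>\<alpha>\<close> of
    \<open>u\<close>.\<close>
  have wy': "weighted_homogeneous n (db + \<beta>) y'"
    unfolding weighted_homogeneous_def
  proof (intro allI impI)
    fix i assume i: "coeff y' i \<noteq> 0"
    have ci: "coeff y i = u * coeff y' i" unfolding u(1) by simp
    have ne: "u * coeff y' i \<noteq> 0" using i nz by simp
    have h: "i * n \<le> db + d + d'" "homogeneous (db + d + d' - i * n) (u * coeff y' i)"
      using wy ne unfolding weighted_homogeneous_def ci[symmetric] by blast+
    obtain \<gamma> where \<gamma>: "homogeneous \<gamma> (coeff y' i)" using homogeneous_dvd[OF h(2) _ ne, of "coeff y' i"] by auto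
    have "\<alpha> + \<gamma> = db + d + d' - i * n"
      by (rule homogeneous_unique[OF homogeneous_mult[OF \<alpha> \<gamma>] h(2) ne])
    then have "i * n \<le> db + \<beta>" "\<gamma> = db + \<beta> - i * n" using ab h(1) by linarith+
    then show "i * n \<le> db + \<beta> \<and> homogeneous (db + \<beta> - i * n) (coeff y' i)" using \<gamma> by simp
  qed
  define H1 where "H1 = b * [:r':]"
  have H1: "weighted_homogeneous n (db + \<beta>) H1" "nonzerodivisor_mod W H1" "eval4 H1 z s \<noteq> 0"
    unfolding H1_def using b rz nz
    by (auto simp del: mult_pCons_right intro!: weighted_homogeneous_mult weighted_homogeneous_const \<beta> nzd_mult nzd_const)
  \<comment> \<open>Multiplication by \<open>u\<close> restores \<open>y\<close> and
    \<open>r\<close>, for which the congruences are known; \<open>u\<close> is then cancelled as a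
    nonzerodivisor.\<close>
  have "W dvd [:u:] * (G * H1 - y' * H)"
  proof -
    have "[:r:] = [:u:] * [:r':]" by (simp add: u(2) mult.commute)
    then have "[:u:] * (G * H1 - y' * H) = b * G * [:r:] - y * H"
      unfolding H1_def u(1) by (simp only: right_diff_distrib mult_ac)
    also have "\<dots> = H * (x - y) - b * G * (H * H' - [:r:])" unfolding x_def by (simp only: right_diff_distrib mult_ac) simp
    finally show ?thesis using xy H'(1) by (metis dvd_diff dvd_mult)
  qed
  then have "W dvd G * H1 - y' * H" using nzd_const[OF nz(1)] unfolding nonzerodivisor_mod_def by blast
  moreover have "weighted_homogeneous n (d + (db + \<beta>)) (G * H1 - y' * H)"
    using weighted_homogeneous_diff[OF weighted_homogeneous_mult[OF G(2) H1(1)] weighted_homogeneous_mult[OF G(3) wy']]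
    by (simp add: mult.commute)
  ultimately have "Fract (G * H1 - y' * H) (H * H1) \<in> vanishing n W"
    by (intro vanishingI[OF _ weighted_homogeneous_mult[OF G(3) H1(1)] nzd_mult[OF G(4) H1(2)]])
  moreover have "a - Fract y' H1 = Fract (G * H1 - y' * H) (H * H1)"
    unfolding G(1) using nzd_nonzero[OF G(4)] nzd_nonzero[OF H1(2)] by simp
  moreover have "local_fraction n W ?\<tau> y' H1" unfolding local_fraction_point using wy' H1 by blast
  ultimately show ?thesis by (intro exI[of _ y'] exI[of _ H1]) simp
qed

lemma local_integral:
  assumes a: "a \<in> rational_functions n W" and lf: "local_fraction n W \<tau> G H" "a - Fract G H \<in> vanishing n W"
  shows "a \<in> integral_functions n W \<tau>"
proof -
  have l: "Fract (- G) H \<in> local_functions n W \<tau>"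
    using local_fraction_minus[OF lf(1)] unfolding local_functions_def by blast
  have "a ^ 1 + (\<Sum>i<1. Fract (- G) H * a ^ i) = a - Fract G H"
    by (simp del: minus_fract add: minus_fract[symmetric])
  then have "a ^ 1 + (\<Sum>i<1. Fract (- G) H * a ^ i) \<in> vanishing n W" using lf(2) by (simp only:)
  then have "\<exists>k c. (\<forall>i<k. c i \<in> local_functions n W \<tau>) \<and> a ^ k + (\<Sum>i<k. c i * a ^ i) \<in> vanishing n W"
    by (intro exI[of _ "1 :: nat"] exI[of _ "\<lambda>_. Fract (- G) H"] conjI allI impI l)
  then show ?thesis using a unfolding integral_functions_def by blast
qed

lemma vanishing_integral:
  assumes "a \<in> vanishing n W" shows "a \<in> integral_functions n W \<tau>"
proof (rule local_integral[of a n \<tau> 0 1])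
  show "a \<in> rational_functions n W" using assms by (rule vanishing_rational)
  have "weighted_homogeneous n 0 0" "weighted_homogeneous n 0 1" by simp_all
  then show "local_fraction n W \<tau> 0 1" unfolding local_fraction_def using nzd_1 by fastforce
  show "a - Fract 0 1 \<in> vanishing n W" using assms by (simp add: Zero_fract_def[symmetric])
qed

lemma local_vanishing:
  assumes "local_fraction n W (bundle_point n (z, s)) G H" "Fract G H \<in> vanishing n W" "eval4 W z s = 0"
  shows "eval4 G z s = 0"
proof -
  obtain V M where V: "Fract G H = Fract V M" "nonzerodivisor_mod W M" "W dvd V"
    using assms(2) unfolding vanishing_def by blast
  have "nonzerodivisor_mod W H" using assms(1) unfolding local_fraction_def by blast
  then have "G * M = V * H" using V(1) nzd_nonzero[OF V(2)] nzd_nonzero[of H] by (simp add: eq_fract)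
  then have "W dvd M * G" using V(3) by (metis dvd_mult2 mult.commute)
  then have "W dvd G" using V(2) unfolding nonzerodivisor_mod_def by blast
  then show ?thesis using assms(3) eval4_dvd by blast
qed

text \<open>The value at \<open>(z, s)\<close> of any regular fraction congruent to
  \<open>a\<close>. Where \<open>F\<close> is nonzero one exists by \<open>integral_local\<close>,
  and on the hypersurface its value does not depend on the choice by
  \<open>value_unique\<close>.\<close>

definition psi :: "nat \<Rightarrow> complex ^ 3 \<Rightarrow> complex \<Rightarrow> poly4 fract \<Rightarrow> complex" where
  "psi n z s = (\<lambda>a \<in> integral_functions n W (bundle_point n (z, s)).
     SOME v. \<exists>G H. local_fraction n W (bundle_point n (z, s)) G H \<and> a - Fract G H \<in> vanishing n W \<and>
       v = eval4 G z s / eval4 H z s)"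

lemma value_unique:
  assumes "eval4 W z s = 0"
    and 1: "local_fraction n W (bundle_point n (z, s)) G H" "a - Fract G H \<in> vanishing n W"
    and 2: "local_fraction n W (bundle_point n (z, s)) G' H'" "a - Fract G' H' \<in> vanishing n W"
  shows "eval4 G z s / eval4 H z s = eval4 G' z s / eval4 H' z s"
proof -
  have nz: "H' \<noteq> 0" using 2(1) nzd_nonzero unfolding local_fraction_def by blast
  have "Fract G H + Fract (- G') H' = (a - Fract G' H') - (a - Fract G H)" using nz by simp
  then have "Fract G H + Fract (- G') H' \<in> vanishing n W" using vanishing_diff[OF 2(2) 1(2)] by (simp only:)
  then have "eval4 (G * H' + - G' * H) z s = 0"
    using local_vanishing[OF _ _ assms(1)] local_fraction_add[OF 1(1) local_fraction_minus[OF 2(1)]] by metis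
  then have "eval4 (G * H' - G' * H) z s = 0" by simp
  moreover have "eval4 H z s \<noteq> 0" "eval4 H' z s \<noteq> 0" using 1 2 unfolding local_fraction_point by blast+
  ultimately show ?thesis by (simp add: field_simps)
qed

lemma psi_eq:
  assumes "eval4 W z s = 0" "a \<in> rational_functions n W"
    and lf: "local_fraction n W (bundle_point n (z, s)) G H" "a - Fract G H \<in> vanishing n W"
  shows "psi n z s a = eval4 G z s / eval4 H z s"
proof -
  have "a \<in> integral_functions n W (bundle_point n (z, s))" by (rule local_integral[OF assms(2) lf])
  moreover have "(SOME v. \<exists>G H. local_fraction n W (bundle_point n (z, s)) G H \<and> a - Fract G H \<in> vanishing n W \<and>
       v = eval4 G z s / eval4 H z s) = eval4 G z s / eval4 H z s"
  proof (rule some_equality)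
    show "\<exists>G' H'. local_fraction n W (bundle_point n (z, s)) G' H' \<and> a - Fract G' H' \<in> vanishing n W \<and>
       eval4 G z s / eval4 H z s = eval4 G' z s / eval4 H' z s" using lf by blast
    fix v assume "\<exists>G' H'. local_fraction n W (bundle_point n (z, s)) G' H' \<and> a - Fract G' H' \<in> vanishing n W \<and>
       v = eval4 G' z s / eval4 H' z s"
    then obtain G' H' where *: "local_fraction n W (bundle_point n (z, s)) G' H'" "a - Fract G' H' \<in> vanishing n W"
      "v = eval4 G' z s / eval4 H' z s" by blast
    show "v = eval4 G z s / eval4 H z s" unfolding *(3) by (rule value_unique[OF assms(1) *(1,2) lf])
  qed
  ultimately show ?thesis unfolding psi_def restrict_def by simp
qed

lemma psi_character:
  assumes F: "homogeneous (m * n) F" and z: "eval3 F z \<noteq> 0" and s: "s ^ m = eval3 F z"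
  shows "integral_character n W (bundle_point n (z, s)) (psi n z s)"
proof -
  let ?\<tau> = "bundle_point n (z, s)"
  have W0: "eval4 W z s = 0" using s by (simp add: eval4_W)
  have lf: "\<exists>G H. local_fraction n W ?\<tau> G H \<and> a - Fract G H \<in> vanishing n W" "a \<in> rational_functions n W"
    if "a \<in> integral_functions n W ?\<tau>" for a
    using integral_local[OF F z that] that unfolding integral_functions_def by auto
  have ev: "psi n z s (Fract G H) = eval4 G z s / eval4 H z s" if "local_fraction n W ?\<tau> G H" for G H
    using psi_eq[OF W0 local_rational[OF that] that] zero_vanishing by simp
  have ab: "psi n z s (a + b) = psi n z s a + psi n z s b \<and> psi n z s (a * b) = psi n z s a * psi n z s b"
    if a: "a \<in> integral_functions n W ?\<tau>" and b: "b \<in> integral_functions n W ?\<tau>" for a b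
  proof -
    obtain G H where G: "local_fraction n W ?\<tau> G H" "a - Fract G H \<in> vanishing n W" using lf(1)[OF a] by blast
    obtain G' H' where G': "local_fraction n W ?\<tau> G' H'" "b - Fract G' H' \<in> vanishing n W" using lf(1)[OF b] by blast
    have nz: "eval4 H z s \<noteq> 0" "eval4 H' z s \<noteq> 0" using G G' unfolding local_fraction_point by blast+
    have "(a + b) - Fract (G * H' + G' * H) (H * H') = (a - Fract G H) + (b - Fract G' H')"
      using local_fraction_add(2)[OF G(1) G'(1)] by (simp add: algebra_simps)
    then have s: "(a + b) - Fract (G * H' + G' * H) (H * H') \<in> vanishing n W"
      using vanishing_add[OF G(2) G'(2)] by (simp only:)
    have "a * b - Fract (G * G') (H * H') = (a - Fract G H) * b + (b - Fract G' H') * Fract G H"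
      by (simp add: algebra_simps flip: mult_fract)
    then have p: "a * b - Fract (G * G') (H * H') \<in> vanishing n W"
      using vanishing_add[OF vanishing_mult[OF G(2) lf(2)[OF b]] vanishing_mult[OF G'(2) local_rational[OF G(1)]]] by (simp only:)
    show ?thesis
      unfolding psi_eq[OF W0 lf(2)[OF a] G] psi_eq[OF W0 lf(2)[OF b] G']
        psi_eq[OF W0 rational_add[OF lf(2)[OF a] lf(2)[OF b]] local_fraction_add(1)[OF G(1) G'(1)] s]
        psi_eq[OF W0 rational_mult[OF lf(2)[OF a] lf(2)[OF b]] local_fraction_mult[OF G(1) G'(1)] p]
      using nz by (simp add: add_frac_eq)
  qed
  have van: "psi n z s a = 0" if a: "a \<in> vanishing n W" for a
  proof -
    have l: "local_fraction n W ?\<tau> 0 1"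
      unfolding local_fraction_point using nzd_1 by (auto intro!: exI[of _ 0])
    have "a - Fract 0 1 \<in> vanishing n W" using a by (simp add: Zero_fract_def[symmetric])
    from psi_eq[OF W0 vanishing_rational[OF a] l this] show ?thesis by simp
  qed
  show ?thesis
    unfolding integral_character_def
  proof (intro conjI)
    show "psi n z s \<in> extensional (integral_functions n W ?\<tau>)" by (simp add: psi_def)
    show "\<forall>G H. local_fraction n W ?\<tau> G H \<longrightarrow> (\<forall>(z', s')\<in>?\<tau>. psi n z s (Fract G H) = eval4 G z' s' / eval4 H z' s')"
      using ev local_fraction_value by auto
    show "\<forall>a\<in>vanishing n W. psi n z s a = 0" using van by blast
  qed (use ab in blast)
qed

text \<open>A character is prescribed on regular fractions and on \<open>vanishing\<close>, and by
  \<open>integral_local\<close> every integral function is a sum of the two. With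
  \<open>psi_character\<close>, one point of the normalization lies over each point of the
  hypersurface with \<open>F\<close> nonzero.\<close>

lemma character_unique:
  assumes F: "homogeneous (m * n) F" and z: "eval3 F z \<noteq> 0" and s: "s ^ m = eval3 F z"
    and \<psi>: "integral_character n W (bundle_point n (z, s)) \<psi>"
  shows "\<psi> = psi n z s"
proof
  fix a
  let ?\<tau> = "bundle_point n (z, s)"
  have W0: "eval4 W z s = 0" using s by (simp add: eval4_W)
  show "\<psi> a = psi n z s a"
  proof (cases "a \<in> integral_functions n W ?\<tau>")
    case False
    then show ?thesis using \<psi> unfolding integral_character_def psi_def by (auto simp: extensional_def)
  next
    case True
    then have ar: "a \<in> rational_functions n W" unfolding integral_functions_def by auto
    obtain G H where G: "local_fraction n W ?\<tau> G H" "a - Fract G H \<in> vanishing n W"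
      using integral_local[OF F z True] by blast
    have i: "Fract G H \<in> integral_functions n W ?\<tau>"
      using local_integral[OF local_rational[OF G(1)] G(1)] zero_vanishing by simp
    have v: "a - Fract G H \<in> integral_functions n W ?\<tau>" by (rule vanishing_integral[OF G(2)])
    have "\<psi> (Fract G H + (a - Fract G H)) = \<psi> (Fract G H) + \<psi> (a - Fract G H)"
      using \<psi> i v unfolding integral_character_def by blast
    moreover have "\<psi> (a - Fract G H) = 0" using \<psi> G(2) unfolding integral_character_def by blast
    moreover have "\<psi> (Fract G H) = eval4 G z s / eval4 H z s"
      using \<psi> G(1) bundle_point_self[of z s n] unfolding integral_character_def by blast
    ultimately show ?thesis using psi_eq[OF W0 ar G] by simp
  qed
qed

end

section \<open>Topology of line bundles and of the cover\<close>

lemma proj_pt_eqD: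
  assumes "proj_pt z = proj_pt z'" obtains c where "c \<noteq> 0" "z' = c *s z"
proof -
  have "z' \<in> proj_pt z'" unfolding proj_pt_def by (auto intro!: exI[of _ 1])
  then have "z' \<in> proj_pt z" using assms by simp
  then show ?thesis using that unfolding proj_pt_def by blast
qed

lemma proj_pt_locus:
  assumes "homogeneous d G" "z \<noteq> 0"
  shows "proj_pt z \<in> locus G \<longleftrightarrow> eval3 G z = 0"
proof
  assume "proj_pt z \<in> locus G"
  then obtain z' where "proj_pt z = proj_pt z'" "eval3 G z' = 0" unfolding locus_def by blast
  then show "eval3 G z = 0" using eval3_homogeneous[OF assms(1)] by (auto elim!: proj_pt_eqD)
qed (use assms in \<open>auto simp: locus_def\<close>)

lemma locusE:
  assumes "x \<in> locus G" obtains z where "z \<noteq> 0" "eval3 G z = 0" "x = proj_pt z"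
  using assms unfolding locus_def by blast

lemma bundle_point_eqD:
  assumes "bundle_point k (z, s) = bundle_point k (z', s')"
  obtains c where "c \<noteq> 0" "z' = c *s z" "s' = c ^ k * s"
  using bundle_point_self[of z' s' k] unfolding assms[symmetric] bundle_point_mem using that by blast

lemma bundle_point_scale:
  assumes "c \<noteq> 0" shows "bundle_point k (c *s z, c ^ k * s) = bundle_point k (z, s)"
proof (rule set_eqI)
  fix p :: "(complex ^ 3) \<times> complex"
  obtain z' s' where p: "p = (z', s')" by (cases p)
  have "(\<exists>d. d \<noteq> 0 \<and> z' = d *s (c *s z) \<and> s' = d ^ k * (c ^ k * s)) \<longleftrightarrow> (\<exists>d. d \<noteq> 0 \<and> z' = d *s z \<and> s' = d ^ k * s)"
    (is "?L \<longleftrightarrow> ?R")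
  proof
    assume ?L then obtain d where "d \<noteq> 0" "z' = d *s (c *s z)" "s' = d ^ k * (c ^ k * s)" by blast
    then show ?R using assms by (intro exI[of _ "d * c"]) (auto simp: vector_scalar_mult_def vec_eq_iff power_mult_distrib mult_ac)
  next
    assume ?R then obtain d where "d \<noteq> 0" "z' = d *s z" "s' = d ^ k * s" by blast
    then show ?L using assms by (intro exI[of _ "d / c"]) (auto simp: vector_scalar_mult_def vec_eq_iff power_divide)
  qed
  then show "p \<in> bundle_point k (c *s z, c ^ k * s) \<longleftrightarrow> p \<in> bundle_point k (z, s)"
    unfolding p bundle_point_mem .
qed

lemma topspace_total_space: "topspace (total_space k) = bundle_point k ` ((- {0}) \<times> UNIV)"
  using quotient_imp_surjective_map[OF quotient_map_quotient_topology[of "top_of_set ((- {0}) \<times> UNIV)" "bundle_point k"]]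
  by (simp add: total_space_def)

lemma topspace_P2: "topspace P2 = proj_pt ` (- {0})"
  using quotient_imp_surjective_map[OF quotient_map_quotient_topology[of "top_of_set (- {0})" proj_pt]]
  by (simp add: P2_def)

lemma continuous_bundle_point: "continuous_map (top_of_set ((- {0}) \<times> UNIV)) (total_space k) (bundle_point k)"
  unfolding total_space_def by (rule quotient_imp_continuous_map[OF quotient_map_quotient_topology])

lemma quotient_proj_pt: "quotient_map (top_of_set (- {0})) P2 proj_pt"
  unfolding P2_def by (rule quotient_map_quotient_topology)

lemma continuous_proj_pt: "continuous_map (top_of_set (- {0})) P2 proj_pt"
  by (rule quotient_imp_continuous_map[OF quotient_proj_pt])

lemma bundle_section_point:
  assumes "homogeneous k G" shows "bundle_section G (proj_pt z) = bundle_point k (z, eval3 G z)"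
  unfolding bundle_section_def proj_pt_def bundle_point_def
  by (auto simp: eval3_homogeneous[OF assms] image_iff)

lemma continuous_bundle_section:
  assumes "homogeneous k G" shows "continuous_map P2 (total_space k) (bundle_section G)"
proof (rule continuous_compose_quotient_map[OF quotient_proj_pt])
  have "continuous_map (top_of_set (- {0})) (top_of_set ((- {0}) \<times> UNIV)) (\<lambda>z. (z, eval3 G z))"
    by (auto intro!: continuous_intros continuous_on_id)
  from continuous_map_compose[OF this continuous_bundle_point[of k]]
  show "continuous_map (top_of_set (- {0})) (total_space k) (bundle_section G \<circ> proj_pt)"
    by (simp add: o_def bundle_section_point[OF assms])
qed

lemma closedin_locus:
  assumes "homogeneous d G" shows "closedin P2 (locus G)"
proof -
  have "openin (top_of_set (- {0})) {z \<in> - {0}. eval3 G z \<noteq> 0}"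
  proof -
    have "continuous_on (- {0}) (\<lambda>z. eval3 G z)" by (intro continuous_intros)
    from continuous_openin_preimage_gen[OF this open_Compl[OF closed_singleton[of 0]]]
    show ?thesis by (simp add: vimage_def Int_def)
  qed
  moreover have "{z \<in> topspace (top_of_set (- {0})). proj_pt z \<in> topspace P2 - locus G} = {z \<in> - {0}. eval3 G z \<noteq> 0}"
    using proj_pt_locus[OF assms] by (auto simp: topspace_P2)
  ultimately have "openin P2 (topspace P2 - locus G)"
    using quotient_proj_pt[unfolded quotient_map_def, THEN conjunct2, rule_format, OF Diff_subset, of "locus G"]
    by (simp only:)
  moreover have "locus G \<subseteq> topspace P2" by (auto simp: locus_def topspace_P2)
  ultimately show ?thesis by (simp add: closedin_def)
qed

definition hermitian :: "complex ^ 3 \<Rightarrow> complex" where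
  "hermitian z = (\<Sum>i\<in>UNIV. z $ i * cnj (z $ i))"

lemma hermitian_nonzero: "z \<noteq> 0 \<Longrightarrow> hermitian z \<noteq> 0"
proof
  assume "z \<noteq> 0" "hermitian z = 0"
  have "hermitian z = complex_of_real (\<Sum>i\<in>UNIV. (cmod (z $ i))\<^sup>2)"
    by (simp add: hermitian_def complex_norm_square[symmetric])
  then have "(\<Sum>i\<in>UNIV. (cmod (z $ i))\<^sup>2) = 0" using \<open>hermitian z = 0\<close> by (metis of_real_eq_0_iff)
  then have "z $ i = 0" for i by (simp add: sum_nonneg_eq_0_iff)
  then show False using \<open>z \<noteq> 0\<close> by (simp add: vec_eq_iff)
qed

lemma hermitian_scale: "hermitian (c *s z) = c * cnj c * hermitian z"
  by (simp add: hermitian_def sum_distrib_left mult_ac)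

text \<open>
  The function \<open>s conj(z\<^sub>j)^k / (z, z)^k\<close> is invariant under the action defining \<open>O(k)\<close>, hence
  a global continuous fibre coordinate, which does not vanish where \<open>z\<^sub>j\<close> does not.
\<close>

definition fibre_coord :: "nat \<Rightarrow> 3 \<Rightarrow> bundle_pt \<Rightarrow> complex" where
  "fibre_coord k j \<tau> = (let (z, s) = (SOME p. p \<in> \<tau>) in s * cnj (z $ j) ^ k / hermitian z ^ k)"

lemma fibre_coord_point:
  assumes "z \<noteq> 0"
  shows "fibre_coord k j (bundle_point k (z, s)) = s * cnj (z $ j) ^ k / hermitian z ^ k"
proof -
  have "(SOME p. p \<in> bundle_point k (z, s)) \<in> bundle_point k (z, s)"
    using bundle_point_self[of z s k] by (rule someI)
  moreover obtain z' s' where p: "(SOME p. p \<in> bundle_point k (z, s)) = (z', s')" by fastforce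
  ultimately have "(z', s') \<in> bundle_point k (z, s)" by simp
  then obtain c where c: "c \<noteq> 0" "z' = c *s z" "s' = c ^ k * s" unfolding bundle_point_mem by blast
  have "fibre_coord k j (bundle_point k (z, s)) = s' * cnj (z' $ j) ^ k / hermitian z' ^ k"
    unfolding fibre_coord_def p by simp
  also have "\<dots> = s * cnj (z $ j) ^ k / hermitian z ^ k"
    using c(1) hermitian_nonzero[OF assms] unfolding c(2,3) hermitian_scale
    by (simp add: power_mult_distrib field_simps)
  finally show ?thesis .
qed

lemma continuous_fibre_coord: "continuous_map (total_space k) euclidean (fibre_coord k j)"
  unfolding total_space_def
proof (rule continuous_compose_quotient_map[OF quotient_map_quotient_topology])
  have "continuous_on ((- {0}) \<times> UNIV) (\<lambda>p. snd p * cnj (fst p $ j) ^ k / hermitian (fst p) ^ k)"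
    using hermitian_nonzero unfolding hermitian_def by (intro continuous_intros) auto
  then have "continuous_on ((- {0}) \<times> UNIV) (fibre_coord k j \<circ> bundle_point k)"
  proof (rule continuous_on_eq)
    fix p :: "(complex ^ 3) \<times> complex" assume "p \<in> (- {0}) \<times> UNIV"
    then have "fst p \<noteq> 0" by auto
    from fibre_coord_point[OF this, of k j "snd p"]
    show "snd p * cnj (fst p $ j) ^ k / hermitian (fst p) ^ k = (fibre_coord k j \<circ> bundle_point k) p" by simp
  qed
  then show "continuous_map (top_of_set ((- {0}) \<times> UNIV)) euclidean (fibre_coord k j \<circ> bundle_point k)"
    by simp
qed

text \<open>The section is read as a homogeneous function on the cone. Continuity is transported by
  \<open>fibre_coord\<close>, since the quotient topology gives no direct access to values in a
  fibre.\<close>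

lemma root_section_function:
  assumes h: "root_section l k F H h" and H: "homogeneous e H" and F: "homogeneous (k * l) F"
  obtains \<eta> where "continuous_on {z. z \<noteq> 0 \<and> eval3 H z = 0} \<eta>"
    "\<And>z. z \<noteq> 0 \<Longrightarrow> eval3 H z = 0 \<Longrightarrow> h (proj_pt z) = bundle_point k (z, \<eta> z)"
    "\<And>z. z \<noteq> 0 \<Longrightarrow> eval3 H z = 0 \<Longrightarrow> \<eta> z ^ l = eval3 F z"
    "\<And>z c. z \<noteq> 0 \<Longrightarrow> eval3 H z = 0 \<Longrightarrow> c \<noteq> 0 \<Longrightarrow> \<eta> (c *s z) = c ^ k * \<eta> z"
proof -
  let ?R = "{z. z \<noteq> 0 \<and> eval3 H z = 0}"
  have hc: "continuous_map (subtopology P2 (locus H)) (total_space k) h"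
    and hp: "\<And>x. x \<in> locus H \<Longrightarrow> bundle_proj (h x) = x"
    and hl: "\<And>x. x \<in> locus H \<Longrightarrow> bundle_power l (h x) = bundle_section F x"
    using h unfolding root_section_def by auto
  have mem: "proj_pt z \<in> locus H" if "z \<in> ?R" for z using that by (auto simp: locus_def)
  \<comment> \<open>A scalar fixing a nonzero vector is 1, so a point of the bundle has only one
    coordinate at the representative \<open>z\<close>.\<close>
  have uniq: "s = s'" if eq: "bundle_point k (z, s) = bundle_point k (z, s')" and "z \<noteq> 0" for z s s'
  proof -
    obtain c where c: "c \<noteq> 0" "z = c *s z" "s' = c ^ k * s" using eq by (rule bundle_point_eqD)
    obtain i where i: "z $ i \<noteq> 0" using \<open>z \<noteq> 0\<close> by (auto simp: vec_eq_iff)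
    have "z $ i = c * z $ i" using c(2) by (metis vector_smult_component)
    then have "c = 1" using i by simp
    then show ?thesis using c by simp
  qed
  have "\<exists>s. h (proj_pt z) = bundle_point k (z, s)" if z: "z \<in> ?R" for z
  proof -
    have "h (proj_pt z) \<in> topspace (total_space k)"
      using hc mem[OF z] unfolding continuous_map_def by (auto simp: topspace_P2 locus_def)
    then obtain z' s where z': "z' \<noteq> 0" "h (proj_pt z) = bundle_point k (z', s)"
      unfolding topspace_total_space by auto
    have "proj_pt z' = proj_pt z" using hp[OF mem[OF z]] unfolding z'(2) bundle_proj_point .
    then obtain c where "c \<noteq> 0" "z = c *s z'" by (rule proj_pt_eqD)
    then have "h (proj_pt z) = bundle_point k (z, c ^ k * s)" unfolding z'(2) by (simp add: bundle_point_scale)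
    then show ?thesis by blast
  qed
  then obtain \<eta> where \<eta>: "\<And>z. z \<in> ?R \<Longrightarrow> h (proj_pt z) = bundle_point k (z, \<eta> z)" by metis
  have \<eta>l: "\<eta> z ^ l = eval3 F z" if z: "z \<in> ?R" for z
  proof -
    have "bundle_point (k * l) (z, \<eta> z ^ l) = bundle_point (k * l) (z, eval3 F z)"
      using hl[OF mem[OF z]] unfolding \<eta>[OF z] bundle_power_point bundle_section_point[OF F] .
    then obtain c where c: "c \<noteq> 0" "z = c *s z" "eval3 F z = c ^ (k * l) * \<eta> z ^ l" by (rule bundle_point_eqD)
    obtain i where i: "z $ i \<noteq> 0" using z by (auto simp: vec_eq_iff)
    have "z $ i = c * z $ i" using c(2) by (metis vector_smult_component)
    then have "c = 1" using i by simp
    then show ?thesis using c by simp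
  qed
  have \<eta>s: "\<eta> (c *s z) = c ^ k * \<eta> z" if z: "z \<in> ?R" and c: "c \<noteq> 0" for z c
  proof -
    have z': "c *s z \<in> ?R" using z c by (auto simp: eval3_homogeneous[OF H])
    \<comment> \<open>In degree 0, projecting \<open>bundle_point_scale\<close> to the plane yields
      invariance of \<open>proj_pt\<close> under scaling.\<close>
    have "bundle_point 0 (c *s z, 0) = bundle_point 0 (z, 0)" using bundle_point_scale[OF c, of 0 z 0] by simp
    then have "proj_pt (c *s z) = proj_pt z" by (metis bundle_proj_point)
    then have "bundle_point k (c *s z, \<eta> (c *s z)) = bundle_point k (z, \<eta> z)" using \<eta>[OF z] \<eta>[OF z'] by simp
    also have "\<dots> = bundle_point k (c *s z, c ^ k * \<eta> z)" using bundle_point_scale[OF c] by simp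
    finally show ?thesis using uniq z' by blast
  qed
  have cont: "continuous_on ?R \<eta>"
    unfolding continuous_on_def
  proof
    fix z0 assume z0: "z0 \<in> ?R"
    then obtain j where j: "z0 $ j \<noteq> 0" by (auto simp: vec_eq_iff)
    have "continuous_map (top_of_set ?R) (subtopology P2 (locus H)) proj_pt"
    proof (rule continuous_map_into_subtopology)
      show "continuous_map (top_of_set ?R) P2 proj_pt"
        using continuous_map_from_subtopology_mono[OF continuous_proj_pt, of ?R] by auto
    qed (use mem in auto)
    from continuous_map_compose[OF continuous_map_compose[OF this hc] continuous_fibre_coord[of k j]]
    have "continuous_on ?R (\<lambda>z. fibre_coord k j (h (proj_pt z)))" by (simp add: o_def)
    then have 1: "((\<lambda>z. fibre_coord k j (h (proj_pt z))) \<longlongrightarrow> fibre_coord k j (h (proj_pt z0))) (at z0 within ?R)"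
      using z0 unfolding continuous_on_def by blast
    have z: "((\<lambda>z. z $ j) \<longlongrightarrow> z0 $ j) (at z0 within ?R)" by (intro tendsto_intros)
    have "((\<lambda>z. fibre_coord k j (h (proj_pt z)) * hermitian z ^ k / cnj (z $ j) ^ k)
        \<longlongrightarrow> fibre_coord k j (h (proj_pt z0)) * hermitian z0 ^ k / cnj (z0 $ j) ^ k) (at z0 within ?R)"
      using j unfolding hermitian_def by (intro tendsto_intros 1) auto
    moreover have inv: "fibre_coord k j (h (proj_pt z)) * hermitian z ^ k / cnj (z $ j) ^ k = \<eta> z"
      if "z \<in> ?R" "z $ j \<noteq> 0" for z
      using that hermitian_nonzero[of z] unfolding \<eta>[OF that(1)] by (simp add: fibre_coord_point)
    moreover have "eventually (\<lambda>z. z \<in> ?R) (at z0 within ?R)" by (simp add: eventually_at_filter)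
    with tendsto_imp_eventually_ne[OF z j] have "eventually (\<lambda>z. fibre_coord k j (h (proj_pt z)) * hermitian z ^ k / cnj (z $ j) ^ k = \<eta> z) (at z0 within ?R)"
      by eventually_elim (rule inv)
    ultimately show "(\<eta> \<longlongrightarrow> \<eta> z0) (at z0 within ?R)"
      using inv[OF z0 j] Lim_transform_eventually by fastforce
  qed
  show ?thesis using that[of \<eta>] cont \<eta> \<eta>l \<eta>s by blast
qed

section \<open>Counting connected components\<close>

text \<open>A component contains each connected piece that it meets, so it is the component of a
  chosen point of some piece.\<close>

lemma card_components_le:
  assumes "finite I" "topspace Y = (\<Union>i\<in>I. K i)" "\<And>i. i \<in> I \<Longrightarrow> connectedin Y (K i)"
  shows "finite (connected_components_of Y)" "card (connected_components_of Y) \<le> card I"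
proof -
  define f where "f i = connected_component_of_set Y (SOME x. x \<in> K i)" for i
  have "connected_components_of Y \<subseteq> f ` I"
  proof
    fix C assume C: "C \<in> connected_components_of Y"
    then obtain x where x: "x \<in> C" using nonempty_connected_components_of by blast
    then have "x \<in> topspace Y" using connected_components_of_subset[OF C] by blast
    then obtain i where i: "i \<in> I" "x \<in> K i" using assms(2) by blast
    then have y: "(SOME x. x \<in> K i) \<in> K i" by (metis someI)
    have "K i \<subseteq> C" using x i by (intro connected_components_of_maximal[OF C assms(3)]) (auto simp: disjnt_def)
    then have yC: "(SOME x. x \<in> K i) \<in> C" using y by blast
    have "f i \<in> connected_components_of Y"
      unfolding f_def connected_component_in_connected_components_of
      using yC connected_components_of_subset[OF C] by blast
    moreover have "(SOME x. x \<in> K i) \<in> f i"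
      unfolding f_def using yC connected_components_of_subset[OF C] by (simp add: connected_component_of_refl subset_iff)
    ultimately have "C = f i"
      using C yC pairwise_disjoint_connected_components_of[of Y] unfolding pairwise_def disjnt_def by blast
    then show "C \<in> f ` I" using i by blast
  qed
  then show "finite (connected_components_of Y)" "card (connected_components_of Y) \<le> card I"
    using assms(1) by (auto intro: finite_subset finite_imageI card_mono[THEN le_trans] card_image_le surj_card_le)
qed

text \<open>Each piece is also closed, its complement being the union of the others, so the
  component of a point of it stays inside. Finiteness matters because \<open>card\<close> is 0 on
  infinite sets.\<close>

lemma card_components_ge:
  assumes fin: "finite (connected_components_of Y)" and cov: "topspace Y = (\<Union>i\<in>I. U i)"
    and op: "\<And>i. i \<in> I \<Longrightarrow> openin Y (U i)" and ne: "\<And>i. i \<in> I \<Longrightarrow> U i \<noteq> {}"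
    and dis: "\<And>i j. i \<in> I \<Longrightarrow> j \<in> I \<Longrightarrow> i \<noteq> j \<Longrightarrow> U i \<inter> U j = {}"
  shows "card I \<le> card (connected_components_of Y)"
proof -
  have "\<forall>i\<in>I. \<exists>x. x \<in> U i" using ne by blast
  then obtain x where x: "\<And>i. i \<in> I \<Longrightarrow> x i \<in> U i" by metis
  define f where "f i = connected_component_of_set Y (x i)" for i
  have xt: "x i \<in> topspace Y" if "i \<in> I" for i using x[OF that] cov that by blast
  have sub: "f i \<subseteq> U i" if i: "i \<in> I" for i
  proof -
    have "topspace Y - U i = (\<Union>j\<in>I - {i}. U j)" unfolding cov using dis i by blast
    moreover have "openin Y (\<Union>j\<in>I - {i}. U j)" using op by blast
    ultimately have "closedin Y (U i)" using op[OF i] by (simp add: closedin_def openin_subset)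
    from connectedin_clopen_cases[OF connectedin_connected_component_of this op[OF i], of "x i"]
    have "f i \<subseteq> U i \<or> disjnt (f i) (U i)" unfolding f_def .
    moreover have "x i \<in> f i" using xt[OF i] by (simp add: f_def connected_component_of_refl)
    ultimately show ?thesis using x[OF i] by (auto simp: disjnt_def)
  qed
  have "inj_on f I"
  proof (rule inj_onI)
    fix i j assume ij: "i \<in> I" "j \<in> I" "f i = f j"
    have "x i \<in> f i" using xt[OF ij(1)] by (simp add: f_def connected_component_of_refl)
    then have "x i \<in> U i \<inter> U j" using sub[OF ij(1)] sub[OF ij(2)] ij(3) by blast
    then show "i = j" using dis ij by blast
  qed
  moreover have "f ` I \<subseteq> connected_components_of Y"
    using xt by (auto simp: f_def connected_component_in_connected_components_of)
  ultimately show ?thesis using fin by (intro card_inj_on_le)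
qed

lemma (in cyclic_algebra) local_fraction_integral:
  "local_fraction n W \<tau> G H \<Longrightarrow> Fract G H \<in> integral_functions n W \<tau>"
  using local_integral[OF local_rational] zero_vanishing by simp

section \<open>The cover over the complement of the branch curve\<close>

locale cover_data = cyclic_algebra +
  fixes n :: nat and H Bp :: poly3 and e b :: nat
  assumes hF: "homogeneous (m * n) F" and hH: "homogeneous e H" and hB: "homogeneous b Bp"
    and F_zero: "\<And>z. eval3 F z = 0 \<Longrightarrow> eval3 Bp z = 0"
begin

abbreviation "S \<equiv> vcone H Bp"

definition E :: "((complex ^ 3) \<times> complex) set" where
  "E = {(z, s). z \<in> S \<and> s ^ m = eval3 F z}"

abbreviation "X \<equiv> normalization n W"

definition N0 where
  "N0 = {x \<in> topspace X. cyclic_cover_map x \<in> locus H - locus Bp}"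

text \<open>Parametrises the cover off the branch curve by the cone \<open>E\<close>; by
  \<open>character_unique\<close> the second component is the only possible one.\<close>

definition Phi where
  "Phi p = (bundle_point n p, psi n (fst p) (snd p))"

lemma S_F: "z \<in> S \<Longrightarrow> eval3 F z \<noteq> 0"
  using F_zero unfolding vcone_def by blast

lemma E_props:
  assumes "(z, s) \<in> E"
  shows "z \<noteq> 0" "eval3 F z \<noteq> 0" "s ^ m = eval3 F z" "s \<noteq> 0" "eval4 W z s = 0"
    "integral_character n W (bundle_point n (z, s)) (psi n z s)"
proof -
  show 1: "z \<noteq> 0" "eval3 F z \<noteq> 0" "s ^ m = eval3 F z"
    using assms S_F by (auto simp: E_def vcone_def)
  then show "s \<noteq> 0" using m by (auto simp: zero_power)
  show "eval4 W z s = 0" using 1 by (simp add: eval4_W)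
  show "integral_character n W (bundle_point n (z, s)) (psi n z s)" by (rule psi_character[OF hF 1(2,3)])
qed

lemma S_scale: "c \<noteq> 0 \<Longrightarrow> z \<in> S \<Longrightarrow> c *s z \<in> S"
  by (auto simp: vcone_def eval3_homogeneous[OF hH] eval3_homogeneous[OF hB])

lemma E_scale: "c \<noteq> 0 \<Longrightarrow> (z, s) \<in> E \<Longrightarrow> (c *s z, c ^ n * s) \<in> E"
  by (auto simp: E_def S_scale eval3_homogeneous[OF hF] power_mult_distrib power_mult[symmetric] mult.commute)

lemma hypersurface_point:
  assumes "z \<noteq> 0" shows "bundle_point n (z, s) \<in> hypersurface n W \<longleftrightarrow> s ^ m = eval3 F z"
proof -
  have W0: "eval4 W (c *s z) (c ^ n * s) = c ^ (m * n) * eval4 W z s" for c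
    by (simp add: eval4_W eval3_homogeneous[OF hF] power_mult_distrib power_mult[symmetric] right_diff_distrib mult.commute)
  have "bundle_point n (z, s) \<in> topspace (total_space n)" using assms by (auto simp: topspace_total_space)
  moreover have "(\<forall>(z', s') \<in> bundle_point n (z, s). eval4 W z' s' = 0) \<longleftrightarrow> eval4 W z s = 0"
  proof
    assume "\<forall>(z', s') \<in> bundle_point n (z, s). eval4 W z' s' = 0"
    then show "eval4 W z s = 0" using bundle_point_self[of z s n] by blast
  next
    assume "eval4 W z s = 0"
    then show "\<forall>(z', s') \<in> bundle_point n (z, s). eval4 W z' s' = 0"
      using W0 by (auto simp: bundle_point_mem)
  qed
  ultimately have "bundle_point n (z, s) \<in> hypersurface n W \<longleftrightarrow> eval4 W z s = 0"
    unfolding hypersurface_def by blast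
  then show ?thesis by (auto simp: eval4_W)
qed

lemma topspace_X: "topspace X = normalization_points n W"
proof -
  have "(\<tau>, \<psi>) \<in> normalization_points n W \<Longrightarrow> 0 \<in> integral_functions n W \<tau>" for \<tau> \<psi>
    by (rule vanishing_integral[OF zero_vanishing])
  then have "normalization_points n W = {(\<tau>, \<psi>) \<in> normalization_points n W. 0 \<in> integral_functions n W \<tau> \<and> \<psi> 0 \<in> UNIV}"
    by auto
  moreover have "0 \<in> rational_functions n W" by (rule vanishing_rational[OF zero_vanishing])
  ultimately show ?thesis unfolding normalization_def topology_generated_by_topspace by blast
qed

lemma X_basic_open:
  assumes "a \<in> rational_functions n W" "open V"
  shows "openin X {(\<tau>, \<psi>) \<in> normalization_points n W. a \<in> integral_functions n W \<tau> \<and> \<psi> a \<in> V}"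
  unfolding normalization_def using assms by (intro topology_generated_by_Basis) blast

lemma N0_point:
  assumes "x \<in> N0" obtains z s where "(z, s) \<in> E" "x = Phi (z, s)"
proof -
  obtain \<tau> \<psi> where x: "x = (\<tau>, \<psi>)" by (cases x)
  have h: "\<tau> \<in> hypersurface n W" "integral_character n W \<tau> \<psi>" "bundle_proj \<tau> \<in> locus H - locus Bp"
    using assms unfolding N0_def topspace_X normalization_points_def x cyclic_cover_map_def by auto
  then obtain z s where z: "z \<noteq> 0" "\<tau> = bundle_point n (z, s)"
    unfolding hypersurface_def topspace_total_space by auto
  have s: "s ^ m = eval3 F z" using h(1) unfolding z(2) hypersurface_point[OF z(1)] .
  have "eval3 H z = 0" "eval3 Bp z \<noteq> 0"
    using h(3) unfolding z(2) bundle_proj_point using proj_pt_locus[OF hH z(1)] proj_pt_locus[OF hB z(1)] by auto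
  then have zs: "(z, s) \<in> E" using z s by (simp add: E_def vcone_def)
  have "\<psi> = psi n z s" by (rule character_unique[OF hF E_props(2,3)[OF zs] h(2)[unfolded z(2)]])
  then show ?thesis using that[OF zs] by (simp add: x z(2) Phi_def)
qed

lemma Phi_N0:
  assumes "p \<in> E" shows "Phi p \<in> N0"
proof -
  obtain z s where p: "p = (z, s)" by (cases p)
  note P = E_props[OF assms[unfolded p]]
  have "Phi (z, s) \<in> normalization_points n W"
    unfolding normalization_points_def Phi_def using P by (simp add: hypersurface_point)
  moreover have "eval3 H z = 0" "eval3 Bp z \<noteq> 0" using assms by (auto simp: p E_def vcone_def)
  ultimately show ?thesis
    unfolding N0_def topspace_X cyclic_cover_map_def p Phi_def
    using proj_pt_locus[OF hH P(1)] proj_pt_locus[OF hB P(1)] by (simp add: bundle_proj_point)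
qed

text \<open>Near a given point an integral function is represented by one fraction
  \<open>G1 / H1\<close>, which stays regular with the right values as long as \<open>H1\<close> is
  nonzero. So regularity and continuity are questions about polynomials on \<open>E\<close>.\<close>

lemma Phi_continuous: "continuous_map (top_of_set E) X Phi"
  unfolding normalization_def continuous_on_generated_topo_iff
proof (intro conjI allI impI)
  fix U assume "U \<in> {{(\<tau>, \<psi>) \<in> normalization_points n W. a \<in> integral_functions n W \<tau> \<and> \<psi> a \<in> V} |a V.
                a \<in> rational_functions n W \<and> open V}"
  then obtain a V where a: "a \<in> rational_functions n W" "open V"
    and U: "U = {(\<tau>, \<psi>) \<in> normalization_points n W. a \<in> integral_functions n W \<tau> \<and> \<psi> a \<in> V}" by blast
  have np: "Phi p \<in> normalization_points n W" if "p \<in> E" for p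
    using Phi_N0[OF that] by (auto simp: N0_def topspace_X)
  show "openin (top_of_set E) (Phi -` U \<inter> topspace (top_of_set E))"
  proof (subst openin_subopen, intro ballI)
    fix p assume p: "p \<in> Phi -` U \<inter> topspace (top_of_set E)"
    obtain z0 s0 where p0: "p = (z0, s0)" by (cases p)
    have E0: "(z0, s0) \<in> E" using p by (simp add: p0)
    have i: "a \<in> integral_functions n W (bundle_point n (z0, s0))" "psi n z0 s0 a \<in> V"
      using p by (auto simp: p0 U Phi_def)
    obtain G1 H1 where G: "local_fraction n W (bundle_point n (z0, s0)) G1 H1" "a - Fract G1 H1 \<in> vanishing n W"
      using integral_local[OF hF E_props(2)[OF E0] i(1)] by blast
    define E' where "E' = {q \<in> E. eval4 H1 (fst q) (snd q) \<noteq> 0}"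
    have E'E: "openin (top_of_set E) E'"
    proof -
      have "continuous_on E (\<lambda>q. eval4 H1 (fst q) (snd q))" by (intro continuous_intros)
      from continuous_openin_preimage_gen[OF this open_Compl[OF closed_singleton[of 0]]]
      show ?thesis by (simp add: E'_def vimage_def Int_def)
    qed
    define T where "T = E' \<inter> (\<lambda>q. eval4 G1 (fst q) (snd q) / eval4 H1 (fst q) (snd q)) -` V"
    have "continuous_on E' (\<lambda>q. eval4 G1 (fst q) (snd q) / eval4 H1 (fst q) (snd q))"
      by (intro continuous_intros) (auto simp: E'_def)
    from continuous_openin_preimage_gen[OF this a(2)]
    have "openin (top_of_set E') T" by (simp add: T_def)
    then have TE: "openin (top_of_set E) T" using E'E openin_trans by blast
    have val: "a \<in> integral_functions n W (bundle_point n (z, s)) \<and> psi n z s a = eval4 G1 z s / eval4 H1 z s"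
      if zs: "(z, s) \<in> E'" for z s
    proof -
      have zE: "(z, s) \<in> E" using zs by (simp add: E'_def)
      have l: "local_fraction n W (bundle_point n (z, s)) G1 H1"
        using G(1) zs unfolding local_fraction_point E'_def by simp
      show ?thesis using local_integral[OF a(1) l G(2)] psi_eq[OF E_props(5)[OF zE] a(1) l G(2)] by simp
    qed
    have "(z0, s0) \<in> E'" using G(1) E0 unfolding local_fraction_point E'_def by simp
    then have "p \<in> T" using val[of z0 s0] i(2) by (simp add: T_def p0)
    moreover have "T \<subseteq> Phi -` U \<inter> topspace (top_of_set E)"
    proof
      fix q assume q: "q \<in> T"
      obtain z s where q': "q = (z, s)" by (cases q)
      have qE: "q \<in> E" using q by (simp add: T_def E'_def)
      have "(z, s) \<in> E'" using q by (simp add: T_def q')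
      from val[OF this] q show "q \<in> Phi -` U \<inter> topspace (top_of_set E)"
        using np[OF qE] qE by (simp add: U T_def q' Phi_def)
    qed
    ultimately show "\<exists>T. openin (top_of_set E) T \<and> p \<in> T \<and> T \<subseteq> Phi -` U \<inter> topspace (top_of_set E)"
      using TE by blast
  qed
next
  show "Phi ` topspace (top_of_set E) \<subseteq> \<Union> {{(\<tau>, \<psi>) \<in> normalization_points n W. a \<in> integral_functions n W \<tau> \<and> \<psi> a \<in> V} |a V.
                a \<in> rational_functions n W \<and> open V}"
    using Phi_N0 unfolding topology_generated_by_topspace[symmetric] normalization_def[symmetric] by (auto simp: N0_def)
qed

lemma Phi_continuous_N0: "continuous_map (top_of_set E) (subtopology X N0) Phi"
  using Phi_continuous Phi_N0 by (intro continuous_map_into_subtopology) auto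

section \<open>Affine charts and open pieces of the cover\<close>

definition coord :: "3 \<Rightarrow> poly3" where
  "coord i = (if i = 1 then X1 else if i = 2 then X2 else X3)"

lemma eval3_coord [simp]: "eval3 (coord i) z = z $ i"
  using exhaust_3[of i] by (auto simp: coord_def eval3_ev)

lemma homogeneous_coord: "homogeneous 1 (coord i)"
  using homogeneous_X by (simp add: coord_def)

lemma coord_nonzero: "coord i \<noteq> 0"
  by (auto simp: coord_def X1_def X2_def X3_def)

definition chart_fun :: "3 \<Rightarrow> 3 \<Rightarrow> poly4 fract" where
  "chart_fun j i = Fract [:coord i:] [:coord j:]"

definition chart_fibre :: "3 \<Rightarrow> poly4 fract" where
  "chart_fibre j = Fract (monom 1 1) [:coord j ^ n:]"

lemma coord_wh: "weighted_homogeneous n 1 [:coord i:]" "weighted_homogeneous n n [:coord j ^ n:]"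
  "weighted_homogeneous n n (monom 1 1)"
  using homogeneous_coord homogeneous_power[OF homogeneous_coord, of n j]
  by (auto intro!: weighted_homogeneous_const weighted_homogeneous_monom)

lemma chart_local:
  fixes z :: "complex ^ 3"
  assumes "z $ j \<noteq> 0"
  shows "local_fraction n W (bundle_point n (z, s)) [:coord i:] [:coord j:]"
    "local_fraction n W (bundle_point n (z, s)) (monom 1 1) [:coord j ^ n:]"
  unfolding local_fraction_point using coord_wh nzd_const coord_nonzero assms by auto

lemma chart_rational: "chart_fun j i \<in> rational_functions n W" "chart_fibre j \<in> rational_functions n W"
  unfolding chart_fun_def chart_fibre_def
  using rational_functionsI[OF coord_wh(1) coord_wh(1) nzd_const[OF coord_nonzero]]
    rational_functionsI[OF coord_wh(3) coord_wh(2) nzd_const] coord_nonzero by auto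

text \<open>Stated by regularity of functions, because the topology of the normalization is
  generated by their domains and values; by \<open>chart_iff\<close> it amounts to
  \<open>z $ j \<noteq> 0\<close> on the image of \<open>E\<close>.\<close>

definition chart :: "3 \<Rightarrow> (bundle_pt \<times> (poly4 fract \<Rightarrow> complex)) set" where
  "chart j = {x \<in> normalization_points n W. (\<forall>i. chart_fun j i \<in> integral_functions n W (fst x)) \<and>
     chart_fibre j \<in> integral_functions n W (fst x)}"

lemma openin_regular:
  assumes "a \<in> rational_functions n W"
  shows "openin X {x \<in> normalization_points n W. a \<in> integral_functions n W (fst x)}"
proof -
  have "{x \<in> normalization_points n W. a \<in> integral_functions n W (fst x)} =
      {(\<tau>, \<psi>) \<in> normalization_points n W. a \<in> integral_functions n W \<tau> \<and> \<psi> a \<in> UNIV}" by auto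
  then show ?thesis using X_basic_open[OF assms open_UNIV] by (simp only:)
qed

lemma openin_chart: "openin X (chart j)"
proof -
  have "chart j = (\<Inter>i\<in>UNIV. {x \<in> normalization_points n W. chart_fun j i \<in> integral_functions n W (fst x)}) \<inter>
     {x \<in> normalization_points n W. chart_fibre j \<in> integral_functions n W (fst x)}"
    by (auto simp: chart_def)
  also have "openin X \<dots>"
    by (intro openin_Int openin_Inter openin_regular) (auto intro: openin_regular chart_rational)
  finally show ?thesis .
qed

lemma chart_value:
  fixes z :: "complex ^ 3"
  assumes "integral_character n W (bundle_point n (z, s)) \<psi>" "z $ j \<noteq> 0"
  shows "\<psi> (chart_fun j i) = z $ i / z $ j" "\<psi> (chart_fibre j) = s / (z $ j) ^ n"
proof -
  have "\<psi> (Fract G H) = eval4 G z s / eval4 H z s" if "local_fraction n W (bundle_point n (z, s)) G H" for G H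
    using assms(1) that bundle_point_self[of z s n] unfolding integral_character_def by blast
  from this[OF chart_local(1)[of z j s i]] this[OF chart_local(2)[of z j s]] assms(2)
  show "\<psi> (chart_fun j i) = z $ i / z $ j" "\<psi> (chart_fibre j) = s / (z $ j) ^ n"
    by (auto simp: chart_fun_def chart_fibre_def)
qed

text \<open>If \<open>z $ j = 0\<close>, a regular \<open>chart_fun j i\<close> with
  \<open>z $ i \<noteq> 0\<close> would be inverse to a function with value 0.\<close>

lemma chart_iff:
  assumes "(z, s) \<in> E" shows "Phi (z, s) \<in> chart j \<longleftrightarrow> z $ j \<noteq> 0"
proof
  note c = E_props(6)[OF assms]
  assume "Phi (z, s) \<in> chart j"
  then have reg: "\<And>i. chart_fun j i \<in> integral_functions n W (bundle_point n (z, s))"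
    by (auto simp: chart_def Phi_def)
  show "z $ j \<noteq> 0"
  proof
    assume z0: "z $ j = 0"
    obtain i where i: "z $ i \<noteq> 0" using E_props(1)[OF assms] by (auto simp: vec_eq_iff)
    have l: "chart_fun i j \<in> integral_functions n W (bundle_point n (z, s))"
      unfolding chart_fun_def
      by (rule local_fraction_integral[OF chart_local(1)[OF i]])
    have "psi n z s (chart_fun j i * chart_fun i j) = psi n z s (chart_fun j i) * psi n z s (chart_fun i j)"
      using c reg l unfolding integral_character_def by blast
    moreover have "psi n z s (chart_fun i j) = 0" using chart_value(1)[OF c i] z0 by simp
    moreover have "chart_fun j i * chart_fun i j = chart_fun i i"
      using coord_nonzero by (simp add: chart_fun_def eq_fract mult.commute)
    moreover have "psi n z s (chart_fun i i) = 1" using chart_value(1)[OF c i] i by simp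
    ultimately show False by simp
  qed
next
  assume z: "z $ j \<noteq> 0"
  have l: "chart_fun j i \<in> integral_functions n W (bundle_point n (z, s))" for i
    unfolding chart_fun_def
    by (rule local_fraction_integral[OF chart_local(1)[OF z]])
  have "chart_fibre j \<in> integral_functions n W (bundle_point n (z, s))"
    unfolding chart_fibre_def
    by (rule local_fraction_integral[OF chart_local(2)[OF z]])
  moreover have "Phi (z, s) \<in> normalization_points n W" using Phi_N0[OF assms] by (simp add: N0_def topspace_X)
  ultimately show "Phi (z, s) \<in> chart j" using l by (simp add: chart_def Phi_def)
qed

lemma continuous_regular:
  assumes "a \<in> rational_functions n W" "\<And>x. x \<in> D \<Longrightarrow> x \<in> normalization_points n W \<and> a \<in> integral_functions n W (fst x)"
  shows "continuous_map (subtopology X D) euclidean (\<lambda>x. snd x a)"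
  unfolding continuous_map_def
proof (intro conjI allI impI)
  fix V :: "complex set" assume "openin euclidean V"
  then have V: "open V" by simp
  have "{x \<in> topspace (subtopology X D). snd x a \<in> V}
     = {x \<in> normalization_points n W. a \<in> integral_functions n W (fst x) \<and> snd x a \<in> V} \<inter> D"
    using assms(2) by (auto simp: topspace_X)
  then show "openin (subtopology X D) {x \<in> topspace (subtopology X D). snd x a \<in> V}"
    using X_basic_open[OF assms(1) V] by (auto simp: openin_subtopology case_prod_beta)
qed auto

text \<open>On a chart, the normalised point and fibre value are values of regular functions, so the
  scaling-invariant \<open>s ^ \<mu> / \<eta> z\<close> is continuous for the topology of the
  normalization. It takes finitely many values, hence its level sets are open.\<close>

lemma fibrewise_open:
  assumes \<eta>: "continuous_on S \<eta>" "\<And>z. z \<in> S \<Longrightarrow> \<eta> z \<noteq> 0"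
    and sc: "\<And>c z. c \<noteq> 0 \<Longrightarrow> z \<in> S \<Longrightarrow> \<eta> (c *s z) = c ^ (\<mu> * n) * \<eta> z"
    and fin: "finite \<Omega>" and val: "\<And>z s. (z, s) \<in> E \<Longrightarrow> s ^ \<mu> / \<eta> z \<in> \<Omega>"
  shows "openin (subtopology X N0) {Phi (z, s) | z s. (z, s) \<in> E \<and> s ^ \<mu> / \<eta> z = \<omega>}"
proof -
  define R where "R = {q :: complex \<times> complex \<times> complex \<times> complex.
     v3 (fst q) (fst (snd q)) (fst (snd (snd q))) \<in> S}"
  define g where "g q = snd (snd (snd q)) ^ \<mu> / \<eta> (v3 (fst q) (fst (snd q)) (fst (snd (snd q))))"
    for q :: "complex \<times> complex \<times> complex \<times> complex"
  define V where "V = - (\<Omega> - {\<omega>})"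
  have gR: "continuous_on R g"
    unfolding g_def
    by (intro continuous_intros continuous_on_compose2[OF \<eta>(1)] continuous_on_v3) (auto simp: R_def \<eta>(2))
  have V: "open V" unfolding V_def using fin by (intro open_Compl finite_imp_closed) auto
  have piece: "openin (subtopology X N0) {Phi (z, s) | z s. (z, s) \<in> E \<and> s ^ \<mu> / \<eta> z = \<omega> \<and> z $ j \<noteq> 0}" for j
  proof -
    define p where "p x = (snd x (chart_fun j 1), snd x (chart_fun j 2), snd x (chart_fun j 3), snd x (chart_fibre j))"
      for x :: "bundle_pt \<times> (poly4 fract \<Rightarrow> complex)"
    let ?Y = "subtopology X (N0 \<inter> chart j)"
    have pc: "continuous_map ?Y euclidean p"
      unfolding p_def prod_topology_euclidean[symmetric]
      by (intro continuous_map_pairedI continuous_regular chart_rational) (auto simp: chart_def)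
    have pv: "p (Phi (z, s)) = (z $ 1 / z $ j, z $ 2 / z $ j, z $ 3 / z $ j, s / (z $ j) ^ n)"
      "p (Phi (z, s)) \<in> R" "g (p (Phi (z, s))) = s ^ \<mu> / \<eta> z" if zs: "(z, s) \<in> E" "z $ j \<noteq> 0" for z s
    proof -
      show p: "p (Phi (z, s)) = (z $ 1 / z $ j, z $ 2 / z $ j, z $ 3 / z $ j, s / (z $ j) ^ n)"
        using chart_value[OF E_props(6)[OF zs(1)] zs(2)] by (simp add: p_def Phi_def)
      have zS: "z \<in> S" using zs by (simp add: E_def)
      have v: "v3 (z $ 1 / z $ j) (z $ 2 / z $ j) (z $ 3 / z $ j) = (1 / z $ j) *s z"
        by (simp add: vec_eq_iff forall_3)
      show "p (Phi (z, s)) \<in> R" unfolding p R_def using S_scale[OF _ zS, of "1 / z $ j"] zs(2) by (simp add: v)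
      show "g (p (Phi (z, s))) = s ^ \<mu> / \<eta> z"
        unfolding p g_def using zs(2) sc[OF _ zS, of "1 / z $ j"]
        by (simp add: v power_divide power_mult[symmetric] mult.commute)
    qed
    have pt: "\<exists>z s. (z, s) \<in> E \<and> z $ j \<noteq> 0 \<and> x = Phi (z, s)" if x: "x \<in> N0 \<inter> chart j" for x
    proof -
      obtain z s where "(z, s) \<in> E" "x = Phi (z, s)" using x N0_point by blast
      then show ?thesis using chart_iff x by blast
    qed
    have ts: "topspace ?Y = N0 \<inter> chart j" by (auto simp: N0_def)
    have "continuous_map ?Y (top_of_set R) p"
      by (rule continuous_map_into_subtopology[OF pc]) (use pt pv(2) in \<open>unfold ts, blast\<close>)
    from continuous_map_compose[OF this, of euclidean g] gR have "continuous_map ?Y euclidean (g \<circ> p)" by simp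
    then have "openin ?Y {x \<in> topspace ?Y. (g \<circ> p) x \<in> V}" using V unfolding continuous_map_def by auto
    also have "{x \<in> topspace ?Y. (g \<circ> p) x \<in> V} = {Phi (z, s) | z s. (z, s) \<in> E \<and> s ^ \<mu> / \<eta> z = \<omega> \<and> z $ j \<noteq> 0}" (is "?A = ?B")
    proof
      show "?A \<subseteq> ?B"
      proof
        fix x assume x: "x \<in> ?A"
        then obtain z s where zs: "(z, s) \<in> E" "z $ j \<noteq> 0" "x = Phi (z, s)" using pt unfolding ts by blast
        then have "s ^ \<mu> / \<eta> z \<in> V" using x pv(3)[OF zs(1,2)] by simp
        then have "s ^ \<mu> / \<eta> z = \<omega>" using val[OF zs(1)] by (auto simp: V_def)
        with zs show "x \<in> ?B" by blast
      qed
      show "?B \<subseteq> ?A"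
      proof
        fix x assume "x \<in> ?B"
        then obtain z s where zs: "(z, s) \<in> E" "s ^ \<mu> / \<eta> z = \<omega>" "z $ j \<noteq> 0" "x = Phi (z, s)" by blast
        then show "x \<in> ?A" unfolding ts using chart_iff[OF zs(1)] Phi_N0[OF zs(1)] pv(3)[OF zs(1,3)]
          by (simp add: V_def)
      qed
    qed
    finally have o1: "openin ?Y {Phi (z, s) | z s. (z, s) \<in> E \<and> s ^ \<mu> / \<eta> z = \<omega> \<and> z $ j \<noteq> 0}" .
    have o2: "openin (subtopology X N0) (N0 \<inter> chart j)"
      using openin_chart by (auto simp: openin_subtopology)
    have "?Y = subtopology (subtopology X N0) (N0 \<inter> chart j)"
      by (simp add: subtopology_subtopology)
    from openin_trans_full[OF o1[unfolded this] o2] show ?thesis .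
  qed
  have "{Phi (z, s) | z s. (z, s) \<in> E \<and> s ^ \<mu> / \<eta> z = \<omega>}
      = (\<Union>j\<in>UNIV. {Phi (z, s) | z s. (z, s) \<in> E \<and> s ^ \<mu> / \<eta> z = \<omega> \<and> z $ j \<noteq> 0})"
  proof -
    have "\<exists>j::3. z $ j \<noteq> 0" if "(z, s) \<in> E" for z s
      using E_props(1)[OF that] by (auto simp: vec_eq_iff)
    then show ?thesis by blast
  qed
  then show ?thesis using piece by (simp only:) (intro openin_Union, blast)
qed

end

section \<open>Sheets of the cover\<close>

context cover_data
begin

text \<open>The principal logarithm is continuous near 1, which gives continuity of \<open>r\<close>
  at \<open>z0\<close>; the power identity holds on all of \<open>S\<close> regardless of branch
  cuts.\<close>

lemma local_root:
  assumes "z0 \<in> S"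
  obtains r where "(r \<longlongrightarrow> 1) (at z0 within S)" "r z0 = 1"
    "\<And>z. z \<in> S \<Longrightarrow> r z ^ m = eval3 F z / eval3 F z0" "\<And>z. r z \<noteq> 0"
proof -
  define r where "r z = exp (Ln (eval3 F z / eval3 F z0) / of_nat m)" for z
  have F0: "eval3 F z0 \<noteq> 0" using S_F[OF assms] .
  have "continuous_on S (\<lambda>z. eval3 F z / eval3 F z0)" using F0 by (intro continuous_intros) auto
  then have 1: "((\<lambda>z. eval3 F z / eval3 F z0) \<longlongrightarrow> 1) (at z0 within S)"
    using assms F0 unfolding continuous_on_def by fastforce
  have "(r \<longlongrightarrow> exp (Ln 1 / of_nat m)) (at z0 within S)"
    unfolding r_def by (rule tendsto_exp, rule tendsto_divide[OF tendsto_Ln[OF 1] tendsto_const]) (use m in auto)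
  moreover have "r z ^ m = eval3 F z / eval3 F z0" if "z \<in> S" for z
  proof -
    have "r z ^ m = exp (of_nat m * (Ln (eval3 F z / eval3 F z0) / of_nat m))"
      unfolding r_def by (rule exp_of_nat_mult[symmetric])
    also have "\<dots> = eval3 F z / eval3 F z0" using S_F[OF that] F0 m by simp
    finally show ?thesis .
  qed
  moreover have "r z0 = 1" using F0 by (simp add: r_def)
  moreover have "r z \<noteq> 0" for z by (simp add: r_def)
  ultimately show ?thesis using that by simp
qed

lemma E_root:
  assumes "r ^ m = eval3 F z / eval3 F z0" "z \<in> S" "(z0, s) \<in> E"
  shows "(z, s * r) \<in> E"
  using assms E_props[OF assms(3)] by (auto simp: E_def power_mult_distrib)

lemma eventually_in_open:
  assumes U: "openin (top_of_set E) U" "(z0, s) \<in> U" and r: "(r \<longlongrightarrow> 1) (at z0 within S)"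
    "\<And>z. z \<in> S \<Longrightarrow> r z ^ m = eval3 F z / eval3 F z0"
  shows "eventually (\<lambda>z. (z, s * r z) \<in> U) (at z0 within S)"
proof -
  obtain T where T: "open T" "U = E \<inter> T" using U(1) by (auto simp: openin_open)
  have sE: "(z0, s) \<in> E" using U T by auto
  have "((\<lambda>z. (z, s * r z)) \<longlongrightarrow> (z0, s * 1)) (at z0 within S)"
    by (intro tendsto_intros r)
  then have "eventually (\<lambda>z. (z, s * r z) \<in> T) (at z0 within S)"
    using topological_tendstoD T U(2) by fastforce
  moreover have "eventually (\<lambda>z. z \<in> S) (at z0 within S)" by (simp add: eventually_at_filter)
  ultimately show ?thesis
    by eventually_elim (use E_root[OF r(2) _ sE] T in auto)
qed

definition clopen :: "((complex ^ 3) \<times> complex) set \<Rightarrow> bool" where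
  "clopen K \<longleftrightarrow> openin (top_of_set E) K \<and> closedin (top_of_set E) K"

definition sheets :: "((complex ^ 3) \<times> complex) set \<Rightarrow> complex ^ 3 \<Rightarrow> nat" where
  "sheets K z = card {s. (z, s) \<in> K}"

lemma clopen_subset: "clopen K \<Longrightarrow> K \<subseteq> E"
  unfolding clopen_def by (auto dest: openin_imp_subset)

lemma clopen_Int: "clopen K \<Longrightarrow> clopen L \<Longrightarrow> clopen (K \<inter> L)"
  unfolding clopen_def by auto

lemma clopen_E: "clopen E"
  unfolding clopen_def by auto

lemma finite_fibre: "clopen K \<Longrightarrow> finite {s. (z, s) \<in> K}"
  by (rule finite_subset[OF _ finite_nth_roots[OF m, of "eval3 F z"]]) (use clopen_subset in \<open>auto simp: E_def\<close>)

text \<open>Multiplication by \<open>r z\<close> carries the fibre over \<open>z0\<close> to that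
  over \<open>z\<close>. As \<open>K\<close> and its complement are both open in \<open>E\<close>,
  it preserves membership in \<open>K\<close> for \<open>z\<close> near \<open>z0\<close>.\<close>

lemma sheets_locally_constant:
  assumes K: "clopen K" and z0: "z0 \<in> S"
  shows "eventually (\<lambda>z. sheets K z0 = sheets K z) (at z0 within S)"
proof -
  obtain r where r: "(r \<longlongrightarrow> 1) (at z0 within S)" "r z0 = 1"
    "\<And>z. z \<in> S \<Longrightarrow> r z ^ m = eval3 F z / eval3 F z0" "\<And>z. r z \<noteq> 0"
    using local_root[OF z0] by blast
  have "eventually (\<lambda>z. (z, s * r z) \<in> K \<longleftrightarrow> (z0, s) \<in> K) (at z0 within S)" if s: "s ^ m = eval3 F z0" for s
  proof (cases "(z0, s) \<in> K")
    case True
    have "eventually (\<lambda>z. (z, s * r z) \<in> K) (at z0 within S)"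
      using K True r(1,3) unfolding clopen_def by (intro eventually_in_open) auto
    then show ?thesis by eventually_elim (simp add: True)
  next
    case False
    have "openin (top_of_set E) (E - K)" using K unfolding clopen_def by (auto intro: openin_diff)
    moreover have "(z0, s) \<in> E - K" using s z0 False by (simp add: E_def)
    ultimately have "eventually (\<lambda>z. (z, s * r z) \<in> E - K) (at z0 within S)"
      using r(1,3) by (intro eventually_in_open) auto
    then show ?thesis by eventually_elim (simp add: False)
  qed
  then have "eventually (\<lambda>z. \<forall>s\<in>{s. s ^ m = eval3 F z0}. (z, s * r z) \<in> K \<longleftrightarrow> (z0, s) \<in> K) (at z0 within S)"
    using finite_nth_roots[OF m] by (intro eventually_ball_finite) auto
  moreover have "eventually (\<lambda>z. z \<in> S) (at z0 within S)" by (simp add: eventually_at_filter)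
  ultimately show ?thesis
  proof eventually_elim
    case (elim z)
    have "{s. (z, s) \<in> K} = (\<lambda>s. s * r z) ` {s. (z0, s) \<in> K}"
    proof
      show "(\<lambda>s. s * r z) ` {s. (z0, s) \<in> K} \<subseteq> {s. (z, s) \<in> K}"
        using elim clopen_subset[OF K] by (auto simp: E_def)
      show "{s. (z, s) \<in> K} \<subseteq> (\<lambda>s. s * r z) ` {s. (z0, s) \<in> K}"
      proof safe
        fix s assume s: "(z, s) \<in> K"
        then have sm: "s ^ m = eval3 F z" using clopen_subset[OF K] by (auto simp: E_def)
        have "(s / r z) ^ m = eval3 F z0"
          using r(3)[OF elim(2)] sm S_F[OF elim(2)] S_F[OF z0] by (simp add: power_divide)
        then have "(z0, s / r z) \<in> K" using elim(1) s r(4)[of z] by auto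
        then show "s \<in> (\<lambda>s. s * r z) ` {s. (z0, s) \<in> K}" using r(4)[of z] by (intro image_eqI[of _ _ "s / r z"]) auto
      qed
    qed
    moreover have "inj_on (\<lambda>s. s * r z) {s. (z0, s) \<in> K}" using r(4)[of z] by (auto intro: inj_onI)
    ultimately show ?case unfolding sheets_def by (simp add: card_image)
  qed
qed

end

locale connected_cover_data = cover_data +
  assumes S_connected: "connected S" and S_nonempty: "S \<noteq> {}"
begin

lemma sheets_constant: "clopen K \<Longrightarrow> z \<in> S \<Longrightarrow> z' \<in> S \<Longrightarrow> sheets K z = sheets K z'"
  using sheets_locally_constant by (intro connected_local_const[OF S_connected]) auto

lemma sheets_pos:
  assumes K: "clopen K" "K \<noteq> {}" and z: "z \<in> S" shows "sheets K z > 0"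
proof -
  obtain w s where ws: "(w, s) \<in> K" using K(2) by auto
  then have "w \<in> S" using clopen_subset[OF K(1)] by (auto simp: E_def)
  moreover have "sheets K w > 0" unfolding sheets_def using finite_fibre[OF K(1)] ws by (auto simp: card_gt_0_iff)
  ultimately show ?thesis using sheets_constant[OF K(1)] z by metis
qed

lemma clopen_translate:
  assumes w: "w ^ m = 1" and K: "clopen K"
  shows "clopen (E \<inter> (\<lambda>p. (fst p, w * snd p)) -` K)"
proof -
  have c: "continuous_on E (\<lambda>p. (fst p, w * snd p))" by (intro continuous_intros)
  have f: "(\<lambda>p. (fst p, w * snd p)) \<in> E \<rightarrow> E" using w by (auto simp: E_def power_mult_distrib)
  have "openin (top_of_set E) (E - K)" "openin (top_of_set E) K"
    using K unfolding clopen_def by (auto intro: openin_diff)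
  then have o: "openin (top_of_set E) (E \<inter> (\<lambda>p. (fst p, w * snd p)) -` (E - K))"
    "openin (top_of_set E) (E \<inter> (\<lambda>p. (fst p, w * snd p)) -` K)"
    by (auto intro: continuous_openin_preimage[OF c f])
  have "E \<inter> (\<lambda>p. (fst p, w * snd p)) -` (E - K) = E - (E \<inter> (\<lambda>p. (fst p, w * snd p)) -` K)"
    using f by blast
  with o show ?thesis unfolding clopen_def closedin_def by simp
qed

text \<open>
  A minimal sheet \<open>K\<close>, with \<open>\<mu>\<close> points in each fibre, is stabilised by exactly the \<open>\<mu>\<close>-th roots
  of unity, so that \<open>s^\<mu>\<close> is a function of the base point on \<open>K\<close>.
\<close>

lemma minimal_sheet:
  obtains \<mu> l h where "m = \<mu> * l" "continuous_on S h" "\<And>z. z \<in> S \<Longrightarrow> h z ^ l = eval3 F z"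
    "\<And>c z. c \<noteq> 0 \<Longrightarrow> z \<in> S \<Longrightarrow> h (c *s z) = c ^ (\<mu> * n) * h z"
    "connected {(z, s). (z, s) \<in> E \<and> s ^ \<mu> = h z}"
proof -
  obtain z1 where z1: "z1 \<in> S" using S_nonempty by blast
  have "card {s. s ^ m = eval3 F z1} = m" using S_F[OF z1] m by (rule card_nth_roots)
  then have "{s. s ^ m = eval3 F z1} \<noteq> {}" using m by (metis card.empty not_gr_zero)
  then have "E \<noteq> {}" using z1 by (auto simp: E_def)
  then have "clopen E \<and> E \<noteq> {}" using clopen_E by blast
  \<comment> \<open>Minimal fibre size yields a nonempty clopen set with no smaller nonempty clopen
    subset, hence a connected one, without appeal to local connectedness.\<close>
  from ex_has_least_nat[of "\<lambda>K. clopen K \<and> K \<noteq> {}", OF this, of "\<lambda>K. sheets K z1"]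
  obtain K where K: "clopen K" "K \<noteq> {}"
    and min: "\<And>L. clopen L \<Longrightarrow> L \<noteq> {} \<Longrightarrow> sheets K z1 \<le> sheets L z1" by blast
  have KE: "K \<subseteq> E" by (rule clopen_subset[OF K(1)])
  have sub: "L = K" if L: "clopen L" "L \<noteq> {}" "L \<subseteq> K" for L
  proof -
    have "{s. (z, s) \<in> L} = {s. (z, s) \<in> K}" if z: "z \<in> S" for z
    proof (rule card_seteq)
      show "finite {s. (z, s) \<in> K}" by (rule finite_fibre[OF K(1)])
      show "{s. (z, s) \<in> L} \<subseteq> {s. (z, s) \<in> K}" using L(3) by auto
      show "card {s. (z, s) \<in> K} \<le> card {s. (z, s) \<in> L}"
        using min[OF L(1,2)] sheets_constant[OF K(1) z z1] sheets_constant[OF L(1) z z1] unfolding sheets_def by simp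
    qed
    then have "(z, s) \<in> L" if "(z, s) \<in> K" for z s
      using that KE by (auto simp: E_def)
    with L(3) show ?thesis by auto
  qed
  define \<mu> where "\<mu> = sheets K z1"
  have \<mu>0: "\<mu> > 0" unfolding \<mu>_def by (rule sheets_pos[OF K z1])
  have cK: "card {s. (z, s) \<in> K} = \<mu>" if "z \<in> S" for z
    using sheets_constant[OF K(1) that z1] by (simp add: \<mu>_def sheets_def)
  define G where "G = {w. w ^ m = 1 \<and> (\<forall>z s. (z, s) \<in> K \<longrightarrow> (z, w * s) \<in> K)}"
  have finG: "finite G" by (rule finite_subset[OF _ finite_units]) (auto simp: G_def)
  \<comment> \<open>The part of \<open>K\<close> that multiplication by the ratio keeps in
    \<open>K\<close> is clopen and nonempty, so it is all of \<open>K\<close> by minimality.\<close>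
  have ratio: "s' / s \<in> G" if s: "(z, s) \<in> K" "(z, s') \<in> K" for z s s'
  proof -
    define w where "w = s' / s"
    have P: "s ^ m = eval3 F z" "s' ^ m = eval3 F z" "eval3 F z \<noteq> 0" "s \<noteq> 0"
      using E_props[of z s] E_props[of z s'] s KE by auto
    have w: "w ^ m = 1" using P by (simp add: w_def power_divide)
    define L where "L = K \<inter> (E \<inter> (\<lambda>p. (fst p, w * snd p)) -` K)"
    have "clopen L" unfolding L_def by (rule clopen_Int[OF K(1) clopen_translate[OF w K(1)]])
    moreover have "(z, s) \<in> L" using s KE P(4) by (auto simp: L_def w_def)
    moreover have "L \<subseteq> K" by (auto simp: L_def)
    ultimately have "L = K" using sub[of L] by blast
    have "(a, w * t) \<in> K" if "(a, t) \<in> K" for a t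
    proof -
      have "(a, t) \<in> L" using that \<open>L = K\<close> by simp
      then show ?thesis unfolding L_def by simp
    qed
    then show ?thesis unfolding w_def[symmetric] G_def using w by blast
  qed
  have fibre: "{s'. (z, s') \<in> K} = (\<lambda>w. w * s) ` G" "s \<noteq> 0" if s: "(z, s) \<in> K" for z s
  proof -
    show s0: "s \<noteq> 0" using E_props(4)[of z s] s KE by blast
    show "{s'. (z, s') \<in> K} = (\<lambda>w. w * s) ` G"
    proof
      show "(\<lambda>w. w * s) ` G \<subseteq> {s'. (z, s') \<in> K}" using s by (auto simp: G_def)
      show "{s'. (z, s') \<in> K} \<subseteq> (\<lambda>w. w * s) ` G"
      proof
        fix s' assume s': "s' \<in> {s'. (z, s') \<in> K}"
        then have "s' / s \<in> G" using ratio[OF s] by simp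
        then show "s' \<in> (\<lambda>w. w * s) ` G" using s0 by (intro image_eqI[of _ _ "s' / s"]) auto
      qed
    qed
  qed
  have ne: "\<exists>s. (z, s) \<in> K" if "z \<in> S" for z
  proof -
    have "{s. (z, s) \<in> K} \<noteq> {}" using cK[OF that] \<mu>0 by (metis card.empty not_gr_zero)
    then show ?thesis by blast
  qed
  have cG: "card G = \<mu>"
  proof -
    obtain s where s: "(z1, s) \<in> K" using ne[OF z1] by blast
    have "inj_on (\<lambda>w. w * s) G" using fibre(2)[OF s] by (auto intro: inj_onI)
    then show ?thesis using cK[OF z1] unfolding fibre(1)[OF s] by (simp add: card_image)
  qed
  \<comment> \<open>Lagrange's theorem for the finite group \<open>G\<close>: multiplication by
    \<open>w\<close> permutes it, and comparing the products of all elements gives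
    \<open>w ^ \<mu> = 1\<close>.\<close>
  have Gpow: "w ^ \<mu> = 1" if w: "w \<in> G" for w
  proof -
    have w0: "w \<noteq> 0" using w m by (auto simp: G_def zero_power)
    have "(\<lambda>v. w * v) ` G \<subseteq> G" using w by (auto simp: G_def power_mult_distrib mult.assoc)
    moreover have inj: "inj_on (\<lambda>v. w * v) G" using w0 by (auto intro: inj_onI)
    ultimately have "(\<lambda>v. w * v) ` G = G" using finG by (intro card_subset_eq) (auto simp: card_image)
    then have "\<Prod>G = (\<Prod>v\<in>G. w * v)" using prod.reindex[OF inj, of "\<lambda>v. v"] by simp
    also have "\<dots> = w ^ \<mu> * \<Prod>G" by (simp add: prod.distrib cG)
    finally have "(1 - w ^ \<mu>) * \<Prod>G = 0" by (simp add: algebra_simps)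
    moreover have "\<Prod>G \<noteq> 0" using finG m by (auto simp: G_def zero_power)
    ultimately show ?thesis by simp
  qed
  have G: "G = {w. w ^ \<mu> = 1}"
  proof (rule card_subset_eq)
    show "finite {w :: complex. w ^ \<mu> = 1}" using \<mu>0 by (intro finite_roots_unity) auto
    show "G \<subseteq> {w. w ^ \<mu> = 1}" using Gpow by auto
    show "card G = card {w :: complex. w ^ \<mu> = 1}" using cG \<mu>0 by (simp add: card_roots_unity_eq)
  qed
  \<comment> \<open>All \<open>\<mu>\<close>-th roots of unity lie in \<open>G\<close>, hence are
    \<open>m\<close>-th roots of unity.\<close>
  have "\<mu> dvd m"
  proof (rule ccontr)
    assume "\<not> \<mu> dvd m"
    then obtain w :: complex where "w ^ \<mu> = 1" "w ^ m \<noteq> 1" using roots_of_unity_separate[OF \<mu>0] by blast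
    then show False using G unfolding G_def by blast
  qed
  then obtain l where l: "m = \<mu> * l" by (rule dvdE)
  \<comment> \<open>Independent of the choice: points of \<open>K\<close> over \<open>z\<close>
    differ by elements of \<open>G\<close>, whose \<open>\<mu>\<close>-th powers are 1.\<close>
  define h where "h z = (SOME s. (z, s) \<in> K) ^ \<mu>" for z
  have h: "h z = s ^ \<mu>" if s: "(z, s) \<in> K" for z s
  proof -
    have "(z, SOME s. (z, s) \<in> K) \<in> K" using s by (rule someI)
    then obtain w where w: "w \<in> G" "(SOME s. (z, s) \<in> K) = w * s" using fibre(1)[OF s] by blast
    then show ?thesis using Gpow[OF w(1)] by (simp add: h_def power_mult_distrib)
  qed
  have Keq: "K = {(z, s). (z, s) \<in> E \<and> s ^ \<mu> = h z}"
  proof (intro set_eqI iffI)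
    fix p assume "p \<in> K" then show "p \<in> {(z, s). (z, s) \<in> E \<and> s ^ \<mu> = h z}" using h KE by (cases p) auto
  next
    fix p assume p: "p \<in> {(z, s). (z, s) \<in> E \<and> s ^ \<mu> = h z}"
    obtain z s where zs: "p = (z, s)" by (cases p)
    have E: "(z, s) \<in> E" "s ^ \<mu> = h z" using p by (auto simp: zs)
    then obtain s1 where s1: "(z, s1) \<in> K" using ne[of z] by (auto simp: E_def)
    have "(s / s1) ^ \<mu> = 1" using E(2) h[OF s1] fibre(2)[OF s1] by (simp add: power_divide)
    then have "(z, (s / s1) * s1) \<in> K" using s1 G unfolding G_def by blast
    then show "p \<in> K" using fibre(2)[OF s1] by (simp add: zs)
  qed
  have conn: "connected K"
    unfolding connected_clopen
  proof (intro allI impI)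
    fix T assume T: "openin (top_of_set K) T \<and> closedin (top_of_set K) T"
    have "clopen T"
      using T K(1) openin_trans closedin_trans unfolding clopen_def by blast
    moreover have "T \<subseteq> K" using T by (auto dest: openin_imp_subset)
    ultimately show "T = {} \<or> T = K" using sub by blast
  qed
  have cont: "continuous_on S h"
    unfolding continuous_on_def
  proof
    fix z0 assume z0: "z0 \<in> S"
    obtain r where r: "(r \<longlongrightarrow> 1) (at z0 within S)" "r z0 = 1"
      "\<And>z. z \<in> S \<Longrightarrow> r z ^ m = eval3 F z / eval3 F z0" "\<And>z. r z \<noteq> 0"
      using local_root[OF z0] by blast
    obtain s where s: "(z0, s) \<in> K" using ne[OF z0] by blast
    have "eventually (\<lambda>z. (z, s * r z) \<in> K) (at z0 within S)"
      using K(1) s r(1,3) unfolding clopen_def by (intro eventually_in_open) auto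
    then have "eventually (\<lambda>z. (s * r z) ^ \<mu> = h z) (at z0 within S)"
      by eventually_elim (simp add: h)
    moreover have "((\<lambda>z. (s * r z) ^ \<mu>) \<longlongrightarrow> (s * 1) ^ \<mu>) (at z0 within S)" by (intro tendsto_intros r)
    ultimately have "(h \<longlongrightarrow> (s * 1) ^ \<mu>) (at z0 within S)" by (rule Lim_transform_eventually[rotated])
    then show "(h \<longlongrightarrow> h z0) (at z0 within S)" using h[OF s] by simp
  qed
  have hl: "h z ^ l = eval3 F z" if z: "z \<in> S" for z
  proof -
    obtain s where s: "(z, s) \<in> K" using ne[OF z] by blast
    then have "s ^ m = eval3 F z" using KE by (auto simp: E_def)
    then show ?thesis using h[OF s] by (simp add: l power_mult)
  qed
  \<comment> \<open>The scaling orbit of a point of \<open>K\<close> is connected and lies in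
    \<open>E\<close>, so it stays in \<open>K\<close>; this gives \<open>h\<close> the weight
    \<open>\<mu> * n\<close>.\<close>
  have hs: "h (c *s z) = c ^ (\<mu> * n) * h z" if c: "c \<noteq> 0" and z: "z \<in> S" for c z
  proof -
    obtain s where s: "(z, s) \<in> K" using ne[OF z] by blast
    define C where "C = (\<lambda>c. (c *s z, c ^ n * s)) ` (- {0 :: complex})"
    have "continuous_on (- {0 :: complex}) (\<lambda>c. \<chi> i. c * z $ i)" by (intro continuous_intros)
    then have "continuous_on (- {0}) (\<lambda>c. c *s z)" by (simp add: vector_scalar_mult_def)
    then have "connected C"
      unfolding C_def by (intro connected_continuous_image connected_punctured_complex continuous_intros)
    moreover have "C \<subseteq> E" using E_scale s KE by (auto simp: C_def)
    moreover have "(z, s) \<in> C" unfolding C_def by (rule image_eqI[of _ _ 1]) auto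
    ultimately have "C \<subseteq> K" using clopen_absorbs[of E K C] K(1) s unfolding clopen_def by blast
    then have "(c *s z, c ^ n * s) \<in> K" using c unfolding C_def by blast
    then show ?thesis using h[OF s] h[of "c *s z" "c ^ n * s"] by (simp add: power_mult_distrib power_mult[symmetric] mult.commute)
  qed
  show ?thesis using that[OF l cont hl hs] conn unfolding Keq by blast
qed

lemma topspace_N0: "topspace (subtopology X N0) = N0"
  by (auto simp: N0_def)

text \<open>Translating the connected sheet by \<open>v\<close> with \<open>v ^ \<mu> = w\<close>,
  for each of the \<open>l\<close> roots of unity \<open>w\<close>, gives connected pieces that
  cover \<open>N0\<close>.\<close>

lemma components_upper:
  assumes m_eq: "m = \<mu> * l" and h: "\<And>z. z \<in> S \<Longrightarrow> h z ^ l = eval3 F z"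
    and conn: "connected {(z, s). (z, s) \<in> E \<and> s ^ \<mu> = h z}"
  shows "finite (connected_components_of (subtopology X N0))"
    "card (connected_components_of (subtopology X N0)) \<le> l"
proof -
  have pos: "\<mu> > 0" "l > 0" using m m_eq by auto
  define K where "K w = Phi ` {(z, s). (z, s) \<in> E \<and> s ^ \<mu> = w * h z}" for w
  define I where "I = {w :: complex. w ^ l = 1}"
  have I: "finite I" "card I = l" unfolding I_def using pos by (auto simp: card_roots_unity_eq intro: finite_roots_unity)
  have hz: "h z \<noteq> 0" if "z \<in> S" for z using h[OF that] S_F[OF that] pos by (auto simp: zero_power)
  have cov: "topspace (subtopology X N0) = (\<Union>w\<in>I. K w)"
    unfolding topspace_N0
  proof
    show "N0 \<subseteq> (\<Union>w\<in>I. K w)"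
    proof
      fix x assume "x \<in> N0"
      then obtain z s where zs: "(z, s) \<in> E" "x = Phi (z, s)" by (rule N0_point)
      have z: "z \<in> S" "s ^ m = eval3 F z" using zs by (auto simp: E_def)
      define w where "w = s ^ \<mu> / h z"
      have "w ^ l = 1" using h[OF z(1)] z S_F[OF z(1)] by (simp add: w_def power_divide power_mult[symmetric] m_eq)
      moreover have "x \<in> K w" unfolding K_def zs(2) using zs(1) hz[OF z(1)] by (intro imageI) (simp add: w_def)
      ultimately show "x \<in> (\<Union>w\<in>I. K w)" by (auto simp: I_def)
    qed
    show "(\<Union>w\<in>I. K w) \<subseteq> N0" using Phi_N0 by (auto simp: K_def)
  qed
  have "connectedin (subtopology X N0) (K w)" if w: "w \<in> I" for w
  proof -
    obtain v :: complex where v: "v ^ \<mu> = w" using nth_root_exists[OF pos(1)] by blast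
    have vm: "v ^ m = 1" using w v by (simp add: m_eq power_mult I_def)
    have v0: "v \<noteq> 0" using vm m by (auto simp: zero_power)
    have "{(z, s). (z, s) \<in> E \<and> s ^ \<mu> = w * h z} = (\<lambda>p. (fst p, v * snd p)) ` {(z, s). (z, s) \<in> E \<and> s ^ \<mu> = h z}" (is "?A = ?f ` ?B")
    proof
      show "?f ` ?B \<subseteq> ?A" using vm v by (auto simp: E_def power_mult_distrib)
      show "?A \<subseteq> ?f ` ?B"
      proof
        fix p assume p: "p \<in> ?A"
        obtain z s where zs: "p = (z, s)" by (cases p)
        have w0: "w \<noteq> 0" using v v0 by auto
        have "(z, s / v) \<in> ?B" using p vm v v0 w0 by (auto simp: zs E_def power_divide)
        then show "p \<in> ?f ` ?B" using v0 by (intro image_eqI[of _ _ "(z, s / v)"]) (auto simp: zs)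
      qed
    qed
    then have "connected ?A"
      by (simp only:) (intro connected_continuous_image conn continuous_intros)
    then have "connectedin (top_of_set E) ?A" by (auto simp: connectedin_subtopology)
    then show ?thesis unfolding K_def by (rule connectedin_continuous_map_image[OF Phi_continuous_N0])
  qed
  from card_components_le[OF I(1) cov this] I(2)
  show "finite (connected_components_of (subtopology X N0))"
    "card (connected_components_of (subtopology X N0)) \<le> l" by auto
qed

lemma components_lower:
  assumes l: "l dvd m" and h: "root_section l (m div l * n) F H hh"
    and fin: "finite (connected_components_of (subtopology X N0))"
  shows "l \<le> card (connected_components_of (subtopology X N0))"
proof -
  define \<mu> where "\<mu> = m div l"
  have m_eq: "m = \<mu> * l" using l by (simp add: \<mu>_def)
  then have pos: "\<mu> > 0" "l > 0" using m by auto
  have hF': "homogeneous (\<mu> * n * l) F" using hF by (simp add: m_eq mult_ac)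
  obtain \<eta> where \<eta>: "continuous_on {z. z \<noteq> 0 \<and> eval3 H z = 0} \<eta>"
    "\<And>z. z \<noteq> 0 \<Longrightarrow> eval3 H z = 0 \<Longrightarrow> hh (proj_pt z) = bundle_point (\<mu> * n) (z, \<eta> z)"
    "\<And>z. z \<noteq> 0 \<Longrightarrow> eval3 H z = 0 \<Longrightarrow> \<eta> z ^ l = eval3 F z"
    "\<And>z c. z \<noteq> 0 \<Longrightarrow> eval3 H z = 0 \<Longrightarrow> c \<noteq> 0 \<Longrightarrow> \<eta> (c *s z) = c ^ (\<mu> * n) * \<eta> z"
    using root_section_function[OF h[folded \<mu>_def] hH hF'] by blast
  have SR: "S \<subseteq> {z. z \<noteq> 0 \<and> eval3 H z = 0}" by (auto simp: vcone_def)
  have cS: "continuous_on S \<eta>" by (rule continuous_on_subset[OF \<eta>(1) SR])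
  have pw: "\<eta> z ^ l = eval3 F z" if "z \<in> S" for z using \<eta>(3) SR that by blast
  have sc: "\<eta> (c *s z) = c ^ (\<mu> * n) * \<eta> z" if "c \<noteq> 0" "z \<in> S" for c z using \<eta>(4) SR that by blast
  have nz: "\<eta> z \<noteq> 0" if "z \<in> S" for z using pw[OF that] S_F[OF that] pos by (auto simp: zero_power)
  define I where "I = {w :: complex. w ^ l = 1}"
  have I: "finite I" "card I = l" unfolding I_def using pos by (auto simp: card_roots_unity_eq intro: finite_roots_unity)
  have val: "s ^ \<mu> / \<eta> z \<in> I" if zs: "(z, s) \<in> E" for z s
  proof -
    have z: "z \<in> S" "s ^ m = eval3 F z" using zs by (auto simp: E_def)
    then show ?thesis using pw[OF z(1)] S_F[OF z(1)]
      by (simp add: I_def power_divide power_mult[symmetric] m_eq)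
  qed
  define U where "U w = {Phi (z, s) | z s. (z, s) \<in> E \<and> s ^ \<mu> / \<eta> z = w}" for w
  have "card I \<le> card (connected_components_of (subtopology X N0))"
  proof (rule card_components_ge[OF fin, where U=U])
    show "topspace (subtopology X N0) = (\<Union>i\<in>I. U i)"
      unfolding topspace_N0
    proof
      show "N0 \<subseteq> (\<Union>i\<in>I. U i)"
      proof
        fix x assume "x \<in> N0"
        then obtain z s where "(z, s) \<in> E" "x = Phi (z, s)" by (rule N0_point)
        then show "x \<in> (\<Union>i\<in>I. U i)" using val unfolding U_def by blast
      qed
      show "(\<Union>i\<in>I. U i) \<subseteq> N0" using Phi_N0 by (auto simp: U_def)
    qed
    show "openin (subtopology X N0) (U w)" for w
      unfolding U_def by (rule fibrewise_open[OF cS nz sc I(1) val])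
    \<comment> \<open>Every value is attained over every base point, namely at any
      \<open>\<mu>\<close>-th root of \<open>w * \<eta> z\<close>.\<close>
    show "U w \<noteq> {}" if w: "w \<in> I" for w
    proof -
      obtain z where z: "z \<in> S" using S_nonempty by blast
      obtain s where s: "s ^ \<mu> = w * \<eta> z" using nth_root_exists[OF pos(1)] by blast
      have "s ^ m = (w * \<eta> z) ^ l" unfolding s[symmetric] by (simp add: m_eq power_mult)
      also have "\<dots> = eval3 F z" using w pw[OF z] by (simp add: I_def power_mult_distrib)
      finally have "(z, s) \<in> E" using z by (simp add: E_def)
      moreover have "s ^ \<mu> / \<eta> z = w" using s nz[OF z] by simp
      ultimately show ?thesis unfolding U_def by blast
    qed
    \<comment> \<open>Numerator and denominator both have weight \<open>\<mu> * n\<close>, so the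
      quotient depends only on the point of the bundle.\<close>
    show "U w \<inter> U w' = {}" if "w \<noteq> w'" for w w'
    proof (rule ccontr)
      assume "U w \<inter> U w' \<noteq> {}"
      then obtain z s z' s' where p: "(z, s) \<in> E" "(z', s') \<in> E" "Phi (z, s) = Phi (z', s')"
        "s ^ \<mu> / \<eta> z = w" "s' ^ \<mu> / \<eta> z' = w'" unfolding U_def by blast
      then have "bundle_point n (z, s) = bundle_point n (z', s')" by (simp add: Phi_def)
      then obtain c where c: "c \<noteq> 0" "z' = c *s z" "s' = c ^ n * s" by (rule bundle_point_eqD)
      have "z \<in> S" using p(1) by (simp add: E_def)
      then have "s' ^ \<mu> / \<eta> z' = s ^ \<mu> / \<eta> z"
        unfolding c(2,3) using sc[OF c(1)] c(1) by (simp add: power_mult_distrib power_mult[symmetric] mult.commute)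
      then show False using p that by simp
    qed
  qed
  then show ?thesis using I by simp
qed

end

section \<open>Curves with smooth components\<close>

lemma homogeneous_0_constant:
  assumes "homogeneous 0 P" shows "P = const3 (ev P 0 0 0)"
proof (rule ev_eqI)
  fix x w y
  show "ev P x w y = ev (const3 (ev P 0 0 0)) x w y"
    using homogeneous_ev[OF assms, of 0 x w y] by simp
qed

lemma const3_unit: "c \<noteq> 0 \<Longrightarrow> const3 c dvd 1"
  by (rule dvdI[of _ _ "const3 (1 / c)"]) (simp add: const3_mult)

lemma homogeneous_0_unit: "homogeneous 0 P \<Longrightarrow> P \<noteq> 0 \<Longrightarrow> P dvd 1"
  using homogeneous_0_constant const3_unit by (metis const3_0)

lemma unit_homogeneous_0:
  assumes "P dvd 1" "homogeneous e P" shows "e = 0"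
proof -
  obtain Q where Q: "1 = P * Q" using assms(1) by (rule dvdE)
  have "homogeneous 0 (Q * P)" "Q * P \<noteq> 0" using Q by (simp_all add: mult.commute)
  then obtain k where k: "homogeneous k Q" by (rule homogeneous_factor)
  have "e + k = 0" using homogeneous_unique[OF homogeneous_mult[OF assms(2) k], of 0] Q by simp
  then show ?thesis by simp
qed

lemma locus_dvd: "P dvd Q \<Longrightarrow> locus P \<subseteq> locus Q"
  unfolding locus_def using eval3_dvd by blast

locale smooth_components = cyclic_algebra +
  fixes n :: nat and H Bp :: poly3 and e b :: nat
  assumes hF: "homogeneous (m * n) F" and hH: "homogeneous e H" and hB: "homogeneous b Bp"
    and F_zero: "\<And>z. eval3 F z = 0 \<Longrightarrow> eval3 Bp z = 0"
    and H_nz: "H \<noteq> 0" and e: "e > 0"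
    and smooth: "\<And>P z. component P H \<Longrightarrow> z \<noteq> 0 \<Longrightarrow> eval3 P z = 0 \<Longrightarrow> smooth_at P z"
    and smooth_H: "\<And>z. z \<noteq> 0 \<Longrightarrow> eval3 H z = 0 \<Longrightarrow> eval3 Bp z = 0 \<Longrightarrow> smooth_at H z"
    and no_common: "\<And>P. component P H \<Longrightarrow> \<not> P dvd Bp"
begin

sublocale cover_data m F n H Bp e b
  by unfold_locales (rule hF hH hB F_zero; assumption?)+

lemma component_form:
  assumes "component P H"
  obtains d where "homogeneous d P" "d > 0" "irreducible P"
proof -
  have P: "irreducible P" "P dvd H" using assms by (auto simp: component_def)
  obtain d where d: "homogeneous d P" using homogeneous_dvd[OF hH P(2) H_nz] by blast
  have "\<not> P dvd 1" "P \<noteq> 0" using P(1) by (auto simp: irreducible_def)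
  then have "d \<noteq> 0" using homogeneous_0_unit d by metis
  then show ?thesis using that d P by simp
qed

lemma vcone_component: "component P H \<Longrightarrow> vcone P Bp \<subseteq> S"
  unfolding vcone_def component_def using eval3_dvd by blast

text \<open>The curve is singular where two components cross and smooth on the branch curve, so
  crossings avoid \<open>Bp\<close>. Both the connectedness of \<open>S\<close> and the gluing of
  forms rest on this.\<close>

lemma intersection_not_branch:
  assumes "P \<in> prime_factors H" "Q \<in> prime_factors H" "P \<noteq> Q" "z \<noteq> 0" "eval3 P z = 0" "eval3 Q z = 0"
  shows "z \<in> vcone P Bp \<inter> vcone Q Bp"
proof -
  have d: "P * Q dvd H" by (rule prime_factors_mult_dvd[OF assms(1-3)])
  then have "\<not> smooth_at H z" using assms(5,6) by (rule not_smooth_at_product)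
  moreover have "eval3 H z = 0" using eval3_dvd[OF d] assms(5) by simp
  ultimately have "eval3 Bp z \<noteq> 0" using smooth_H[OF assms(4)] by blast
  then show ?thesis using assms by (simp add: vcone_def)
qed

lemma ex_component: "\<exists>P. P \<in> prime_factors H"
proof (rule ccontr)
  assume "\<not> ?thesis"
  then have "prime_factorization H = {#}" by (metis set_mset_eq_empty_iff equals0I)
  then have "H dvd 1" using H_nz by (auto simp: prime_factorization_empty_iff)
  then show False using unit_homogeneous_0[OF _ hH] e by simp
qed

lemma component_connected:
  assumes "component P H" shows "connected (vcone P Bp)" "vcone P Bp \<noteq> {}"
proof -
  obtain d where d: "homogeneous d P" "d > 0" "irreducible P" using component_form[OF assms] by blast
  show "connected (vcone P Bp)" by (rule vcone_connected[OF d smooth[OF assms] hB no_common[OF assms]])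
  show "vcone P Bp \<noteq> {}" by (rule vcone_nonempty[OF d hB no_common[OF assms]])
qed

lemma S_cover: "S = (\<Union>P\<in>prime_factors H. vcone P Bp)"
proof
  show "(\<Union>P\<in>prime_factors H. vcone P Bp) \<subseteq> S" using vcone_component prime_factors_component by blast
  show "S \<subseteq> (\<Union>P\<in>prime_factors H. vcone P Bp)"
  proof
    fix z assume z: "z \<in> S"
    then obtain P where "P \<in> prime_factors H" "eval3 P z = 0"
      using eval3_prime_factors[OF H_nz, of z] by (auto simp: vcone_def)
    then show "z \<in> (\<Union>P\<in>prime_factors H. vcone P Bp)" using z by (auto simp: vcone_def)
  qed
qed

lemma connected_S: "connected S"
  unfolding connected_clopen
proof (intro allI impI)
  fix T assume T: "openin (top_of_set S) T \<and> closedin (top_of_set S) T"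
  have TS: "T \<subseteq> S" using T by (auto dest: openin_imp_subset)
  have all: "vcone P Bp \<subseteq> T" if P: "P \<in> prime_factors H" "vcone P Bp \<inter> T \<noteq> {}" for P
  proof -
    have c: "component P H" by (rule prime_factors_component[OF P(1)])
    show ?thesis
      by (rule clopen_absorbs[OF T[THEN conjunct1] T[THEN conjunct2] component_connected(1)[OF c] vcone_component[OF c] P(2)])
  qed
  have meet: "vcone P Bp \<inter> vcone Q Bp \<noteq> {}" if PQ: "P \<in> prime_factors H" "Q \<in> prime_factors H" "P \<noteq> Q" for P Q
  proof -
    have c: "component P H" "component Q H" using PQ prime_factors_component by auto
    obtain d where d: "homogeneous d P" "d > 0" "irreducible P" using component_form[OF c(1)] by blast
    obtain k where k: "homogeneous k Q" "k > 0" "irreducible Q" using component_form[OF c(2)] by blast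
    obtain z where z: "z \<noteq> 0" "eval3 P z = 0" "eval3 Q z = 0"
      using curves_meet[OF d smooth[OF c(1)] k(1,2)] by blast
    then show ?thesis using intersection_not_branch[OF PQ z] by blast
  qed
  show "T = {} \<or> T = S"
  proof (rule disjCI)
    assume "T \<noteq> S"
    then obtain z where "z \<in> S" "z \<notin> T" using TS by blast
    then obtain Q where Q: "Q \<in> prime_factors H" "\<not> vcone Q Bp \<subseteq> T" unfolding S_cover by blast
    show "T = {}"
    proof (rule ccontr)
      assume "T \<noteq> {}"
      then obtain P where P: "P \<in> prime_factors H" "vcone P Bp \<inter> T \<noteq> {}" using TS unfolding S_cover by blast
      then have "vcone P Bp \<subseteq> T" by (rule all)
      moreover have "P \<noteq> Q" using Q(2) calculation by blast
      ultimately have "vcone Q Bp \<inter> T \<noteq> {}" using meet[OF P(1) Q(1)] by blast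
      then show False using all[OF Q(1)] Q(2) by blast
    qed
  qed
qed

lemma nonempty_S: "S \<noteq> {}"
  using ex_component component_connected(2) prime_factors_component vcone_component by blast

sublocale connected_cover_data m F n H Bp e b
  by unfold_locales (rule connected_S nonempty_S)+

text \<open>On each component \<open>h\<close> is given by a form, which also supplies the values at
  points of \<open>Bp\<close>. At a crossing of two components, which avoids \<open>Bp\<close>, both
  forms equal \<open>h\<close>, so they glue along the finite closed cover by components.\<close>

lemma root_section_exists:
  assumes m_eq: "m = \<mu> * l" and h: "continuous_on S h" "\<And>z. z \<in> S \<Longrightarrow> h z ^ l = eval3 F z"
    "\<And>c z. c \<noteq> 0 \<Longrightarrow> z \<in> S \<Longrightarrow> h (c *s z) = c ^ (\<mu> * n) * h z"
  shows "\<exists>hh. root_section l (\<mu> * n) F H hh"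
proof -
  have l: "l > 0" using m m_eq by auto
  have hF': "homogeneous (\<mu> * n * l) F" using hF by (simp add: m_eq mult_ac)
  have "\<exists>G. homogeneous (\<mu> * n) G \<and> (\<forall>z\<in>vcone P Bp. h z = eval3 G z)" if P: "P \<in> prime_factors H" for P
  proof -
    have c: "component P H" by (rule prime_factors_component[OF P])
    have sub: "vcone P Bp \<subseteq> S" by (rule vcone_component[OF c])
    obtain d where d: "homogeneous d P" "d > 0" "irreducible P" using component_form[OF c] by blast
    have "\<exists>G. (int (\<mu> * n) \<ge> 0 \<longrightarrow> homogeneous (nat (int (\<mu> * n))) G) \<and> (int (\<mu> * n) < 0 \<longrightarrow> G = 0) \<and>
        (\<forall>z\<in>vcone P Bp. h z = eval3 G z)"
    proof (rule vcone_function_is_form[OF d smooth[OF c] hB no_common[OF c], where A=F and Q=1 and l=l])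
      show "eval3 F z \<noteq> 0" if "z \<in> vcone P Bp" for z using S_F sub that by blast
      show "continuous_on (vcone P Bp) h" by (rule continuous_on_subset[OF h(1) sub])
      show "h (c *s z) = c powi int (\<mu> * n) * h z" if "c \<noteq> 0" "z \<in> vcone P Bp" for c z
        unfolding power_int_of_nat using h(3) sub that by blast
      show "h z ^ l * eval3 1 z = eval3 F z" if "z \<in> vcone P Bp" for z using h(2)[of z] sub that by auto
    qed (use l in auto)
    then obtain G where "int (\<mu> * n) \<ge> 0 \<longrightarrow> homogeneous (nat (int (\<mu> * n))) G" "\<forall>z\<in>vcone P Bp. h z = eval3 G z"
      by blast
    moreover from this have "homogeneous (\<mu> * n) G" by (simp only: nat_int of_nat_0_le_iff)
    ultimately show ?thesis by blast
  qed
  then obtain G where G: "\<And>P. P \<in> prime_factors H \<Longrightarrow> homogeneous (\<mu> * n) (G P)"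
    "\<And>P z. P \<in> prime_factors H \<Longrightarrow> z \<in> vcone P Bp \<Longrightarrow> h z = eval3 (G P) z" by metis
  \<comment> \<open>The power identity is a closed condition and holds on a dense part of the
    component, hence also on \<open>Bp\<close>.\<close>
  have Gl: "eval3 (G P) z ^ l = eval3 F z" if P: "P \<in> prime_factors H" and z: "z \<noteq> 0" "eval3 P z = 0" for P z
  proof -
    have c: "component P H" by (rule prime_factors_component[OF P])
    obtain d where d: "homogeneous d P" "d > 0" "irreducible P" using component_form[OF c] by blast
    have "closed {z. eval3 (G P) z ^ l = eval3 F z}" by (intro closed_Collect_eq continuous_intros)
    moreover have "vcone P Bp \<subseteq> {z. eval3 (G P) z ^ l = eval3 F z}"
      using G(2)[OF P] h(2) vcone_component[OF c] by fastforce
    ultimately have "closure (vcone P Bp) \<subseteq> {z. eval3 (G P) z ^ l = eval3 F z}" by (rule closure_minimal[rotated])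
    then show ?thesis using vcone_closure[OF d hB no_common[OF c] z] by blast
  qed
  have agree: "bundle_section (G P) x = bundle_section (G Q) x"
    if PQ: "P \<in> prime_factors H" "Q \<in> prime_factors H" and x: "x \<in> locus P" "x \<in> locus Q" for P Q x
  proof (cases "P = Q")
    case False
    obtain z where z: "z \<noteq> 0" "eval3 P z = 0" "x = proj_pt z" using x(1) by (rule locusE)
    obtain k where "homogeneous k Q" using component_form[OF prime_factors_component[OF PQ(2)]] by blast
    then have "eval3 Q z = 0" using x(2) proj_pt_locus z by blast
    then have "z \<in> vcone P Bp \<inter> vcone Q Bp" using intersection_not_branch[OF PQ False z(1,2)] by blast
    then have "eval3 (G P) z = eval3 (G Q) z" using G(2)[OF PQ(1)] G(2)[OF PQ(2)] by (metis IntE)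
    then show ?thesis unfolding z(3) by (simp add: bundle_section_point[OF G(1)[OF PQ(1)]] bundle_section_point[OF G(1)[OF PQ(2)]])
  qed simp
  have cov: "\<exists>P. P \<in> prime_factors H \<and> x \<in> locus P" if x: "x \<in> locus H" for x
  proof -
    obtain z where z: "z \<noteq> 0" "eval3 H z = 0" "x = proj_pt z" using x by (rule locusE)
    obtain P where "P \<in> prime_factors H" "eval3 P z = 0" by (rule eval3_prime_factors[OF H_nz z(2)])
    then show ?thesis using z by (auto simp: locus_def)
  qed
  define hh where "hh x = bundle_section (G (SOME P. P \<in> prime_factors H \<and> x \<in> locus P)) x" for x
  have hh: "hh x = bundle_section (G P) x" if P: "P \<in> prime_factors H" and x: "x \<in> locus P" for P x
  proof -
    have "(SOME P. P \<in> prime_factors H \<and> x \<in> locus P) \<in> prime_factors H \<and> x \<in> locus (SOME P. P \<in> prime_factors H \<and> x \<in> locus P)"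
      using P x by (intro someI_ex[of "\<lambda>P. P \<in> prime_factors H \<and> x \<in> locus P"]) blast
    then show ?thesis unfolding hh_def using agree[OF _ P _ x] by blast
  qed
  have ts: "topspace (subtopology P2 (locus H)) = locus H"
    by (auto simp: topspace_P2 locus_def)
  have point: "\<exists>P z. P \<in> prime_factors H \<and> z \<noteq> 0 \<and> eval3 P z = 0 \<and> x = proj_pt z \<and>
      hh x = bundle_point (\<mu> * n) (z, eval3 (G P) z)" if x: "x \<in> locus H" for x
  proof -
    obtain P where P: "P \<in> prime_factors H" "x \<in> locus P" using cov[OF x] by blast
    obtain z where z: "z \<noteq> 0" "eval3 P z = 0" "x = proj_pt z" using P(2) by (rule locusE)
    have "hh x = bundle_point (\<mu> * n) (z, eval3 (G P) z)"
      unfolding hh[OF P] unfolding z(3) by (rule bundle_section_point[OF G(1)[OF P(1)]])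
    then show ?thesis using P z by blast
  qed
  have "root_section l (\<mu> * n) F H hh"
    unfolding root_section_def
  proof (intro conjI allI impI ballI)
    show "continuous_map (subtopology P2 (locus H)) (total_space (\<mu> * n)) hh"
    proof (rule pasting_lemma_closed[of "prime_factors H" _ locus _ "\<lambda>P. bundle_section (G P)"])
      show "finite (prime_factors H)" by simp
      fix P assume P: "P \<in> prime_factors H"
      obtain d where d: "homogeneous d P" using component_form[OF prime_factors_component[OF P]] by blast
      have "locus P \<subseteq> locus H" using P by (intro locus_dvd) (auto simp: in_prime_factors_iff)
      then show "closedin (subtopology P2 (locus H)) (locus P)"
        using closedin_locus[OF d] by (metis closedin_subset_topspace)
      show "continuous_map (subtopology (subtopology P2 (locus H)) (locus P)) (total_space (\<mu> * n)) (bundle_section (G P))"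
        by (intro continuous_map_from_subtopology continuous_bundle_section G(1)[OF P])
    next
      fix P Q x assume "P \<in> prime_factors H" "Q \<in> prime_factors H"
        "x \<in> topspace (subtopology P2 (locus H)) \<inter> locus P \<inter> locus Q"
      then show "bundle_section (G P) x = bundle_section (G Q) x" using agree by blast
    next
      fix x assume "x \<in> topspace (subtopology P2 (locus H))"
      then show "\<exists>P. P \<in> prime_factors H \<and> x \<in> locus P \<and> hh x = bundle_section (G P) x"
        unfolding ts using cov hh by blast
    qed
  next
    fix x assume "x \<in> locus H"
    then show "bundle_proj (hh x) = x" using point bundle_proj_point by metis
  next
    fix x assume "x \<in> locus H"
    then obtain P z where P: "P \<in> prime_factors H" "z \<noteq> 0" "eval3 P z = 0" "x = proj_pt z"
      "hh x = bundle_point (\<mu> * n) (z, eval3 (G P) z)" using point by blast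
    show "bundle_power l (hh x) = bundle_section F x"
      unfolding P(5) bundle_power_point Gl[OF P(1-3)] unfolding P(4) bundle_section_point[OF hF'] ..
  next
    fix P assume P: "component P H"
    \<comment> \<open>The forms are indexed by normalised primes, so an arbitrary component is
      handled through its associate.\<close>
    then have P': "normalize P \<in> prime_factors H" using H_nz by (rule component_associated)
    have "locus P \<subseteq> locus (normalize P)" by (rule locus_dvd) simp
    then have "\<forall>x\<in>locus P. hh x = bundle_section (G (normalize P)) x" using hh[OF P'] by blast
    then show "\<exists>g. homogeneous (\<mu> * n) g \<and> (\<forall>x\<in>locus P. hh x = bundle_section g x)"
      using G(1)[OF P'] by blast
  qed
  then show ?thesis by blast
qed

text \<open>Both bounds meet at the \<open>l\<close> of the minimal sheet: its translates give at
  most \<open>l\<close> components, and its function, extended to a section on the whole curve,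
  separates at least \<open>l\<close>. The lower bound applied to any other section gives
  maximality.\<close>

lemma connected_number_maximal:
  defines "c \<equiv> card (connected_components_of (subtopology X N0))"
  shows "c dvd m" "\<exists>hh. root_section c (m div c * n) F H hh"
    "\<And>l hh. l dvd m \<Longrightarrow> root_section l (m div l * n) F H hh \<Longrightarrow> l \<le> c"
proof -
  obtain \<mu> l h where l: "m = \<mu> * l" "continuous_on S h" "\<And>z. z \<in> S \<Longrightarrow> h z ^ l = eval3 F z"
    "\<And>c z. c \<noteq> 0 \<Longrightarrow> z \<in> S \<Longrightarrow> h (c *s z) = c ^ (\<mu> * n) * h z"
    "connected {(z, s). (z, s) \<in> E \<and> s ^ \<mu> = h z}"
    using minimal_sheet by blast
  have fin: "finite (connected_components_of (subtopology X N0))" and cl: "c \<le> l"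
    unfolding c_def using components_upper[OF l(1,3,5)] by auto
  show le: "l \<le> c" if "l dvd m" "root_section l (m div l * n) F H hh" for l hh
    unfolding c_def by (rule components_lower[OF that fin])
  have l0: "l > 0" using m l(1) by auto
  then have \<mu>: "m div l = \<mu>" using l(1) by simp
  obtain hh where hh: "root_section l (\<mu> * n) F H hh" using root_section_exists[OF l(1-4)] by blast
  then have "l \<le> c" using le[of l hh] l(1) \<mu> by simp
  with cl have "c = l" by simp
  then show "c dvd m" "\<exists>hh. root_section c (m div c * n) F H hh" using hh \<mu> l(1) by auto
qed

end

theorem theorem2p4:
  fixes m n lam mu e :: nat
    and B :: "nat \<Rightarrow> poly3" and d :: "nat \<Rightarrow> nat"
    and H F :: poly3
  assumes m: "m \<ge> 2"
    and B_form: "\<And>i. i \<in> {1..m - 1} \<Longrightarrow> homogeneous (d i) (B i)"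
    and B_reduced: "squarefree (\<Prod>i = 1..m - 1. B i)"
    and C_form: "homogeneous e H" and C_nonempty: "e > 0"
    and C_reduced: "squarefree H"
    and no_common_component:
      "\<nexists>P. component P H \<and> component P (\<Prod>i = 1..m - 1. B i)"
    and degree_dvd: "m dvd (\<Sum>i = 1..m - 1. i * d i)"
    and components_smooth:
      "\<And>P z. component P H \<Longrightarrow> z \<noteq> 0 \<Longrightarrow> eval3 P z = 0 \<Longrightarrow> smooth_at P z"
    and smooth_at_intersections:
      "\<And>z. z \<noteq> 0 \<Longrightarrow> eval3 H z = 0 \<Longrightarrow> eval3 (\<Prod>i = 1..m - 1. B i) z = 0 \<Longrightarrow> smooth_at H z"
    and n_def: "n = (\<Sum>i = 1..m - 1. i * d i) div m"
    and F_section: "homogeneous (m * n) F"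
    and F_defines: "same_divisor F (\<Prod>i = 1..m - 1. B i ^ i)"
    and lam: "lam > 0" and m_eq: "m = mu * lam"
  shows
    "connected_number (cyclic_cover m n F) cyclic_cover_map
       (locus (\<Prod>i = 1..m - 1. B i)) (locus H) = lam
     \<longleftrightarrow>
     (\<exists>h. root_section lam (mu * n) F H h) \<and>
     (\<forall>l. l dvd m \<and> (\<exists>h. root_section l (m div l * n) F H h) \<longrightarrow> l \<le> lam)"
proof -
  define Bp where "Bp = (\<Prod>i = 1..m - 1. B i)"
  have hBp: "homogeneous (\<Sum>i = 1..m - 1. d i) Bp"
    unfolding Bp_def using B_form by (rule homogeneous_prod)
  \<comment> \<open>The exponents in \<open>F\<close> affect multiplicities only: a zero of
    \<open>F\<close> is a zero of some \<open>B i\<close>.\<close>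
  have F_zero: "eval3 Bp z = 0" if "eval3 F z = 0" for z
  proof -
    have "eval3 (\<Prod>i = 1..m - 1. B i ^ i) z = 0"
      using F_defines that unfolding same_divisor_def by (blast intro: eval3_dvd)
    then show ?thesis by (auto simp: Bp_def)
  qed
  have H0: "H \<noteq> 0" using C_reduced by auto
  interpret smooth_components m F n H Bp e "\<Sum>i = 1..m - 1. d i"
  proof
    show "m > 0" using m by simp
    show "\<not> P dvd Bp" if "component P H" for P
      using no_common_component that unfolding component_def Bp_def by blast
  qed (use F_section C_form hBp F_zero H0 C_nonempty components_smooth smooth_at_intersections in
      \<open>auto simp: Bp_def\<close>)
  define c where "c = card (connected_components_of (subtopology X N0))"
  note max = connected_number_maximal[folded c_def]
  have cn: "connected_number (cyclic_cover m n F) cyclic_cover_map (locus (\<Prod>i = 1..m - 1. B i)) (locus H) = c"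
    unfolding connected_number_def cyclic_cover_def c_def Bp_def[symmetric] N0_def unfolding W_def ..
  have mu: "mu = m div lam" using lam m_eq by simp
  show ?thesis
    unfolding cn
  proof
    assume c: "c = lam"
    have "\<exists>h. root_section lam (mu * n) F H h" using max(2) unfolding c mu .
    moreover have "l \<le> lam" if "l dvd m" "root_section l (m div l * n) F H h" for l h
      using max(3)[OF that] c by simp
    ultimately show "(\<exists>h. root_section lam (mu * n) F H h) \<and>
       (\<forall>l. l dvd m \<and> (\<exists>h. root_section l (m div l * n) F H h) \<longrightarrow> l \<le> lam)" by blast
  next
    assume R: "(\<exists>h. root_section lam (mu * n) F H h) \<and>
       (\<forall>l. l dvd m \<and> (\<exists>h. root_section l (m div l * n) F H h) \<longrightarrow> l \<le> lam)"
    \<comment> \<open>The number \<open>c\<close> is itself admissible, so maximality of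
      \<open>lam\<close> bounds it from above; the counting bound for the section given at
      \<open>lam\<close> yields the other inequality.\<close>
    then have "c dvd m \<and> (\<exists>h. root_section c (m div c * n) F H h) \<longrightarrow> c \<le> lam" by blast
    then have "c \<le> lam" using max(1,2) by simp
    moreover have "lam \<le> c"
    proof -
      obtain h where "root_section lam (m div lam * n) F H h" using R mu by blast
      moreover have "lam dvd m" using m_eq by simp
      ultimately show ?thesis using max(3) by simp
    qed
    ultimately show "c = lam" by simp
  qed
qed

end
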